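(* Let $f\in L^2(\mathbb{R}^n)$ satisfy $$K_a(f) = \int_{\mathbb{R}^n}\int_{\mathbb{R}^n} |f(x)|\,|\hat f(y)|\, e^{a|x\cdot y|}\,dx\,dy < \infty$$ for some $a>0$. Then $f$ is an entire vector for the Schr\"odinger representation $\pi$ of the Heisenberg group $\mathbb{H}^n$.
   Context: The Fourier transform is $\hat f(y) = (2\pi)^{-n/2}\int_{\mathbb{R}^n} f(x) e^{-i x\cdot y}\,dx$, extended to $L^2(\mathbb{R}^n)$ as usual. The Schr\"odinger representation $\pi$ acts on $L^2(\mathbb{R}^n)$ (with the central variable suppressed) by $$\pi(x,u)f(\xi) = e^{i(x\cdot\xi+\frac12 x\cdot u)} f(\xi+u),\qquad (x,u)\in\mathbb{R}^{2n},\ \xi\in\mathbb{R}^n.$$ A function $f\in L^2(\mathbb{R}^n)$ is an entire vector for $\pi$ if the map $(x,u)\mapsto \pi(x,u)f$ from $\mathbb{R}^{2n}$ into $L^2(\mathbb{R}^n)$ extends to $\mathbb{C}^{2n}$ as an entire ($L^2(\mathbb{R}^n)$-valued) function, whose value at $(x+iy,u+iv)$ is denoted $\pi(x+iy,u+iv)f$, and for every $t>0$ (and each $(x,u)\in\mathbb{R}^{2n}$) $$\sup_{\{(y,v)\in\mathbb{R}^{2n}:\ |y|^2+|v|^2<t^2\}} \int_{\mathbb{R}^n} |\pi(x+iy,u+iv)f(\xi)|^2\,d\xi < \infty.$$ *)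

theory Defs
  imports "HOL-Analysis.Analysis"
begin

text \<open>
  Elements of \<open>L\<^sup>2(\<real>\<^sup>n)\<close> are represented by functions \<open>real^'n \<Rightarrow> complex\<close>; equality in
  \<open>L\<^sup>2(\<real>\<^sup>n)\<close> is equality almost everywhere, and every notion below is invariant under it.
\<close>

definition L1 :: "(real^'n \<Rightarrow> complex) set" where
  "L1 = {f. integrable lebesgue f}"

definition L2 :: "(real^'n \<Rightarrow> complex) set" where
  "L2 = {f. f \<in> borel_measurable lebesgue \<and> integrable lebesgue (\<lambda>x. (cmod (f x))\<^sup>2)}"

definition L2_sqnorm :: "(real^'n \<Rightarrow> complex) \<Rightarrow> ennreal" where
  "L2_sqnorm f = (\<integral>\<^sup>+x. ennreal ((cmod (f x))\<^sup>2) \<partial>lebesgue)"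

definition L2_tendsto :: "('i \<Rightarrow> real^'n \<Rightarrow> complex) \<Rightarrow> (real^'n \<Rightarrow> complex) \<Rightarrow> 'i filter \<Rightarrow> bool" where
  "L2_tendsto g f \<F> \<longleftrightarrow> ((\<lambda>i. L2_sqnorm (\<lambda>x. g i x - f x)) \<longlongrightarrow> 0) \<F>"

definition fourier_integral :: "(real^'n \<Rightarrow> complex) \<Rightarrow> real^'n \<Rightarrow> complex" where
  "fourier_integral f y =
     of_real ((2 * pi) powr (- real CARD('n) / 2)) *
     (LINT x|lebesgue. f x * exp (- \<i> * of_real (x \<bullet> y)))"

text \<open>
  The extension by continuity of \<^const>\<open>fourier_integral\<close> from \<open>L\<^sup>1 \<inter> L\<^sup>2\<close> to \<open>L\<^sup>2\<close>: its graph
  is the closure in \<open>L\<^sup>2 \<times> L\<^sup>2\<close> of the graph over \<open>L\<^sup>1 \<inter> L\<^sup>2\<close>. By Plancherel's theorem each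
  \<open>f \<in> L\<^sup>2\<close> has a transform, unique up to null sets; \<open>fourier_L2 f\<close> is a choice of representative.
\<close>

definition has_fourier_L2 :: "(real^'n \<Rightarrow> complex) \<Rightarrow> (real^'n \<Rightarrow> complex) \<Rightarrow> bool" where
  "has_fourier_L2 f g \<longleftrightarrow> f \<in> L2 \<and> g \<in> L2 \<and>
     (\<exists>s :: nat \<Rightarrow> real^'n \<Rightarrow> complex. (\<forall>k. s k \<in> L1 \<inter> L2) \<and>
        L2_tendsto s f sequentially \<and>
        L2_tendsto (\<lambda>k. fourier_integral (s k)) g sequentially)"

definition fourier_L2 :: "(real^'n \<Rightarrow> complex) \<Rightarrow> real^'n \<Rightarrow> complex" where
  "fourier_L2 f = (SOME g. has_fourier_L2 f g)"

definition K :: "real \<Rightarrow> (real^'n \<Rightarrow> complex) \<Rightarrow> ennreal" where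
  "K a f = (\<integral>\<^sup>+x. (\<integral>\<^sup>+y. ennreal (cmod (f x) * cmod (fourier_L2 f y) * exp (a * \<bar>x \<bullet> y\<bar>))
              \<partial>lebesgue) \<partial>lebesgue)"

definition schrodinger :: "real^'n \<Rightarrow> real^'n \<Rightarrow> (real^'n \<Rightarrow> complex) \<Rightarrow> real^'n \<Rightarrow> complex" where
  "schrodinger x u f \<xi> = exp (\<i> * of_real (x \<bullet> \<xi> + (x \<bullet> u) / 2)) * f (\<xi> + u)"

definition cvec :: "real^'n \<Rightarrow> real^'n \<Rightarrow> complex^'n" where
  "cvec x y = (\<chi> j. Complex (x $ j) (y $ j))"

text \<open>
  Entire maps \<open>\<complex>\<^sup>2\<^sup>n \<rightarrow> L\<^sup>2(\<real>\<^sup>n)\<close>: complex Frechet differentiable at every point in the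
  \<open>L\<^sup>2\<close> norm. Every complex-linear map from \<open>\<complex>\<^sup>2\<^sup>n\<close> to \<open>L\<^sup>2\<close> is bounded and of the form
  \<open>(h, k) \<mapsto> \<Sum>\<^sub>j (h\<^sub>j D\<^sub>j + k\<^sub>j E\<^sub>j)\<close> with all \<open>D\<^sub>j\<close> and \<open>E\<^sub>j\<close> in \<open>L\<^sup>2\<close>.
\<close>

definition L2_entire :: "((complex^'n) \<times> (complex^'n) \<Rightarrow> real^'n \<Rightarrow> complex) \<Rightarrow> bool" where
  "L2_entire F \<longleftrightarrow> (\<forall>p. F p \<in> L2) \<and>
     (\<forall>p. \<exists>D E :: 'n \<Rightarrow> real^'n \<Rightarrow> complex. (\<forall>j. D j \<in> L2 \<and> E j \<in> L2) \<and>
        L2_tendsto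
          (\<lambda>q \<xi>. (F (p + q) \<xi> - F p \<xi> - (\<Sum>j\<in>UNIV. fst q $ j * D j \<xi> + snd q $ j * E j \<xi>))
                    / of_real (norm q))
          (\<lambda>\<xi>. 0) (at 0))"

text \<open>The extension \<open>F\<close> is unique up to null sets by the identity theorem.\<close>

definition entire_vector :: "(real^'n \<Rightarrow> complex) \<Rightarrow> bool" where
  "entire_vector f \<longleftrightarrow> f \<in> L2 \<and>
     (\<exists>F. L2_entire F \<and>
        (\<forall>x u. AE \<xi> in lebesgue. F (cvec x 0, cvec u 0) \<xi> = schrodinger x u f \<xi>) \<and>
        (\<forall>t>0. \<forall>x u.
           (SUP (y, v) \<in> {(y, v). (norm y)\<^sup>2 + (norm v)\<^sup>2 < t\<^sup>2}.
              L2_sqnorm (F (cvec x y, cvec u v))) < \<infinity>))"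

end

theory Submission
  imports Defs "HOL-Probability.Probability" "HOL-Complex_Analysis.Complex_Analysis"
begin

text \<open>
Write \<open>g\<close> for the Fourier transform of \<open>f\<close>; both may be assumed not to vanish almost everywhere.

The first step is that the coupled integral forces all exponential moments of \<open>f\<close> and of \<open>g\<close> to be
finite (\<open>exp_integrable_of_fourier_coupling\<close>). Let \<open>Y\<close> be the set of all \<open>y\<close> for which
\<open>|f x| exp (a |x \<bullet> y|)\<close> is integrable in \<open>x\<close>. By Tonelli, \<open>Y\<close> contains almost every \<open>y\<close> with \<open>g y \<noteq> 0\<close>, so it
is not a null set; it is convex and symmetric, so it contains a ball about \<open>0\<close>. Hence \<open>f\<close> has some
exponential moment and \<open>g\<close> is real analytic. If a point \<open>p\<close> were missing from \<open>Y\<close>, convexity would keep \<open>Y\<close> away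
from a whole ball about \<open>2 p\<close>; there \<open>g\<close> would vanish, hence everywhere. So \<open>Y\<close> is the whole space. The
hypothesis is symmetric in \<open>f\<close> and \<open>g\<close>, so the same holds for \<open>g\<close>.

The second step is decay in complex tubes. Since \<open>g\<close> has all exponential moments, \<open>f\<close> extends to an entire
function \<open>F\<close>, bounded in every tube. In the weighted square integral of \<open>F (\<xi> + \<i> v)\<close> the integrand is the
restriction to real \<open>\<xi>\<close> of the entire function \<open>F (\<xi> + \<i> v) cnj (F (cnj \<xi> + \<i> v)) exp (2 y \<bullet> \<xi>)\<close>. Shifting
the contour by \<open>- \<i> v\<close> turns the product into \<open>F \<xi> cnj (F (\<xi> + 2 \<i> v))\<close>, a function with all exponential
moments times a bounded one. The shift is carried out under a Gaussian convergence factor, where it is an identity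
between explicit Gaussian transforms (\<open>gauss_contour_shift\<close>). As \<open>F\<close> is Lipschitz in tubes, the weighted
integrals give the pointwise bound \<open>|F (\<xi> + \<i> v)| \<le> C exp (- R |\<xi>|)\<close> for every \<open>R\<close>, uniformly for bounded \<open>v\<close>
(\<open>ft_tilt_decay\<close>).

The third step is that the formula for \<open>\<pi>(z, w) f\<close> makes sense for complex \<open>z\<close> and \<open>w\<close>, is entire in \<open>(z, w)\<close>
for each \<open>\<xi>\<close>, and is bounded by \<open>C exp (- |\<xi>|)\<close> for bounded \<open>(z, w)\<close>. Cauchy's estimates on complex lines
carry this domination over to the Taylor remainders, which gives complex differentiability in \<open>L\<^sup>2\<close> and the
required suprema at once (\<open>L2_entire_rep_ext\<close>, \<open>entire_vector_ft\<close>).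

The \<open>L\<^sup>2\<close> transform enters through three facts: it exists for every \<open>f\<close> (by the Plancherel inequality and
completeness), it is the Fourier integral when \<open>f\<close> is integrable, and \<open>f\<close> is the inverse Fourier integral of \<open>g\<close>
when \<open>g\<close> is integrable. The last one is obtained by multiplying with a Gaussian, which makes everything integrable
and is compatible with \<open>L\<^sup>2\<close> limits, and by injectivity of the transform on \<open>L\<^sup>1\<close>.
\<close>

section \<open>Gaussian integrals with complex linear terms\<close>

lemma borel_measurable_cis [measurable]: "cis \<in> borel_measurable borel"
  by (intro borel_measurable_continuous_onI continuous_intros)

lemma integral_gauss_std_cis:
  "has_bochner_integral lborel (\<lambda>s::real. of_real (exp (- s\<^sup>2 / 2)) * cis (b * s))
     (of_real (sqrt (2 * pi) * exp (- b\<^sup>2 / 2)))"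
proof -
  have int: "integrable lborel (\<lambda>s. of_real (std_normal_density s) * cis (b * s))"
    by (rule Bochner_Integration.integrable_bound[OF integrable_normal_density[where \<mu>=0 and \<sigma>=1]])
       (auto simp: norm_mult)
  have "(LINT s|lborel. of_real (std_normal_density s) * cis (b * s)) = char std_normal_distribution b"
    unfolding char_def by (subst integral_density) (auto simp: scaleR_conv_of_real cis_conv_exp mult_ac)
  also have "\<dots> = of_real (exp (- b\<^sup>2 / 2))"
    by (simp add: char_std_normal_distribution)
  finally have "has_bochner_integral lborel (\<lambda>s. of_real (std_normal_density s) * cis (b * s))
                   (of_real (exp (- b\<^sup>2 / 2)))"
    using int has_bochner_integral_integrable by metis
  from has_bochner_integral_mult_right[OF this, of "of_real (sqrt (2 * pi))"] show ?thesis
    by (simp add: std_normal_density_def field_simps)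
qed

text \<open>
Completing the square absorbs the real part \<open>a\<close> of the linear coefficient into a shift of the variable; what
remains is the characteristic function of the standard normal distribution.
\<close>
lemma integral_gauss_1d:
  fixes a b e :: real
  assumes e: "e > 0"
  shows "has_bochner_integral lborel (\<lambda>t::real. of_real (exp (a * t - e * t\<^sup>2)) * cis (b * t))
     (of_real (sqrt (pi / e) * exp ((a\<^sup>2 - b\<^sup>2) / (4 * e))) * cis (a * b / (2 * e)))"
proof -
  (* The substitution t = a / (2 e) + r s rescales to unit variance. *)
  define r where "r = 1 / sqrt (2 * e)"
  have r: "r > 0" "r\<^sup>2 = 1 / (2 * e)" using e by (auto simp: r_def field_simps)
  let ?f = "\<lambda>t::real. of_real (exp (a * t - e * t\<^sup>2)) * cis (b * t)"
  have *: "?f (a / (2 * e) + r * s) =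
     of_real (exp (a\<^sup>2 / (4 * e))) * cis (a * b / (2 * e)) *
       (of_real (exp (- s\<^sup>2 / 2)) * cis (b * r * s))" for s
  proof -
    have "a * (a / (2 * e) + r * s) - e * (a / (2 * e) + r * s)\<^sup>2 = a\<^sup>2 / (4 * e) - e * r\<^sup>2 * s\<^sup>2"
      using e by (simp add: power2_eq_square field_simps)
    also have "\<dots> = a\<^sup>2 / (4 * e) + (- s\<^sup>2 / 2)" using e by (simp add: r)
    finally have 1: "exp (a * (a / (2 * e) + r * s) - e * (a / (2 * e) + r * s)\<^sup>2) =
       exp (a\<^sup>2 / (4 * e)) * exp (- s\<^sup>2 / 2)" by (simp only: exp_add)
    have 2: "cis (b * (a / (2 * e) + r * s)) = cis (a * b / (2 * e)) * cis (b * r * s)"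
      by (simp add: cis_mult algebra_simps)
    show ?thesis unfolding 1 2 by simp
  qed
  note std = has_bochner_integral_mult_right[OF integral_gauss_std_cis[of "b * r"],
      of "of_real (exp (a\<^sup>2 / (4 * e))) * cis (a * b / (2 * e))"]
  have int: "integrable lborel (\<lambda>s. ?f (a / (2 * e) + r * s))"
    unfolding * using std by (rule has_bochner_integral_iff[THEN iffD1, THEN conjunct1])
  then have i: "integrable lborel ?f"
    by (subst (asm) lborel_integrable_real_affine_iff) (use r in auto)
  have "integral\<^sup>L lborel ?f = r *\<^sub>R (LINT s|lborel. ?f (a / (2 * e) + r * s))"
    using r by (subst lborel_integral_real_affine[of r _ "a / (2 * e)"]) auto
  also have "(LINT s|lborel. ?f (a / (2 * e) + r * s)) =
     of_real (exp (a\<^sup>2 / (4 * e))) * cis (a * b / (2 * e)) * of_real (sqrt (2 * pi) * exp (- (b * r)\<^sup>2 / 2))"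
    unfolding * using std by (rule has_bochner_integral_integral_eq)
  also have "r *\<^sub>R \<dots> = of_real (r * sqrt (2 * pi) * (exp (a\<^sup>2 / (4 * e)) * exp (- (b * r)\<^sup>2 / 2)))
      * cis (a * b / (2 * e))"
    by (simp add: scaleR_conv_of_real)
  also have "r * sqrt (2 * pi) = sqrt (pi / e)"
    using e by (simp add: r_def real_sqrt_divide real_sqrt_mult field_simps)
  also have "exp (a\<^sup>2 / (4 * e)) * exp (- (b * r)\<^sup>2 / 2) = exp ((a\<^sup>2 - b\<^sup>2) / (4 * e))"
    unfolding exp_add[symmetric] using e by (simp add: power_mult_distrib r field_simps)
  finally show ?thesis using i by (simp add: has_bochner_integral_iff)
qed

lemma has_bochner_integral_lborel_prod:
  fixes f :: "'a::euclidean_space \<Rightarrow> real \<Rightarrow> complex"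
  assumes "\<And>b. b \<in> Basis \<Longrightarrow> has_bochner_integral lborel (f b) (I b)"
  shows "has_bochner_integral lborel (\<lambda>x::'a. \<Prod>b\<in>Basis. f b (x \<bullet> b)) (\<Prod>b\<in>Basis. I b)"
proof -
  interpret product_sigma_finite "\<lambda>_::'a. lborel :: real measure" ..
  have int: "\<And>b. b \<in> Basis \<Longrightarrow> integrable lborel (f b)"
    using assms by (auto simp: has_bochner_integral_iff)
  have [measurable]: "\<And>b. b \<in> Basis \<Longrightarrow> f b \<in> borel_measurable borel"
    using borel_measurable_integrable[OF int] by simp
  have m: "(\<lambda>x::'a. \<Prod>b\<in>Basis. f b (x \<bullet> b)) \<in> borel_measurable borel"
    by measurable
  have T: "(\<lambda>g. \<Sum>b\<in>Basis. g b *\<^sub>R b :: 'a) \<in> measurable (\<Pi>\<^sub>M b\<in>Basis. lborel) borel"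
    by measurable
  have e: "(\<Prod>b\<in>Basis. f b ((\<Sum>c\<in>Basis. g c *\<^sub>R c) \<bullet> b))
      = (\<Prod>b\<in>(Basis::'a set). f b (g b))" for g
    by (intro prod.cong) auto
  show ?thesis
    unfolding has_bochner_integral_iff
  proof
    show "integrable lborel (\<lambda>x::'a. \<Prod>b\<in>Basis. f b (x \<bullet> b))"
      by (subst lborel_eq, subst integrable_distr_eq[OF T m])
         (unfold e, intro product_integrable_prod int, auto)
    have "integral\<^sup>L lborel (\<lambda>x::'a. \<Prod>b\<in>Basis. f b (x \<bullet> b)) =
        (\<Prod>b\<in>Basis. integral\<^sup>L lborel (f b))"
      by (subst lborel_eq, subst integral_distr[OF T m])
         (unfold e, intro product_integral_prod int, auto)
    also have "\<dots> = (\<Prod>b\<in>Basis. I b)"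
      using assms by (intro prod.cong) (auto simp: has_bochner_integral_iff)
    finally show "integral\<^sup>L lborel (\<lambda>x::'a. \<Prod>b\<in>Basis. f b (x \<bullet> b))
        = (\<Prod>b\<in>Basis. I b)" .
  qed
qed

lemma cis_sum: "finite A \<Longrightarrow> cis (\<Sum>x\<in>A. f x) = (\<Prod>x\<in>A. cis (f x))"
  by (induction rule: finite_induct) (auto simp: cis_mult[symmetric])

text \<open>
For the complex vector \<open>z = a + \<i> b\<close> and the bilinear square of \<open>z\<close>, the value is a constant times
\<open>exp (z\<^sup>2 / (4 e))\<close>. Modulus and phase are kept apart so that only real vectors occur.
\<close>
lemma has_bochner_integral_gauss:
  fixes a b :: "'a::euclidean_space" and e :: real
  assumes e: "e > 0"
  shows "has_bochner_integral lborel
     (\<lambda>x. of_real (exp (a \<bullet> x - e * (norm x)\<^sup>2)) * cis (b \<bullet> x))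
     (of_real (sqrt (pi / e) ^ DIM('a) * exp (((norm a)\<^sup>2 - (norm b)\<^sup>2) / (4 * e))) * cis ((a \<bullet> b) / (2 * e)))"
proof -
  have 1: "a \<bullet> x - e * (norm x)\<^sup>2
      = (\<Sum>i\<in>Basis. (a \<bullet> i) * (x \<bullet> i) - e * (x \<bullet> i)\<^sup>2)" for x
    by (subst euclidean_inner, subst power2_norm_eq_inner, subst (3) euclidean_inner)
       (simp add: sum_subtractf sum_distrib_left power2_eq_square)
  have 2: "((norm a)\<^sup>2 - (norm b)\<^sup>2) / (4 * e)
      = (\<Sum>i\<in>Basis. ((a \<bullet> i)\<^sup>2 - (b \<bullet> i)\<^sup>2) / (4 * e))"
    unfolding power2_norm_eq_inner
    by (subst euclidean_inner, subst (3) euclidean_inner)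
       (simp add: sum_subtractf power2_eq_square flip: sum_divide_distrib)
  have 3: "(a \<bullet> b) / (2 * e) = (\<Sum>i\<in>Basis. (a \<bullet> i) * (b \<bullet> i) / (2 * e))"
    by (subst euclidean_inner) (simp flip: sum_divide_distrib)
  have 4: "b \<bullet> x = (\<Sum>i\<in>Basis. (b \<bullet> i) * (x \<bullet> i))" for x
    by (rule euclidean_inner)
  have "has_bochner_integral lborel
     (\<lambda>x. \<Prod>i\<in>Basis. of_real (exp ((a \<bullet> i) * (x \<bullet> i) - e * (x \<bullet> i)\<^sup>2)) * cis ((b \<bullet> i) * (x \<bullet> i)))
     (\<Prod>i\<in>(Basis::'a set). of_real (sqrt (pi / e) * exp (((a \<bullet> i)\<^sup>2 - (b \<bullet> i)\<^sup>2) / (4 * e)))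
        * cis ((a \<bullet> i) * (b \<bullet> i) / (2 * e)))"
    by (intro has_bochner_integral_lborel_prod integral_gauss_1d e)
  moreover have "(\<Prod>i\<in>Basis. of_real (exp ((a \<bullet> i) * (x \<bullet> i) - e * (x \<bullet> i)\<^sup>2)) * cis ((b \<bullet> i) * (x \<bullet> i)))
      = of_real (exp (a \<bullet> x - e * (norm x)\<^sup>2)) * cis (b \<bullet> x)" for x
    by (subst 1, subst 4) (simp add: exp_sum cis_sum prod.distrib)
  ultimately show ?thesis
    by (subst 2, subst 3) (simp add: exp_sum cis_sum prod.distrib)
qed

lemma integrable_gauss_cis:
  "e > 0 \<Longrightarrow> integrable lborel (\<lambda>x::'a::euclidean_space. of_real (exp (a \<bullet> x
      - e * (norm x)\<^sup>2)) * cis (b \<bullet> x))"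
  using has_bochner_integral_gauss has_bochner_integral_iff by blast

lemma integrable_gauss_real:
  assumes "e > 0"
  shows "integrable lborel (\<lambda>x::'a::euclidean_space. exp (a \<bullet> x - e * (norm x)\<^sup>2))"
  using integrable_norm[OF integrable_gauss_cis[OF assms, of a 0]] by simp

section \<open>The Fourier transform of integrable functions\<close>

lemma lborel_integral_affine:
  fixes f :: "'a::euclidean_space \<Rightarrow> 'b::{banach, second_countable_topology}"
  assumes [measurable]: "f \<in> borel_measurable borel" and s: "s \<noteq> 0"
  shows "(LINT x|lborel. f x) = \<bar>s\<bar> ^ DIM('a) *\<^sub>R (LINT x|lborel. f (t + s *\<^sub>R x))"
  by (subst lborel_affine[OF s, of t]) (simp add: integral_density integral_distr)

lemma nn_integral_lborel_affine:
  fixes f :: "'a::euclidean_space \<Rightarrow> ennreal"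
  assumes [measurable]: "f \<in> borel_measurable borel" and s: "s \<noteq> 0"
  shows "(\<integral>\<^sup>+x. f x \<partial>lborel)
      = ennreal (\<bar>s\<bar> ^ DIM('a)) * (\<integral>\<^sup>+x. f (t + s *\<^sub>R x) \<partial>lborel)"
  by (subst lborel_affine[OF s, of t]) (simp add: nn_integral_density nn_integral_distr nn_integral_cmult)

lemma integrable_lborel_affine:
  fixes f :: "'a::euclidean_space \<Rightarrow> 'b::{banach, second_countable_topology}"
  assumes f: "integrable lborel f" and s: "s \<noteq> 0"
  shows "integrable lborel (\<lambda>x. f (t + s *\<^sub>R x))"
proof -
  have [measurable]: "f \<in> borel_measurable borel" using f by auto
  have "(\<integral>\<^sup>+x. norm (f x) \<partial>lborel) < \<infinity>" using f by (simp add: integrable_iff_bounded)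
  then have "(\<integral>\<^sup>+x. norm (f (t + s *\<^sub>R x)) \<partial>lborel) < \<infinity>"
    using s by (subst (asm) nn_integral_lborel_affine[OF _ s, of _ t]) (auto simp: ennreal_mult_less_top)
  then show ?thesis by (simp add: integrable_iff_bounded)
qed

text \<open>
The unitary Fourier transform of \<open>f\<close> at \<open>y\<close> is \<open>ft f (- y) / sqrt (2 \<pi>) ^ n\<close>. Leaving out the constant and
the sign keeps the exchange formulas below symmetric.
\<close>
definition ft :: "('a::euclidean_space \<Rightarrow> complex) \<Rightarrow> 'a \<Rightarrow> complex" where
  "ft f y = (LINT x|lborel. f x * cis (x \<bullet> y))"

lemma integrable_mult_bounded:
  fixes f k :: "'a::euclidean_space \<Rightarrow> complex"
  assumes f: "integrable lborel f" and [measurable]: "k \<in> borel_measurable borel"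
    and k: "\<And>x. norm (k x) \<le> B"
  shows "integrable lborel (\<lambda>x. f x * k x)"
proof (rule Bochner_Integration.integrable_bound)
  show "integrable lborel (\<lambda>x. B * norm (f x))" using f by simp
  have "f \<in> borel_measurable borel" using f by auto
  then show "(\<lambda>x. f x * k x) \<in> borel_measurable lborel" by simp
  have "0 \<le> B" using k[of undefined] norm_ge_zero order_trans by blast
  then show "AE x in lborel. norm (f x * k x) \<le> norm (B * norm (f x))"
    using k by (auto simp: norm_mult mult.commute[of B] intro!: mult_left_mono)
qed

lemma integrable_mult_cis:
  "integrable lborel f \<Longrightarrow> integrable lborel (\<lambda>x. f x * cis (x \<bullet> y))"
  by (rule integrable_mult_bounded[where B=1]) auto

lemma norm_ft_le: "integrable lborel f \<Longrightarrow> norm (ft f y) \<le> (LINT x|lborel. norm (f x))"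
  unfolding ft_def by (rule order_trans[OF integral_norm_bound]) (simp add: norm_mult)

lemma continuous_on_ft:
  assumes f: "integrable lborel f"
  shows "continuous_on UNIV (ft f)"
proof -
  have [measurable]: "f \<in> borel_measurable borel" using f by auto
  have "(\<lambda>n. ft f (u n)) \<longlonglongrightarrow> ft f y" if u: "u \<longlonglongrightarrow> y" for u y
    unfolding ft_def
  proof (rule integral_dominated_convergence[where w="\<lambda>x. norm (f x)"])
    show "AE x in lborel. (\<lambda>n. f x * cis (x \<bullet> u n)) \<longlonglongrightarrow> f x * cis (x \<bullet> y)"
      by (auto intro!: tendsto_intros u)
  qed (use f in \<open>auto simp: norm_mult\<close>)
  then show ?thesis
    by (intro continuous_at_imp_continuous_on ballI) (auto simp: continuous_at_sequentially o_def)
qed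

lemma borel_measurable_ft: "integrable lborel f \<Longrightarrow> ft f \<in> borel_measurable borel"
  by (intro borel_measurable_continuous_onI continuous_on_ft)

lemma ft_mult_cis: "ft (\<lambda>x. f x * cis (x \<bullet> z)) y = ft f (y + z)"
  unfolding ft_def by (simp add: mult.assoc cis_mult inner_add_right add.commute)

lemma cnj_ft: "cnj (ft f y) = ft (\<lambda>x. cnj (f x)) (- y)"
  unfolding ft_def by (subst Bochner_Integration.integral_cnj[symmetric]) (simp add: cis_cnj)

text \<open>
The integrability that Fubini's theorem demands in the multiplication formula.
\<close>
lemma integrable_pair_product:
  fixes p w :: "'a::euclidean_space \<Rightarrow> complex"
  assumes p: "integrable lborel p" and w: "integrable lborel w"
    and [measurable]: "k \<in> borel_measurable borel" and k: "\<And>z. norm (k z) \<le> 1"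
  shows "integrable (lborel \<Otimes>\<^sub>M lborel) (\<lambda>(x, y). p x * w y * k (x, y))"
proof -
  have [measurable]: "p \<in> borel_measurable borel" "w \<in> borel_measurable borel" using p w by auto
  have kk[measurable]: "k \<in> borel_measurable (borel \<Otimes>\<^sub>M borel)" by (simp add: borel_prod)
  have "integrable (lborel \<Otimes>\<^sub>M lborel) (\<lambda>z. p (fst z) * w (snd z))"
    by (rule lborel_pair.Fubini_integrable) (use p w in \<open>auto simp: norm_mult\<close>)
  then show ?thesis
    by (rule Bochner_Integration.integrable_bound)
       (use k in \<open>auto simp: norm_mult split_beta intro!: mult_left_le\<close>)
qed

text \<open>
By Fubini's theorem. Taking for \<open>w\<close> a product with a further transform yields the convolution and Parseval
identities used below.
\<close>
lemma ft_multiplication_formula: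
  assumes p: "integrable lborel p" and w: "integrable lborel w"
  shows "(LINT \<xi>|lborel. ft p \<xi> * w \<xi>) = (LINT x|lborel. p x * ft w x)"
proof -
  have i: "integrable (lborel \<Otimes>\<^sub>M lborel) (\<lambda>(x, y). p x * w y * cis (fst (x, y) \<bullet> snd (x, y)))"
    by (rule integrable_pair_product[OF p w]) (auto intro!: borel_measurable_continuous_onI continuous_intros)
  have "(LINT \<xi>|lborel. ft p \<xi> * w \<xi>) = (LINT y|lborel. (LINT x|lborel. p x * w y * cis (x \<bullet> y)))"
    unfolding ft_def by (subst integral_mult_left_zero[symmetric]) (simp add: mult_ac)
  also have "\<dots> = (LINT x|lborel. (LINT y|lborel. p x * w y * cis (x \<bullet> y)))"
    by (rule lborel_pair.Fubini_integral) (use i in simp)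
  also have "\<dots> = (LINT x|lborel. p x * ft w x)"
    unfolding ft_def by (subst integral_mult_right_zero[symmetric]) (simp add: mult_ac inner_commute)
  finally show ?thesis .
qed

lemma ft_mult_ft:
  assumes q: "integrable lborel q" and w: "integrable lborel w"
  shows "ft (\<lambda>\<xi>. ft q \<xi> * w \<xi>) y = (LINT x|lborel. q x * ft w (x + y))"
proof -
  have "ft (\<lambda>\<xi>. ft q \<xi> * w \<xi>) y = (LINT \<xi>|lborel. ft q \<xi> * (w \<xi> * cis (\<xi> \<bullet> y)))"
    by (simp add: ft_def mult.assoc)
  also have "\<dots> = (LINT x|lborel. q x * ft (\<lambda>\<xi>. w \<xi> * cis (\<xi> \<bullet> y)) x)"
    by (rule ft_multiplication_formula[OF q integrable_mult_cis[OF w]])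
  finally show ?thesis by (simp add: ft_mult_cis)
qed

lemma ft_gauss:
  fixes b :: "'a::euclidean_space"
  assumes "e > 0"
  shows "ft (\<lambda>x. of_real (exp (- e * (norm x)\<^sup>2))) b
      = of_real (sqrt (pi / e) ^ DIM('a) * exp (- (norm b)\<^sup>2 / (4 * e)))"
  using has_bochner_integral_integral_eq[OF has_bochner_integral_gauss[OF assms, of 0 b]]
  by (simp add: ft_def inner_commute)

lemma integrable_centered_gauss: "e > 0
    \<Longrightarrow> integrable lborel (\<lambda>x::'a::euclidean_space. exp (- e * (norm x)\<^sup>2))"
  using integrable_gauss_real[of e 0] by simp

lemma integrable_centered_gauss_complex: "e > 0
    \<Longrightarrow> integrable lborel (\<lambda>x::'a::euclidean_space. complex_of_real (exp (- e * (norm x)\<^sup>2)))"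
  using integrable_centered_gauss by (intro integrable_of_real)

lemma integral_centered_gauss:
  assumes "e > 0"
  shows "(LINT x::'a::euclidean_space|lborel. exp (- e * (norm x)\<^sup>2)) = sqrt (pi / e) ^ DIM('a)"
proof -
  have "complex_of_real (LINT x::'a::euclidean_space|lborel. exp (- e * (norm x)\<^sup>2))
      = of_real (sqrt (pi / e) ^ DIM('a))"
    using ft_gauss[OF assms, of 0] by (simp add: ft_def flip: integral_of_real)
  then show ?thesis by (simp only: of_real_eq_iff)
qed

text \<open>
Testing \<open>F\<close> against \<open>k\<close> is the limit of testing it against the convolutions of \<open>k\<close> with narrowing Gaussians.
By Fubini's theorem the Gaussian can be moved onto \<open>F\<close>, where it gives \<open>0\<close> by hypothesis. Writing the
convolution as an average of \<open>k (x + s u)\<close> over a fixed Gaussian in \<open>u\<close> makes the limit \<open>s \<rightarrow> 0\<close> a matter of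
dominated convergence.
\<close>
lemma integral_zero_of_gauss_convolution_zero:
  fixes F k :: "'a::euclidean_space \<Rightarrow> complex"
  assumes F: "integrable lborel F"
    and F0: "\<And>x0 e. e > 0 \<Longrightarrow> (LINT x|lborel. F x * of_real (exp (- e * (norm (x - x0))\<^sup>2))) = 0"
    and k: "continuous_on UNIV k" and kB: "\<And>x. norm (k x) \<le> B"
  shows "(LINT x|lborel. F x * k x) = 0"
proof -
  have [measurable]: "F \<in> borel_measurable borel" using F by auto
  have [measurable]: "k \<in> borel_measurable borel" by (rule borel_measurable_continuous_onI[OF k])
  have B: "B \<ge> 0" using kB[of 0] norm_ge_zero order_trans by blast
  define C where "C = sqrt pi ^ DIM('a)"
  have C: "C > 0" by (simp add: C_def)
  note gi = integrable_centered_gauss[of 1, simplified]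
  note gci = integrable_centered_gauss_complex[of 1, simplified]
  define K where "K s x = (LINT u|lborel. of_real (exp (- (norm u)\<^sup>2)) * k (x + s *\<^sub>R u))" for s x
  have [measurable]: "K s \<in> borel_measurable borel" for s
    unfolding K_def by measurable
  have Kint: "integrable lborel (\<lambda>u. of_real (exp (- (norm u)\<^sup>2)) * k (x + s *\<^sub>R u))" for s x
    by (rule integrable_mult_bounded[OF gci, where B=B]) (auto simp: kB)
  have KB: "norm (K s x) \<le> B * C" for s x
  proof -
    have "norm (K s x) \<le> (LINT u|lborel. norm (of_real (exp (- (norm u)\<^sup>2)) * k (x + s *\<^sub>R u)))"
      unfolding K_def by (rule integral_norm_bound)
    also have "\<dots> \<le> (LINT u::'a|lborel. B * exp (- (norm u)\<^sup>2))"
    proof (rule integral_mono)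
      show "norm (of_real (exp (- (norm u)\<^sup>2)) * k (x + s *\<^sub>R u)) \<le> B * exp (- (norm u)\<^sup>2)" for u
        using kB by (simp add: norm_mult mult.commute[of B])
    qed (use gi integrable_norm[OF Kint[of x s]] in auto)
    also have "\<dots> = B * C" using integral_centered_gauss[of 1, where ?'a='a] by (simp add: C_def)
    finally show ?thesis .
  qed
  have Klim: "(\<lambda>n. K (1 / Suc n) x) \<longlonglongrightarrow> of_real C * k x" for x
  proof -
    have "(\<lambda>n. K (1 / Suc n) x)
        \<longlonglongrightarrow> (LINT u::'a|lborel. of_real (exp (- (norm u)\<^sup>2)) * k x)"
      unfolding K_def
    proof (rule integral_dominated_convergence[where w="\<lambda>u. B * exp (- (norm u)\<^sup>2)"])
      have "(\<lambda>n. x + (1 / Suc n) *\<^sub>R u) \<longlonglongrightarrow> x + 0 *\<^sub>R u" for u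
        by (intro tendsto_intros LIMSEQ_inverse_real_of_nat[unfolded inverse_eq_divide])
      then have "(\<lambda>n. k (x + (1 / Suc n) *\<^sub>R u)) \<longlonglongrightarrow> k x" for u
        using k by (intro continuous_on_tendsto_compose[OF k]) auto
      then show "AE u in lborel. (\<lambda>n. of_real (exp (- (norm u)\<^sup>2)) * k (x + (1 / Suc n) *\<^sub>R u))
          \<longlonglongrightarrow> of_real (exp (- (norm u)\<^sup>2)) * k x"
        by (intro AE_I2 tendsto_intros)
    qed (use gi kB in \<open>auto simp: norm_mult mult.commute\<close>)
    also have "(LINT u::'a|lborel. of_real (exp (- (norm u)\<^sup>2)) * k x) = of_real C * k x"
      using integral_centered_gauss[of 1, where ?'a='a] by (simp add: C_def)
    finally show ?thesis .
  qed
  have zero: "(LINT x|lborel. F x * K s x) = 0" if s: "s > 0" for s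
  proof -
    define e where "e = 1 / s\<^sup>2"
    have e: "e > 0" using s by (simp add: e_def)
    have gxi: "integrable lborel (\<lambda>v. exp (- e * (norm (x - v))\<^sup>2))" for x :: 'a
      using integrable_lborel_affine[OF integrable_centered_gauss[OF e, where ?'a='a], of "-1" x] by simp
    have gx: "(LINT v|lborel. exp (- e * (norm (x - v))\<^sup>2)) = sqrt (pi / e) ^ DIM('a)" for x :: 'a
      using lborel_integral_affine[of "\<lambda>v. exp (- e * (norm v)\<^sup>2)" "-1" x] integral_centered_gauss[OF e, where ?'a='a]
      by simp
    let ?G = "\<lambda>x v. F x * (of_real (exp (- e * (norm (x - v))\<^sup>2)) * k v)"
    have gk: "integrable lborel (\<lambda>v. ?G x v)" for x :: 'a
      by (intro integrable_mult_right integrable_mult_bounded[where B=B] integrable_of_real gxi kB) auto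
    have i: "integrable (lborel \<Otimes>\<^sub>M lborel) (\<lambda>(x, v). ?G x v)"
    proof (rule lborel_pair.Fubini_integrable)
      have "norm (?G x v) \<le> norm (F x) * (B * exp (- e * (norm (x - v))\<^sup>2))" for x v
        using kB by (simp add: norm_mult mult.commute[of B] mult_left_mono)
      then have "(LINT v|lborel. norm (?G x v)) \<le>
         (LINT v|lborel. norm (F x) * (B * exp (- e * (norm (x - v))\<^sup>2)))" for x
        by (intro integral_mono integrable_norm gk integrable_mult_right gxi)
      then have *: "(LINT v|lborel. norm (?G x v)) \<le> norm (F x) * (B * sqrt (pi / e) ^ DIM('a))" for x
        by (simp only: integral_mult_right_zero gx)
      show "integrable lborel (\<lambda>x. LINT v|lborel. norm (case (x, v) of (x, v) \<Rightarrow> ?G x v))"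
      proof (rule Bochner_Integration.integrable_bound)
        show "integrable lborel (\<lambda>x. norm (F x) * (B * sqrt (pi / e) ^ DIM('a)))"
          using F by (intro integrable_mult_left integrable_norm)
        show "AE x in lborel. norm (LINT v|lborel. norm (case (x, v) of (x, v) \<Rightarrow> ?G x v))
           \<le> norm (norm (F x) * (B * sqrt (pi / e) ^ DIM('a)))"
          using * by (auto intro!: AE_I2 order_trans[OF _ abs_ge_self] simp: integral_nonneg)
      qed measurable
    qed (use gk in auto)
    have subst: "(LINT u|lborel. of_real (exp (- (norm u)\<^sup>2)) * k (x + s *\<^sub>R u)) =
       of_real ((1/s) ^ DIM('a)) * (LINT v|lborel. k v * of_real (exp (- (1 / s\<^sup>2) * (norm (x - v))\<^sup>2)))" for x
    proof -
      have m: "(\<lambda>u. of_real (exp (- (norm u)\<^sup>2))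
          * k (x + s *\<^sub>R u)) \<in> borel_measurable borel" by measurable
      have "(LINT u|lborel. of_real (exp (- (norm u)\<^sup>2)) * k (x + s *\<^sub>R u)) =
        \<bar>1/s\<bar> ^ DIM('a) *\<^sub>R (LINT v|lborel. of_real (exp (- (norm (- (1/s) *\<^sub>R x + (1/s) *\<^sub>R v))\<^sup>2)) *
           k (x + s *\<^sub>R (- (1/s) *\<^sub>R x + (1/s) *\<^sub>R v)))"
        by (rule lborel_integral_affine[OF m]) (use s in auto)
      also have "norm (- (1/s) *\<^sub>R x + (1/s) *\<^sub>R v) = (1/s) * norm (x - v)" for v
      proof -
        have "- (1/s) *\<^sub>R x + (1/s) *\<^sub>R v = (- (1/s)) *\<^sub>R (x - v)" by (simp add: algebra_simps)
        then show ?thesis using s by (simp only: norm_scaleR) simp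
      qed
      then have "(\<lambda>v. of_real (exp (- (norm (- (1/s) *\<^sub>R x + (1/s) *\<^sub>R v))\<^sup>2)) * k (x + s *\<^sub>R (- (1/s) *\<^sub>R x + (1/s) *\<^sub>R v)))
          = (\<lambda>v. k v * complex_of_real (exp (- (1 / s\<^sup>2) * (norm (x - v))\<^sup>2)))"
        using s by (auto simp: fun_eq_iff power_mult_distrib power_divide mult.commute scaleR_right_diff_distrib)
      finally show ?thesis using s by (simp add: scaleR_conv_of_real)
    qed
    have inner: "(LINT x|lborel. ?G x v) = 0" for v
      using F0[OF e, of v] by (simp add: mult.assoc[symmetric])
    have "(LINT x|lborel. F x * K s x) = (LINT x|lborel. of_real ((1/s) ^ DIM('a)) *
        (LINT v|lborel. ?G x v))"
      unfolding K_def subst e_def by (simp add: mult_ac flip: integral_mult_right_zero)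
    also have "\<dots> = of_real ((1/s) ^ DIM('a)) * (LINT x|lborel. (LINT v|lborel. ?G x v))"
      by (rule integral_mult_right_zero)
    also have "(LINT x|lborel. (LINT v|lborel. ?G x v)) =
       (LINT v|lborel. (LINT x|lborel. ?G x v))"
      by (rule lborel_pair.Fubini_integral[symmetric]) (use i in simp)
    finally show ?thesis unfolding inner by simp
  qed
  have "(\<lambda>n. LINT x|lborel. F x * K (1 / Suc n) x)
      \<longlonglongrightarrow> (LINT x|lborel. F x * (of_real C * k x))"
  proof (rule integral_dominated_convergence[where w="\<lambda>x. B * C * norm (F x)"])
    show "AE x in lborel. (\<lambda>n. F x * K (1 / Suc n) x) \<longlonglongrightarrow> F x * (of_real C * k x)"
      by (intro AE_I2 tendsto_intros Klim)
    show "AE x in lborel. norm (F x * K (1 / Suc n) x) \<le> B * C * norm (F x)" for n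
      using KB[of "1 / Suc n"] by (auto simp: norm_mult mult.commute[of "norm (F _)"] intro!: mult_right_mono)
  qed (use F in auto)
  then have "(LINT x|lborel. F x * (of_real C * k x)) = 0"
    by (simp add: zero LIMSEQ_const_iff)
  also have "(LINT x|lborel. F x * (of_real C * k x)) = of_real C * (LINT x|lborel. F x * k x)"
    by (subst integral_mult_right_zero[symmetric]) (simp add: mult_ac)
  finally show ?thesis using C by simp
qed

text \<open>
Tent functions around a closed set converge to its indicator, so \<open>F\<close> integrates to \<open>0\<close> over closed sets. These
form a generator of the Borel sets that is stable under intersection, and Dynkin's argument does the rest.
\<close>
lemma AE_zero_of_continuous_tests:
  fixes F :: "'a::euclidean_space \<Rightarrow> complex"
  assumes F: "integrable lborel F"
    and F0: "\<And>k. continuous_on UNIV k \<Longrightarrow> (\<And>x. norm (k x) \<le> 1)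
        \<Longrightarrow> (LINT x|lborel. F x * k x) = 0"
  shows "AE x in lborel. F x = 0"
proof -
  have [measurable]: "F \<in> borel_measurable borel" using F by auto
  have int: "set_integrable lborel A F" if "A \<in> sets borel" for A
    using integrable_mult_indicator[OF _ F, of A] that by (simp add: set_integrable_def)
  have cl: "set_lebesgue_integral lborel A F = 0" if A: "closed A" for A
  proof (cases "A = {}")
    case False
    define k where "k m x = complex_of_real (max 0 (1 - real m * infdist x A))" for m x
    have [measurable]: "A \<in> sets borel" using A by auto
    have "(\<lambda>m. LINT x|lborel. F x * k m x) \<longlonglongrightarrow> (LINT x|lborel. indicator A x *\<^sub>R F x)"
    proof (rule integral_dominated_convergence[where w="\<lambda>x. norm (F x)"])
      show "AE x in lborel. (\<lambda>m. F x * k m x) \<longlonglongrightarrow> indicator A x *\<^sub>R F x"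
      proof (intro AE_I2)
        fix x
        show "(\<lambda>m. F x * k m x) \<longlonglongrightarrow> indicator A x *\<^sub>R F x"
        proof (cases "x \<in> A")
          case True
          then show ?thesis by (simp add: k_def)
        next
          case False
          then have pos: "infdist x A > 0"
            using A \<open>A \<noteq> {}\<close> by (simp add: infdist_pos_not_in_closed)
          obtain N where N: "real N * infdist x A > 1" using reals_Archimedean3[OF pos] by blast
          have "k m x = 0" if "m \<ge> N" for m
          proof -
            have "real m * infdist x A \<ge> real N * infdist x A" using that pos by simp
            then show ?thesis using N by (simp add: k_def max_def)
          qed
          then have "eventually (\<lambda>m. F x * k m x = 0) sequentially"
            by (auto simp: eventually_sequentially)
          then show ?thesis using False by (simp add: tendsto_eventually)
        qed
      qed
      show "AE x in lborel. norm (F x * k m x) \<le> norm (F x)" for m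
        by (auto simp: k_def norm_mult max_def infdist_nonneg intro!: mult_left_le)
      show "(\<lambda>x. F x * k m x) \<in> borel_measurable lborel" for m
      proof -
        have [measurable]: "k m \<in> borel_measurable borel"
          unfolding k_def by (intro borel_measurable_continuous_onI continuous_intros)
        show ?thesis by simp
      qed
    qed (use F in auto)
    moreover have "(LINT x|lborel. F x * k m x) = 0" for m
      unfolding k_def by (rule F0) (intro continuous_intros, simp add: infdist_nonneg)
    ultimately show ?thesis by (simp add: set_lebesgue_integral_def LIMSEQ_const_iff)
  qed (simp add: set_lebesgue_integral_def)
  have sb: "sets borel = sigma_sets UNIV (Collect (closed :: 'a set \<Rightarrow> bool))"
    unfolding borel_eq_closed by simp
  have F_UNIV: "set_lebesgue_integral lborel UNIV F = 0" by (rule cl) simp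
  have "set_lebesgue_integral lborel A F = 0" if "A \<in> sets borel" for A
  proof -
    have "A \<in> sigma_sets UNIV (Collect closed)" using that sb by simp
    have st: "Int_stable (Collect (closed :: 'a set \<Rightarrow> bool))" by (auto simp: Int_stable_def)
    have "Collect (closed :: 'a set \<Rightarrow> bool) \<subseteq> Pow UNIV" by simp
    from st this \<open>A \<in> sigma_sets UNIV (Collect closed)\<close> show ?thesis
    proof (induction rule: sigma_sets_induct_disjoint)
      case (basic A)
      then show ?case using cl by simp
    next
      case empty
      show ?case by (simp add: set_lebesgue_integral_def)
    next
      case (compl A)
      then have A: "A \<in> sets borel" using sb by simp
      have "set_lebesgue_integral lborel (A \<union> (UNIV - A)) F =
          set_lebesgue_integral lborel A F + set_lebesgue_integral lborel (UNIV - A) F"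
        using A by (intro set_integral_Un int) auto
      then show ?case using compl F_UNIV by (simp add: Un_Diff_cancel)
    next
      case (union A)
      then have A: "A i \<in> sets borel" for i using sb by auto
      show ?case
        by (subst lebesgue_integral_countable_add)
           (use A union in \<open>auto simp: disjoint_family_on_def intro!: int\<close>)
    qed
  qed
  then show ?thesis by (intro sigma_finite_measure.density_zero[OF sigma_finite_lborel F]) simp
qed

text \<open>
A translated Gaussian is the transform of a modulated Gaussian, so by the multiplication formula all Gaussian
averages of \<open>F\<close> vanish with its transform.
\<close>
lemma ft_injective:
  fixes F :: "'a::euclidean_space \<Rightarrow> complex"
  assumes F: "integrable lborel F" and F0: "\<And>y. ft F y = 0"
  shows "AE x in lborel. F x = 0"
proof (rule AE_zero_of_continuous_tests[OF F])
  fix k :: "'a \<Rightarrow> complex" assume k: "continuous_on UNIV k" "\<And>x. norm (k x) \<le> 1"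
  show "(LINT x|lborel. F x * k x) = 0"
  proof (rule integral_zero_of_gauss_convolution_zero[OF F _ k])
    fix x0 :: 'a and e :: real assume e: "e > 0"
    define d where "d = 1 / (4 * e)"
    have d: "d > 0" "4 * d = 1 / e" using e by (auto simp: d_def)
    define w where "w = (\<lambda>x. complex_of_real (exp (- d * (norm x)\<^sup>2)) * cis (x \<bullet> (- x0)))"
    have w: "integrable lborel w" unfolding w_def
      by (intro integrable_mult_cis integrable_centered_gauss_complex d)
    have ftw: "ft w x = of_real (sqrt (pi / d) ^ DIM('a)) * of_real (exp (- e * (norm (x - x0))\<^sup>2))" for x
      unfolding w_def ft_mult_cis ft_gauss[OF d(1)] using e by (simp add: d)
    have "0 = (LINT x|lborel. F x * ft w x)"
      using ft_multiplication_formula[OF F w] F0 by simp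
    also have "\<dots> = of_real (sqrt (pi / d) ^ DIM('a))
        * (LINT x|lborel. F x * of_real (exp (- e * (norm (x - x0))\<^sup>2)))"
      unfolding ftw by (subst integral_mult_right_zero[symmetric]) (simp add: mult_ac)
    finally show "(LINT x|lborel. F x * of_real (exp (- e * (norm (x - x0))\<^sup>2))) = 0"
      using d by simp
  qed
qed

section \<open>The Plancherel inequality and completeness\<close>

lemma cnj_ft_reflect: 
  fixes f :: "'a::euclidean_space \<Rightarrow> complex"
  assumes "integrable lborel f"
  shows "cnj (ft f y) = ft (\<lambda>x. cnj (f (- x))) y"
proof -
  have [measurable]: "f \<in> borel_measurable borel" using assms by auto
  have m: "(\<lambda>x. cnj (f x) * cis (x \<bullet> - y)) \<in> borel_measurable borel"
  proof -
    have "(\<lambda>x. cnj (f x)) \<in> borel_measurable borel"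
      by (intro borel_measurable_continuous_on[OF continuous_on_cnj[OF continuous_on_id]]) simp
    then show ?thesis by simp
  qed
  show ?thesis unfolding cnj_ft
    using lborel_integral_affine[OF m, of "-1" 0] by (simp add: ft_def)
qed

lemma ennreal_norm_integral_le:
  fixes f :: "'a \<Rightarrow> 'b::{banach, second_countable_topology}"
  shows "ennreal (norm (integral\<^sup>L M f)) \<le> (\<integral>\<^sup>+x. ennreal (norm (f x)) \<partial>M)"
  by (cases "integrable M f") (auto intro: integral_norm_bound_ennreal simp: not_integrable_integral_eq)

text \<open>
Removes a Gaussian convergence factor from an integral, by Fatou's lemma.
\<close>
lemma nn_integral_le_of_gauss_damped:
  fixes h :: "'a::euclidean_space \<Rightarrow> real"
  assumes [measurable]: "h \<in> borel_measurable borel" and h: "\<And>x. h x \<ge> 0"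
    and b: "\<And>e. e > 0 \<Longrightarrow> (\<integral>\<^sup>+x. ennreal (h x
        * exp (- e * (norm x)\<^sup>2)) \<partial>lborel) \<le> ennreal (b e)"
    and bB: "(b \<longlongrightarrow> B) (at_right 0)"
  shows "(\<integral>\<^sup>+x. ennreal (h x) \<partial>lborel) \<le> ennreal B"
proof -
  have lim0: "filterlim (\<lambda>n. 1 / real (Suc n)) (at_right 0) sequentially"
    using LIMSEQ_inverse_real_of_nat[unfolded inverse_eq_divide]
    by (auto simp: filterlim_at intro!: always_eventually)
  have "(\<lambda>n. exp (- (1 / Suc n) * (norm x)\<^sup>2))
      \<longlonglongrightarrow> exp (- 0 * (norm x)\<^sup>2)" for x :: 'a
    using LIMSEQ_inverse_real_of_nat[unfolded inverse_eq_divide] by (intro tendsto_intros) auto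
  then have "(\<lambda>n. h x * exp (- (1 / Suc n) * (norm x)\<^sup>2)) \<longlonglongrightarrow> h x * 1" for x
    by (intro tendsto_intros) simp
  then have "(\<lambda>n. ennreal (h x * exp (- (1 / Suc n) * (norm x)\<^sup>2)))
      \<longlonglongrightarrow> ennreal (h x)" for x
    by (intro tendsto_ennrealI) simp
  then have "(\<integral>\<^sup>+x. ennreal (h x) \<partial>lborel)
      = (\<integral>\<^sup>+x. liminf (\<lambda>n. ennreal (h x * exp (- (1 / Suc n) * (norm x)\<^sup>2))) \<partial>lborel)"
    by (intro nn_integral_cong lim_imp_Liminf[symmetric]) auto
  also have "\<dots> \<le> liminf (\<lambda>n. \<integral>\<^sup>+x. ennreal (h x
      * exp (- (1 / Suc n) * (norm x)\<^sup>2)) \<partial>lborel)"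
    by (rule nn_integral_liminf) simp
  also have "\<dots> \<le> liminf (\<lambda>n. ennreal (b (1 / Suc n)))"
    by (rule Liminf_mono) (intro always_eventually allI b, simp)
  also have "\<dots> = ennreal B"
    by (intro lim_imp_Liminf tendsto_ennrealI filterlim_compose[OF bB lim0]) simp
  finally show ?thesis .
qed

abbreviation sqint :: "'a measure \<Rightarrow> ('a \<Rightarrow> complex) \<Rightarrow> ennreal" where
  "sqint M f \<equiv> \<integral>\<^sup>+x. ennreal ((cmod (f x))\<^sup>2) \<partial>M"

text \<open>
From \<open>2 |s| |q| \<le> |s|\<^sup>2 + |q|\<^sup>2\<close>, since the kernel has the same mass \<open>M\<close> in each variable.
\<close>
lemma nn_integral_bilinear_young:
  fixes s q :: "'a::euclidean_space \<Rightarrow> complex" and k :: "'a \<Rightarrow> real"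
  assumes [measurable]: "s \<in> borel_measurable borel" "q \<in> borel_measurable borel" "k \<in> borel_measurable borel"
    and k: "\<And>x. k x \<ge> 0" and kM: "(\<integral>\<^sup>+x. ennreal (k x) \<partial>lborel) = M"
    and s: "(sqint lborel s) \<le> A" and q: "(sqint lborel q) \<le> A"
  shows "(\<integral>\<^sup>+x. (\<integral>\<^sup>+u. ennreal (norm (s x)
      * norm (q u) * k (u + x)) \<partial>lborel) \<partial>lborel) \<le> M * A"
proof -
  have t: "(\<integral>\<^sup>+u. ennreal (k (u + x)) \<partial>lborel) = M" for x
    using nn_integral_lborel_affine[of "\<lambda>x. ennreal (k x)" 1 x] kM by (simp add: add.commute)
  have s': "(\<integral>\<^sup>+x. ennreal ((norm (s x))\<^sup>2 / 2) \<partial>lborel) \<le> ennreal (1/2) * A"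
  proof -
    have "(\<integral>\<^sup>+x. ennreal ((norm (s x))\<^sup>2 / 2) \<partial>lborel) = ennreal (1/2) * (sqint lborel s)"
      by (subst nn_integral_cmult[symmetric]) (auto simp: ennreal_mult[symmetric] simp del: ennreal_half ennreal_divide_numeral)
    then show ?thesis using mult_left_mono[OF s] by simp
  qed
  have q': "(\<integral>\<^sup>+x. ennreal ((norm (q x))\<^sup>2 / 2) \<partial>lborel) \<le> ennreal (1/2) * A"
  proof -
    have "(\<integral>\<^sup>+x. ennreal ((norm (q x))\<^sup>2 / 2) \<partial>lborel) = ennreal (1/2) * (sqint lborel q)"
      by (subst nn_integral_cmult[symmetric]) (auto simp: ennreal_mult[symmetric] simp del: ennreal_half ennreal_divide_numeral)
    then show ?thesis using mult_left_mono[OF q] by simp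
  qed
  have "(\<integral>\<^sup>+x. (\<integral>\<^sup>+u. ennreal (norm (s x) * norm (q u) * k (u + x)) \<partial>lborel) \<partial>lborel) \<le>
     (\<integral>\<^sup>+x. (\<integral>\<^sup>+u. ennreal ((norm (s x))\<^sup>2 / 2) * ennreal (k (u + x)) + ennreal ((norm (q u))\<^sup>2 / 2) * ennreal (k (u + x)) \<partial>lborel) \<partial>lborel)"
  proof (intro nn_integral_mono)
    fix x u
    have "norm (s x) * norm (q u) \<le> (norm (s x))\<^sup>2 / 2 + (norm (q u))\<^sup>2 / 2"
      using sum_squares_bound[of "norm (s x)" "norm (q u)"] by simp
    from mult_right_mono[OF this k[of "u + x"]]
    have "norm (s x) * norm (q u) * k (u + x)
        \<le> (norm (s x))\<^sup>2 / 2 * k (u + x) + (norm (q u))\<^sup>2 / 2 * k (u + x)"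
      by (simp add: distrib_right)
    then show "ennreal (norm (s x) * norm (q u) * k (u + x))
        \<le> ennreal ((norm (s x))\<^sup>2 / 2) * ennreal (k (u + x)) + ennreal ((norm (q u))\<^sup>2 / 2) * ennreal (k (u + x))"
      by (simp add: ennreal_mult[symmetric] k ennreal_plus[symmetric] del: ennreal_plus) 
  qed
  also have "\<dots> = (\<integral>\<^sup>+x. (\<integral>\<^sup>+u. ennreal ((norm (s x))\<^sup>2 / 2) * ennreal (k (u + x)) \<partial>lborel) \<partial>lborel)
       + (\<integral>\<^sup>+x. (\<integral>\<^sup>+u. ennreal ((norm (q u))\<^sup>2 / 2) * ennreal (k (u + x)) \<partial>lborel) \<partial>lborel)"
    by (subst nn_integral_add[symmetric]) (auto intro!: nn_integral_cong nn_integral_add)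
  also have "(\<integral>\<^sup>+x. (\<integral>\<^sup>+u. ennreal ((norm (q u))\<^sup>2 / 2) * ennreal (k (u + x)) \<partial>lborel) \<partial>lborel) =
      (\<integral>\<^sup>+u. (\<integral>\<^sup>+x. ennreal ((norm (q u))\<^sup>2 / 2) * ennreal (k (x + u)) \<partial>lborel) \<partial>lborel)"
    by (subst lborel_pair.Fubini') (simp_all add: add.commute)
  also have "(\<integral>\<^sup>+x. (\<integral>\<^sup>+u. ennreal ((norm (s x))\<^sup>2 / 2)
      * ennreal (k (u + x)) \<partial>lborel) \<partial>lborel) = (\<integral>\<^sup>+x. ennreal ((norm (s x))\<^sup>2 / 2) \<partial>lborel) * M"
    by (simp add: nn_integral_cmult t nn_integral_multc)
  also have "(\<integral>\<^sup>+x. (\<integral>\<^sup>+u. ennreal ((norm (q x))\<^sup>2 / 2)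
      * ennreal (k (u + x)) \<partial>lborel) \<partial>lborel) = (\<integral>\<^sup>+x. ennreal ((norm (q x))\<^sup>2 / 2) \<partial>lborel) * M"
    by (simp add: nn_integral_cmult t nn_integral_multc)
  also have "(\<integral>\<^sup>+x. ennreal ((norm (s x))\<^sup>2 / 2) \<partial>lborel) * M + (\<integral>\<^sup>+x. ennreal ((norm (q x))\<^sup>2 / 2) \<partial>lborel) * M
      \<le> ennreal (1/2) * A * M + ennreal (1/2) * A * M"
    by (intro add_mono mult_right_mono s' q') auto
  also have "ennreal (1/2) * A * M + ennreal (1/2) * A * M = M * A"
  proof -
    have "ennreal (1/2) * A * M + ennreal (1/2) * A * M = (ennreal (1/2) + ennreal (1/2)) * A * M"
      by (simp add: distrib_right)
    also have "ennreal (1/2) + ennreal (1/2) = 1" by (subst ennreal_plus[symmetric]) auto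
    finally show ?thesis by (simp add: mult.commute)
  qed
  finally show ?thesis .
qed

text \<open>
Under a Gaussian factor the square integral of the transform is a double integral of \<open>s\<close> against a Gaussian
kernel. This kernel has mass \<open>(2 \<pi>) ^ n\<close> whatever the width of the factor, so the bound survives its removal.
\<close>
lemma plancherel_le:
  fixes s :: "'a::euclidean_space \<Rightarrow> complex"
  assumes s: "integrable lborel s" and s2: "(sqint lborel s) \<le> ennreal A" and A: "A \<ge> 0"
  shows "(sqint lborel (\<lambda>y. ft s y)) \<le> ennreal ((2 * pi) ^ DIM('a) * A)"
proof (rule nn_integral_le_of_gauss_damped[where b="\<lambda>_. (2 * pi) ^ DIM('a) * A"])
  have [measurable]: "s \<in> borel_measurable borel" using s by auto
  note [measurable] = borel_measurable_ft[OF s]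
  show "(\<lambda>y. (norm (ft s y))\<^sup>2) \<in> borel_measurable borel" by measurable
  fix e :: real assume e: "e > 0"
  define g where "g = (\<lambda>x::'a. complex_of_real (exp (- e * (norm x)\<^sup>2)))"
  have g: "integrable lborel g" unfolding g_def by (rule integrable_centered_gauss_complex[OF e])
  have [measurable]: "g \<in> borel_measurable borel" using g by auto
  define q where "q = (\<lambda>x. cnj (s (- x)))"
  have q: "integrable lborel q"
    unfolding q_def using integrable_lborel_affine[OF s, of "-1" 0] by simp
  have [measurable]: "q \<in> borel_measurable borel" using q by auto
  note [measurable] = borel_measurable_ft[OF q]
  have ftq: "ft q y = cnj (ft s y)" for y
    unfolding q_def by (rule cnj_ft_reflect[OF s, symmetric])
  define k where "k = (\<lambda>b::'a. sqrt (pi / e) ^ DIM('a) * exp (- (norm b)\<^sup>2 / (4 * e)))"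
  have k: "ft g b = of_real (k b)" "k b \<ge> 0" for b
    using e unfolding g_def ft_gauss[OF e] by (simp_all add: k_def)
  have [measurable]: "k \<in> borel_measurable borel" unfolding k_def by measurable
  have kM: "(\<integral>\<^sup>+b. ennreal (k b) \<partial>lborel) = ennreal ((2 * pi) ^ DIM('a))"
  proof -
    have e': "1 / (4 * e) > 0" using e by simp
    have k': "k = (\<lambda>b. sqrt (pi / e) ^ DIM('a)
        * exp (- (1 / (4 * e)) * (norm b)\<^sup>2))" by (simp add: k_def fun_eq_iff)
    have ki: "integrable lborel k" unfolding k' by (intro integrable_mult_right integrable_centered_gauss e')
    have "integral\<^sup>L lborel k = sqrt (pi / e) ^ DIM('a) * sqrt (pi / (1 / (4 * e))) ^ DIM('a)"
      unfolding k' integral_mult_right_zero by (subst integral_centered_gauss[OF e']) simp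
    also have "\<dots> = (2 * pi) ^ DIM('a)"
    proof -
      have "sqrt (pi / e) * sqrt (pi / (1 / (4 * e))) = sqrt ((2 * pi)\<^sup>2)"
        unfolding real_sqrt_mult[symmetric] using e by (simp add: power2_eq_square)
      also have "\<dots> = 2 * pi" by (simp only: real_sqrt_abs) simp
      finally show ?thesis unfolding power_mult_distrib[symmetric] by (simp only:)
    qed
    finally show ?thesis using ki k(2) by (simp add: nn_integral_eq_integral)
  qed
  have i: "integrable lborel (\<lambda>y. ft q y * g y)"
    using integrable_mult_bounded[OF g borel_measurable_ft[OF q] norm_ft_le[OF q]] by (simp add: mult.commute)
  have i2: "integrable lborel (\<lambda>y. ft q y * g y * ft s y)"
    by (rule integrable_mult_bounded[OF i borel_measurable_ft[OF s] norm_ft_le[OF s]])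
  have eq: "ft q y * g y * ft s y = of_real ((norm (ft s y))\<^sup>2 * exp (- e * (norm y)\<^sup>2))" for y
    unfolding ftq g_def by (simp only: of_real_mult complex_norm_square mult_ac)
  have i3: "integrable lborel (\<lambda>y. (norm (ft s y))\<^sup>2 * exp (- e * (norm y)\<^sup>2))"
    using integrable_norm[OF i2] unfolding eq norm_of_real by simp
  have "(\<integral>\<^sup>+y. ennreal ((norm (ft s y))\<^sup>2 * exp (- e * (norm y)\<^sup>2)) \<partial>lborel)
      = ennreal (LINT y|lborel. (norm (ft s y))\<^sup>2 * exp (- e * (norm y)\<^sup>2))"
    by (rule nn_integral_eq_integral[OF i3]) simp
  also have "(LINT y|lborel. (norm (ft s y))\<^sup>2 * exp (- e * (norm y)\<^sup>2))
      = norm (LINT y|lborel. ft q y * g y * ft s y)"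
  proof -
    have "(LINT y|lborel. ft q y * g y * ft s y)
        = of_real (LINT y|lborel. (norm (ft s y))\<^sup>2 * exp (- e * (norm y)\<^sup>2))"
      unfolding eq using i3 by (rule integral_of_real)
    then show ?thesis by (simp only: norm_of_real) (simp add: integral_nonneg)
  qed
  also have "(LINT y|lborel. ft q y * g y * ft s y) = (LINT x|lborel. s x * ft (\<lambda>y. ft q y * g y) x)"
    using ft_multiplication_formula[OF s i] by (simp add: mult_ac)
  also have "\<dots> = (LINT x|lborel. (LINT u|lborel. s x * (q u * ft g (u + x))))"
    unfolding ft_mult_ft[OF q g] by simp
  also have "ennreal (norm \<dots>) \<le> (\<integral>\<^sup>+x. (\<integral>\<^sup>+u. ennreal (norm (s x
      * (q u * ft g (u + x)))) \<partial>lborel) \<partial>lborel)"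
    by (rule order_trans[OF ennreal_norm_integral_le]) (intro nn_integral_mono ennreal_norm_integral_le)
  also have "\<dots> = (\<integral>\<^sup>+x. (\<integral>\<^sup>+u. ennreal (norm (s x)
      * norm (q u) * k (u + x)) \<partial>lborel) \<partial>lborel)"
    by (simp add: k norm_mult mult.assoc)
  also have "\<dots> \<le> ennreal ((2 * pi) ^ DIM('a)) * ennreal A"
  proof (rule nn_integral_bilinear_young[OF _ _ _ k(2) kM s2])
    show "(sqint lborel q) \<le> ennreal A"
      using s2 nn_integral_lborel_affine[of "\<lambda>x. ennreal ((norm (s x))\<^sup>2)" "-1" 0] by (simp add: q_def)
  qed measurable
  finally show "(\<integral>\<^sup>+y. ennreal ((norm (ft s y))\<^sup>2 * exp (- e * (norm y)\<^sup>2)) \<partial>lborel)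
      \<le> ennreal ((2 * pi) ^ DIM('a) * A)"
    using A by (simp add: ennreal_mult)
qed auto

text \<open>
The weighted sum of \<open>2 ^ j |h (j + 1) - h j|\<^sup>2\<close> over \<open>j\<close> has a finite integral, hence is finite almost everywhere,
and this forces a geometric rate of pointwise convergence. Fatou's lemma turns the pointwise limit into a limit in
the mean.
\<close>
lemma L2_complete_rapid:
  fixes h :: "nat \<Rightarrow> 'a \<Rightarrow> complex"
  assumes [measurable]: "\<And>k. h k \<in> borel_measurable M"
    and c: "\<And>j k. j \<le> k \<Longrightarrow> (sqint M (\<lambda>x. h k x - h j x)) \<le> ennreal ((1/4) ^ j)"
  shows "\<exists>g \<in> borel_measurable M. \<forall>j. (sqint M (\<lambda>x. h j x - g x)) \<le> ennreal ((1/4) ^ j)"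
proof -
  have "(\<integral>\<^sup>+x. (\<Sum>j. ennreal (2 ^ j * (norm (h (Suc j) x - h j x))\<^sup>2)) \<partial>M) =
      (\<Sum>j. ennreal (2 ^ j) * (sqint M (\<lambda>x. h (Suc j) x - h j x)))"
    by (subst nn_integral_suminf) (auto simp: ennreal_mult nn_integral_cmult)
  also have "\<dots> \<le> (\<Sum>j. ennreal (2 ^ j) * ennreal ((1/4) ^ j))"
    by (intro suminf_le mult_left_mono c) auto
  also have "\<dots> = (\<Sum>j. ennreal ((1/2) ^ j))"
  proof (intro suminf_cong)
    fix j :: nat
    have "(2::real) ^ j * (1/4) ^ j = (1/2) ^ j" by (induction j) auto
    then show "ennreal (2 ^ j) * ennreal ((1/4) ^ j) = ennreal ((1/2) ^ j)"
      by (subst ennreal_mult[symmetric]) auto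
  qed
  also have "\<dots> < \<infinity>"
    by (subst suminf_ennreal2) (auto intro!: summable_geometric)
  finally have "AE x in M. (\<Sum>j. ennreal (2 ^ j * (norm (h (Suc j) x - h j x))\<^sup>2)) \<noteq> \<infinity>"
    by (intro nn_integral_PInf_AE) auto
  then have conv: "AE x in M. convergent (\<lambda>j. h j x)"
  proof eventually_elim
    fix x assume "(\<Sum>j. ennreal (2 ^ j * (norm (h (Suc j) x - h j x))\<^sup>2)) \<noteq> \<infinity>"
    then have sm: "summable (\<lambda>j. 2 ^ j * (norm (h (Suc j) x - h j x))\<^sup>2)"
      by (intro summable_suminf_not_top) auto
    from summable_imp_Bseq[OF this] obtain C where C: "C > 0" "\<And>j. norm (2 ^ j * (norm (h (Suc j) x - h j x))\<^sup>2) \<le> C"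
      by (auto elim: BseqE)
    have "norm (h (Suc j) x - h j x) \<le> sqrt C * (sqrt (1/2)) ^ j" for j
    proof -
      have "(norm (h (Suc j) x - h j x))\<^sup>2 \<le> C * (1/2) ^ j"
        using C(2)[of j] by (simp add: power_one_over field_simps)
      from real_sqrt_le_mono[OF this] show ?thesis by (simp add: real_sqrt_mult real_sqrt_power)
    qed
    moreover have "summable (\<lambda>j. sqrt C * (sqrt (1/2)) ^ j)"
      by (intro summable_mult summable_geometric) (simp add: real_sqrt_divide)
    ultimately have "summable (\<lambda>j. h (Suc j) x - h j x)"
      by (rule summable_comparison_test'[rotated, where N=0])
    then have "convergent (\<lambda>n. \<Sum>j<n. h (Suc j) x - h j x)" by (simp add: summable_iff_convergent)
    then have "convergent (\<lambda>n. h n x - h 0 x)" by (simp only: sum_lessThan_telescope[of "\<lambda>j. h j x"])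
    from convergent_add[OF this convergent_const[of "h 0 x"]] show "convergent (\<lambda>j. h j x)" by simp
  qed
  define g where "g x = lim (\<lambda>j. h j x)" for x
  have [measurable]: "g \<in> borel_measurable M" unfolding g_def by measurable
  have "(sqint M (\<lambda>x. h j x - g x)) \<le> ennreal ((1/4) ^ j)" for j
  proof -
    have "(sqint M (\<lambda>x. h j x - g x))
        = (\<integral>\<^sup>+x. liminf (\<lambda>k. ennreal ((norm (h k x - h j x))\<^sup>2)) \<partial>M)"
    proof (rule nn_integral_cong_AE, use conv in eventually_elim)
      case (elim x)
      then have "(\<lambda>k. h k x) \<longlonglongrightarrow> g x" by (simp add: g_def convergent_LIMSEQ_iff)
      then have "(\<lambda>k. ennreal ((norm (h k x - h j x))\<^sup>2))
          \<longlonglongrightarrow> ennreal ((norm (g x - h j x))\<^sup>2)"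
        by (intro tendsto_ennrealI tendsto_intros)
      from lim_imp_Liminf[OF _ this] show ?case by (simp add: norm_minus_commute)
    qed
    also have "\<dots> \<le> liminf (\<lambda>k. sqint M (\<lambda>x. h k x - h j x))"
      by (rule nn_integral_liminf) simp
    also have "\<dots> \<le> liminf (\<lambda>k. ennreal ((1/4) ^ j))"
      by (rule Liminf_mono) (auto simp: eventually_sequentially intro!: exI[of _ j] c)
    finally show ?thesis by (simp add: Liminf_const)
  qed
  then show ?thesis by (intro bexI[of _ g]) auto
qed

section \<open>The Fourier transform of square-integrable functions\<close>

lemma L2_sqnorm_lborel: "L2_sqnorm f = (sqint lborel f)"
  by (simp add: L2_sqnorm_def nn_integral_completion)

lemma L2_sqnorm_cong_AE:
  "AE x in lborel. f x = g x \<Longrightarrow> L2_sqnorm f = L2_sqnorm g"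
  unfolding L2_sqnorm_lborel by (rule nn_integral_cong_AE) auto

text \<open>
Product measures and affine substitutions are handled for Borel functions and \<open>lborel\<close>; this lemma is the passage
from Lebesgue measurable functions.
\<close>
lemma borel_representative:
  fixes f :: "'a::euclidean_space \<Rightarrow> complex"
  assumes [measurable]: "f \<in> borel_measurable lebesgue"
  obtains f' where "f' \<in> borel_measurable borel" "AE x in lborel. f x = f' x"
proof -
  obtain r where r: "r \<in> borel_measurable lborel" "AE x in lborel. Re (f x) = r x"
    using completion_ex_borel_measurable_real[of "\<lambda>x. Re (f x)" lborel] by auto
  obtain i where i: "i \<in> borel_measurable lborel" "AE x in lborel. Im (f x) = i x"
    using completion_ex_borel_measurable_real[of "\<lambda>x. Im (f x)" lborel] by auto
  show thesis
  proof (rule that[of "\<lambda>x. of_real (r x) + \<i> * of_real (i x)"])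
    show "AE x in lborel. f x = of_real (r x) + \<i> * of_real (i x)"
      using r(2) i(2) by eventually_elim (auto simp: complex_eq_iff)
  qed (use r i in auto)
qed

lemma borel_measurable_lebesgueI: "f \<in> borel_measurable borel \<Longrightarrow> f \<in> borel_measurable lebesgue"
  by (simp add: measurable_completion)

lemma AE_borel_imp_lebesgue_measurable:
  fixes f :: "'a::euclidean_space \<Rightarrow> complex"
  assumes f': "f' \<in> borel_measurable borel" and ae: "AE x in lborel. f x = f' x"
  shows "f \<in> borel_measurable lebesgue"
  using borel_measurable_AE[OF borel_measurable_lebesgueI[OF f'], of f] AE_completion[OF ae] by (simp add: eq_commute)

lemma L2_iff:
  fixes f :: "real^'n \<Rightarrow> complex"
  assumes [measurable]: "f \<in> borel_measurable lebesgue"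
  shows "f \<in> L2 \<longleftrightarrow> L2_sqnorm f < \<infinity>"
  unfolding L2_def L2_sqnorm_def by (auto simp: integrable_iff_bounded)

text \<open>
The Gaussian that \<open>ft\<close> maps to a multiple of itself.
\<close>
definition unit_gauss :: "'a::euclidean_space \<Rightarrow> complex" where
  "unit_gauss x = of_real (exp (- (norm x)\<^sup>2 / 2))"

lemma unit_gauss_conv: "unit_gauss = (\<lambda>x. complex_of_real (exp (- (1/2) * (norm x)\<^sup>2)))"
  by (simp add: unit_gauss_def fun_eq_iff)

lemma integrable_unit_gauss: "integrable lborel unit_gauss"
  unfolding unit_gauss_conv by (rule integrable_centered_gauss_complex) simp

lemma borel_measurable_unit_gauss [measurable]: "unit_gauss \<in> borel_measurable borel"
  using borel_measurable_integrable[OF integrable_unit_gauss] by simp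

lemma ft_unit_gauss: "ft unit_gauss (y::'a::euclidean_space) = of_real (sqrt (2 * pi) ^ DIM('a)) * unit_gauss y"
  unfolding unit_gauss_conv by (subst ft_gauss) (auto simp: mult.commute)

lemma norm_unit_gauss_le: "norm (unit_gauss x) \<le> 1" by (simp add: unit_gauss_def)

lemma unit_gauss_square_finite: "(sqint lborel (\<lambda>x. unit_gauss (y + x))) < \<infinity>"
proof -
  have "(sqint lborel (\<lambda>x. unit_gauss (y + x)))
      \<le> (\<integral>\<^sup>+x. ennreal (norm (unit_gauss (y + 1 *\<^sub>R x))) \<partial>lborel)"
  proof (intro nn_integral_mono ennreal_leI)
    fix x
    show "(norm (unit_gauss (y + x)))\<^sup>2 \<le> norm (unit_gauss (y + 1 *\<^sub>R x))"
      using norm_unit_gauss_le[of "y + x"] by (simp add: power2_eq_square mult_left_le)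
  qed
  also have "\<dots> < \<infinity>"
    using integrable_lborel_affine[OF integrable_unit_gauss, of 1 y] unfolding integrable_iff_bounded by simp
  finally show ?thesis .
qed

lemma integrable_mult_L2:
  fixes f h :: "'a \<Rightarrow> complex"
  assumes [measurable]: "f \<in> borel_measurable M" "h \<in> borel_measurable M"
    and f: "(sqint M f) < \<infinity>" and h: "(sqint M h) < \<infinity>"
  shows "integrable M (\<lambda>x. f x * h x)"
proof (rule Bochner_Integration.integrable_bound)
  show "integrable M (\<lambda>x. (norm (f x))\<^sup>2 + (norm (h x))\<^sup>2)"
    using f h by (intro Bochner_Integration.integrable_add) (auto simp: integrable_iff_bounded)
  have "norm (f x) * norm (h x) \<le> (norm (f x))\<^sup>2 + (norm (h x))\<^sup>2" for x
    using sum_squares_bound[of "norm (f x)" "norm (h x)"] mult_nonneg_nonneg[of "norm (f x)" "norm (h x)"]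
    by (simp del: mult_nonneg_nonneg)
  then show "AE x in M. norm (f x * h x) \<le> norm ((norm (f x))\<^sup>2 + (norm (h x))\<^sup>2)"
    by (intro AE_I2) (simp add: norm_mult)
qed simp

lemma square_integral_triangle:
  fixes f g :: "'a \<Rightarrow> complex"
  assumes [measurable]: "f \<in> borel_measurable M" "g \<in> borel_measurable M" "h \<in> borel_measurable M"
  shows "(sqint M (\<lambda>x. f x - h x)) \<le>
      2 * (sqint M (\<lambda>x. f x - g x)) + 2 * (sqint M (\<lambda>x. g x - h x))"
proof -
  have "(sqint M (\<lambda>x. f x - h x)) \<le>
     (\<integral>\<^sup>+x. 2 * ennreal ((norm (f x - g x))\<^sup>2) + 2 * ennreal ((norm (g x - h x))\<^sup>2) \<partial>M)"
  proof (intro nn_integral_mono)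
    fix x
    have "norm (f x - h x) \<le> norm (f x - g x) + norm (g x - h x)"
      using norm_triangle_ineq[of "f x - g x" "g x - h x"] by simp
    then have "(norm (f x - h x))\<^sup>2 \<le> (norm (f x - g x) + norm (g x - h x))\<^sup>2"
      by (intro power_mono) auto
    also have "\<dots> \<le> 2 * (norm (f x - g x))\<^sup>2 + 2 * (norm (g x - h x))\<^sup>2"
      using sum_squares_bound[of "norm (f x - g x)" "norm (g x - h x)"] by (simp add: power2_sum)
    finally have "ennreal ((norm (f x - h x))\<^sup>2)
        \<le> ennreal (2 * (norm (f x - g x))\<^sup>2 + 2 * (norm (g x - h x))\<^sup>2)"
      by (rule ennreal_leI)
    then show "ennreal ((norm (f x - h x))\<^sup>2)
        \<le> 2 * ennreal ((norm (f x - g x))\<^sup>2) + 2 * ennreal ((norm (g x - h x))\<^sup>2)"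
      by (simp add: ennreal_mult)
  qed
  also have "\<dots> = 2 * (sqint M (\<lambda>x. f x - g x)) + 2 * (sqint M (\<lambda>x. g x - h x))"
    by (simp add: nn_integral_add nn_integral_cmult)
  finally show ?thesis .
qed

lemma tendsto_integral_mult_L2:
  fixes f h :: "'a \<Rightarrow> complex"
  assumes [measurable]: "\<And>k. u k \<in> borel_measurable M" "f \<in> borel_measurable M" "h \<in> borel_measurable M"
    and uint: "\<And>k. integrable M (\<lambda>x. u k x * h x)"
    and f: "(sqint M f) < \<infinity>"
    and h: "(sqint M h) < \<infinity>"
    and uf: "(\<lambda>k. sqint M (\<lambda>x. u k x - f x)) \<longlonglongrightarrow> 0"
  shows "(\<lambda>k. LINT x|M. u k x * h x) \<longlonglongrightarrow> (LINT x|M. f x * h x)"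
proof -
  define H where "H = enn2real (sqint M h)"
  have H: "(sqint M h) = ennreal H" using h by (simp add: H_def)
  have fint: "integrable M (\<lambda>x. f x * h x)" by (rule integrable_mult_L2[OF _ _ f h]) auto
  let ?d = "\<lambda>k. norm ((LINT x|M. u k x * h x) - (LINT x|M. f x * h x))"
  have bd: "ennreal ((?d k)\<^sup>2) \<le> (sqint M (\<lambda>x. u k x - f x)) * ennreal H" for k
  proof -
    have "(LINT x|M. u k x * h x) - (LINT x|M. f x * h x) = (LINT x|M. (u k x - f x) * h x)"
      using uint fint by (simp add: left_diff_distrib)
    then have "ennreal (?d k) \<le> (\<integral>\<^sup>+x. ennreal (norm (u k x - f x)) * ennreal (norm (h x)) \<partial>M)"
      using ennreal_norm_integral_le[of M "\<lambda>x. (u k x - f x) * h x"] by (simp add: norm_mult ennreal_mult)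
    then have "(ennreal (?d k))\<^sup>2
        \<le> (\<integral>\<^sup>+x. ennreal (norm (u k x - f x)) * ennreal (norm (h x)) \<partial>M)\<^sup>2"
      by (rule power_mono) simp
    also have "\<dots> \<le> (\<integral>\<^sup>+x. (ennreal (norm (u k x - f x)))\<^sup>2 \<partial>M)
        * (\<integral>\<^sup>+x. (ennreal (norm (h x)))\<^sup>2 \<partial>M)"
      by (rule Cauchy_Schwarz_nn_integral) auto
    finally show ?thesis by (simp add: ennreal_power H)
  qed
  have "(\<lambda>k. (sqint M (\<lambda>x. u k x - f x)) * ennreal H) \<longlonglongrightarrow> 0 * ennreal H"
    by (intro tendsto_mult_ennreal tendsto_const uf) auto
  then have lim0: "(\<lambda>k. (sqint M (\<lambda>x. u k x - f x)) * ennreal H) \<longlonglongrightarrow> 0" by simp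
  have "(\<lambda>k. ennreal ((?d k)\<^sup>2)) \<longlonglongrightarrow> 0"
    by (rule tendsto_sandwich[OF _ _ tendsto_const lim0]) (auto intro!: always_eventually bd)
  then have "(\<lambda>k. ennreal ((?d k)\<^sup>2)) \<longlonglongrightarrow> ennreal 0" by simp
  then have "(\<lambda>k. (?d k)\<^sup>2) \<longlonglongrightarrow> 0" by (subst (asm) tendsto_ennreal_iff) auto
  then have "?d \<longlonglongrightarrow> 0" using tendsto_real_sqrt[of "\<lambda>k. (?d k)\<^sup>2" 0] by simp
  then show ?thesis by (simp add: LIM_zero_iff tendsto_norm_zero_iff)
qed

lemma fourier_integral_eq_ft:
  fixes f :: "real^'n \<Rightarrow> complex"
  assumes f': "f' \<in> borel_measurable borel" and ae: "AE x in lborel. f x = f' x"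
  shows "fourier_integral f y = ft f' (- y) / of_real (sqrt (2 * pi) ^ CARD('n))"
proof -
  have "(LINT x|lebesgue. f x * exp (- \<i> * of_real (x \<bullet> y))) = (LINT x|lebesgue. f' x * cis (x \<bullet> (- y)))"
  proof (rule integral_cong_AE)
    have f: "f \<in> borel_measurable lebesgue" by (rule AE_borel_imp_lebesgue_measurable[OF f' ae])
    have "(\<lambda>x. exp (- \<i> * of_real (x \<bullet> y))) \<in> borel_measurable lebesgue"
      by (intro borel_measurable_lebesgueI borel_measurable_continuous_onI continuous_intros)
    with f show "(\<lambda>x. f x * exp (- \<i> * of_real (x \<bullet> y))) \<in> borel_measurable lebesgue" by simp
    show "(\<lambda>x. f' x * cis (x \<bullet> - y)) \<in> borel_measurable lebesgue"
      using f' by (intro borel_measurable_lebesgueI) simp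
    show "AE x in lebesgue. f x * exp (- \<i> * of_real (x \<bullet> y)) = f' x * cis (x \<bullet> - y)"
      using AE_completion[OF ae] by eventually_elim (simp add: cis_conv_exp)
  qed
  also have "\<dots> = ft f' (- y)"
    unfolding ft_def using f' by (intro integral_completion) simp
  finally have 1: "(LINT x|lebesgue. f x * exp (- \<i> * of_real (x \<bullet> y))) = ft f' (- y)" .
  have "(2 * pi) powr (- real CARD('n) / 2) = ((2 * pi) powr (1/2)) powr (- real CARD('n))"
    by (simp add: powr_powr)
  also have "\<dots> = 1 / sqrt (2 * pi) ^ CARD('n)"
    by (simp add: powr_half_sqrt powr_minus powr_realpow field_simps)
  finally show ?thesis unfolding fourier_integral_def 1 by simp
qed

lemma integrable_L1_representative:
  fixes f :: "real^'n \<Rightarrow> complex"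
  assumes f: "integrable lebesgue f" and f': "f' \<in> borel_measurable borel" and ae: "AE x in lborel. f x = f' x"
  shows "integrable lborel f'"
proof -
  have "integrable lebesgue f'"
    using f borel_measurable_lebesgueI[OF f'] AE_completion[OF ae] by (subst integrable_cong_AE[of _ _ f]) (auto simp: eq_commute)
  then show ?thesis using f' by (simp add: integrable_completion)
qed

text \<open>
The Fourier integrals of the approximating functions do not change when these are replaced by Borel
representatives, so the definition of a Fourier pair carries over as a whole.
\<close>
lemma has_fourier_L2_borel:
  fixes f g :: "real^'n \<Rightarrow> complex"
  assumes "has_fourier_L2 f g"
    and f': "f' \<in> borel_measurable borel" "AE x in lborel. f x = f' x"
    and g': "g' \<in> borel_measurable borel" "AE x in lborel. g x = g' x"
  obtains s where "\<And>k. integrable lborel (s k)"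
    "\<And>k. (sqint lborel (\<lambda>x. s k x)) < \<infinity>"
    "(sqint lborel f') < \<infinity>"
    "(sqint lborel g') < \<infinity>"
    "(\<lambda>k. sqint lborel (\<lambda>x. s k x - f' x)) \<longlonglongrightarrow> 0"
    "(\<lambda>k. sqint lborel (\<lambda>y. ft (s k) (- y) / of_real (sqrt (2 * pi) ^ CARD('n)) - g' y))
        \<longlonglongrightarrow> 0"
proof -
  obtain t where t: "\<And>k. t k \<in> L1 \<inter> L2" "L2_tendsto t f sequentially"
      "L2_tendsto (\<lambda>k. fourier_integral (t k)) g sequentially"
    and fg: "f \<in> L2" "g \<in> L2"
    using assms(1) unfolding has_fourier_L2_def by auto
  have "\<forall>k. \<exists>s. s \<in> borel_measurable borel \<and> (AE x in lborel. t k x = s x)"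
  proof
    fix k
    have "t k \<in> borel_measurable lebesgue" using t(1)[of k] by (simp add: L2_def)
    then show "\<exists>s. s \<in> borel_measurable borel \<and> (AE x in lborel. t k x = s x)"
      by (rule borel_representative) blast
  qed
  from choice[OF this] obtain s where s: "\<And>k. s k \<in> borel_measurable borel" "\<And>k. AE x in lborel. t k x = s k x"
    by blast
  have 1: "integrable lborel (s k)" for k
    using t(1)[of k] s(1)[of k] s(2)[of k] by (intro integrable_L1_representative[of "t k"]) (auto simp: L1_def)
  have fin: "(sqint lborel h') < \<infinity>" if "h \<in> L2" "AE x in lborel. h x = h' x" for h h' :: "real^'n \<Rightarrow> complex"
  proof -
    have "L2_sqnorm h < \<infinity>" using that(1) L2_iff[of h] by (simp add: L2_def)
    then show ?thesis unfolding L2_sqnorm_cong_AE[OF that(2)] unfolding L2_sqnorm_lborel .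
  qed
  have 5: "(\<lambda>k. sqint lborel (\<lambda>x. s k x - f' x)) \<longlonglongrightarrow> 0"
  proof -
    have "L2_sqnorm (\<lambda>x. t k x - f x) = L2_sqnorm (\<lambda>x. s k x - f' x)" for k
      by (rule L2_sqnorm_cong_AE) (use s(2)[of k] f'(2) in \<open>eventually_elim, simp\<close>)
    then show ?thesis using t(2) unfolding L2_tendsto_def L2_sqnorm_lborel by simp
  qed
  have 6: "(\<lambda>k. sqint lborel (\<lambda>y. ft (s k) (- y) / of_real (sqrt (2 * pi) ^ CARD('n)) - g' y))
      \<longlonglongrightarrow> 0"
  proof -
    have "L2_sqnorm (\<lambda>x. fourier_integral (t k) x - g x)
        = L2_sqnorm (\<lambda>y. ft (s k) (- y) / of_real (sqrt (2 * pi) ^ CARD('n)) - g' y)" for k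
      by (rule L2_sqnorm_cong_AE) (use g'(2) in \<open>eventually_elim, simp add: fourier_integral_eq_ft[OF s]\<close>)
    then show ?thesis using t(3) unfolding L2_tendsto_def L2_sqnorm_lborel by simp
  qed
  have 2: "(sqint lborel (\<lambda>x. s k x)) < \<infinity>" for k
    using t(1)[of k] by (intro fin[OF _ s(2)[of k]]) auto
  show thesis
    by (rule that[OF 1 2 fin[OF fg(1) f'(2)] fin[OF fg(2) g'(2)] 5 6])
qed

lemma unit_gauss_minus: "unit_gauss (- x) = unit_gauss x" by (simp add: unit_gauss_def)

text \<open>
For integrable functions this is the rule that a product with a Gaussian is transformed into a convolution with a
Gaussian. Both sides are pairings with square-integrable functions, so the rule persists in the \<open>L\<^sup>2\<close> limit,
even though \<open>f\<close> and \<open>g\<close> need not be integrable.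
\<close>
lemma has_fourier_L2_gauss_twist:
  fixes f g :: "real^'n \<Rightarrow> complex"
  assumes fg: "has_fourier_L2 f g"
    and f': "f' \<in> borel_measurable borel" "AE x in lborel. f x = f' x"
    and g': "g' \<in> borel_measurable borel" "AE x in lborel. g x = g' x"
  shows "ft (\<lambda>x. f' x * unit_gauss x) y = (LINT \<eta>|lborel. g' \<eta> * unit_gauss (y + \<eta>))"
proof -
  define N where "N = complex_of_real (sqrt (2 * pi) ^ CARD('n))"
  have N: "N \<noteq> 0" by (simp add: N_def)
  obtain s where s: "\<And>k. integrable lborel (s k)"
    "\<And>k. (sqint lborel (\<lambda>x. s k x)) < \<infinity>"
    and ff: "(sqint lborel f') < \<infinity>"
    and gf: "(sqint lborel g') < \<infinity>"
    and sf: "(\<lambda>k. sqint lborel (\<lambda>x. s k x - f' x)) \<longlonglongrightarrow> 0"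
    and sg: "(\<lambda>k. sqint lborel (\<lambda>y. ft (s k) (- y) / N - g' y)) \<longlonglongrightarrow> 0"
    using has_fourier_L2_borel[OF fg f' g', folded N_def] by blast
  note [measurable] = f'(1) g'(1)
  have [measurable]: "s k \<in> borel_measurable borel" for k using s(1)[of k] by auto
  note [measurable] = borel_measurable_ft[OF s(1)]
  have eq: "(LINT x|lborel. s k x * (unit_gauss x * cis (x \<bullet> y)))
      = (LINT \<eta>|lborel. (ft (s k) (- \<eta>) / N) * unit_gauss (y + \<eta>))" for k
  proof -
    have "N * (LINT x|lborel. s k x * (unit_gauss x * cis (x \<bullet> y))) = ft (\<lambda>x. ft unit_gauss x * s k x) y"
      unfolding ft_unit_gauss ft_def[of "\<lambda>x. _ x
          * s k x"] N_def by (subst integral_mult_right_zero[symmetric]) (simp add: mult_ac)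
    also have "\<dots> = (LINT x|lborel. unit_gauss x * ft (s k) (x + y))"
      by (rule ft_mult_ft[OF integrable_unit_gauss s(1)])
    also have "\<dots> = (LINT \<eta>|lborel. unit_gauss (- y - \<eta>) * ft (s k) (- \<eta>))"
      using lborel_integral_affine[of "\<lambda>x. unit_gauss x * ft (s k) (x + y)" "-1" "- y"] by simp
    also have "\<dots> = (LINT \<eta>|lborel. N * ((ft (s k) (- \<eta>) / N) * unit_gauss (y + \<eta>)))"
      using N unit_gauss_minus[of "y + _"] by (simp add: mult.commute)
    also have "\<dots> = N * (LINT \<eta>|lborel. (ft (s k) (- \<eta>) / N) * unit_gauss (y + \<eta>))"
      by (rule integral_mult_right_zero)
    finally show ?thesis using N by (simp add: field_simps)
  qed
  have lim1: "(\<lambda>k. LINT x|lborel. s k x * (unit_gauss x * cis (x \<bullet> y)))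
      \<longlonglongrightarrow> (LINT x|lborel. f' x * (unit_gauss x * cis (x \<bullet> y)))"
  proof (rule tendsto_integral_mult_L2[OF _ _ _ _ ff _ sf])
    show "(sqint lborel (\<lambda>x. unit_gauss x * cis (x \<bullet> y))) < \<infinity>"
      using unit_gauss_square_finite[of 0] by (simp add: norm_mult)
    show "integrable lborel (\<lambda>x. s k x * (unit_gauss x * cis (x \<bullet> y)))" for k
      by (rule integrable_mult_bounded[OF s(1), where B=1]) (auto simp: norm_mult norm_unit_gauss_le)
  qed auto
  have lim2: "(\<lambda>k. LINT \<eta>|lborel. (ft (s k) (- \<eta>) / N) * unit_gauss (y + \<eta>))
      \<longlonglongrightarrow> (LINT \<eta>|lborel. g' \<eta> * unit_gauss (y + \<eta>))"
  proof (rule tendsto_integral_mult_L2[OF _ _ _ _ gf unit_gauss_square_finite sg])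
    show "integrable lborel (\<lambda>\<eta>. (ft (s k) (- \<eta>) / N) * unit_gauss (y + \<eta>))" for k
    proof -
      have "integrable lborel (\<lambda>\<eta>. unit_gauss (y + 1 *\<^sub>R \<eta>) * (ft (s k) (- \<eta>) / N))"
      proof (rule integrable_mult_bounded[OF integrable_lborel_affine[OF integrable_unit_gauss]])
        show "norm (ft (s k) (- \<eta>) / N) \<le> (LINT x|lborel. norm (s k x)) / norm N" for \<eta>
          unfolding norm_divide by (intro divide_right_mono norm_ft_le s(1)) simp
      qed auto
      then show ?thesis by (simp add: mult.commute)
    qed
  qed auto
  from LIMSEQ_unique[OF lim1] lim2 show ?thesis
    unfolding eq ft_def by (simp add: mult.assoc)
qed

text \<open>
Multiplied by a Gaussian, \<open>f\<close> and the inverse Fourier integral of \<open>g\<close> become integrable functions with the same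
transform, by \<open>has_fourier_L2_gauss_twist\<close>; injectivity then identifies them.
\<close>
lemma has_fourier_L2_inversion:
  fixes f g :: "real^'n \<Rightarrow> complex"
  assumes fg: "has_fourier_L2 f g"
    and f': "f' \<in> borel_measurable borel" "AE x in lborel. f x = f' x"
    and g': "g' \<in> borel_measurable borel" "AE x in lborel. g x = g' x"
    and gi: "integrable lborel g'"
  shows "AE x in lborel. f' x = ft g' x / of_real (sqrt (2 * pi) ^ CARD('n))"
proof -
  define N where "N = complex_of_real (sqrt (2 * pi) ^ CARD('n))"
  have N: "N \<noteq> 0" by (simp add: N_def)
  note [measurable] = f'(1) g'(1)
  have ff: "(sqint lborel f') < \<infinity>"
    by (rule has_fourier_L2_borel[OF fg f' g'])
  have i1: "integrable lborel (\<lambda>x. f' x * unit_gauss x)"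
    using unit_gauss_square_finite[of 0] by (intro integrable_mult_L2 ff) auto
  have i2: "integrable lborel (\<lambda>x. ft g' x * unit_gauss x)"
    using integrable_mult_bounded[OF integrable_unit_gauss borel_measurable_ft[OF gi] norm_ft_le[OF gi]]
    by (simp add: mult.commute)
  have i: "integrable lborel (\<lambda>x. f' x * unit_gauss x - ft g' x * unit_gauss x / N)"
    using i1 i2 by simp
  have "ft (\<lambda>x. f' x * unit_gauss x - ft g' x * unit_gauss x / N) y = 0" for y
  proof -
    have "ft (\<lambda>x. f' x * unit_gauss x - ft g' x * unit_gauss x / N) y
        = ft (\<lambda>x. f' x * unit_gauss x) y - ft (\<lambda>x. ft g' x * unit_gauss x) y / N"
      unfolding ft_def[of "\<lambda>x. f' x * unit_gauss x - ft g' x * unit_gauss x / N"] ft_def[of "\<lambda>x. f' x * unit_gauss x"]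
        ft_def[of "\<lambda>x. ft g' x * unit_gauss x"]
      using integrable_mult_cis[OF i1] integrable_mult_cis[OF i2]
      by (simp add: left_diff_distrib)
    also have "ft (\<lambda>x. ft g' x * unit_gauss x) y = (LINT x|lborel. N * (g' x * unit_gauss (y + x)))"
      unfolding ft_mult_ft[OF gi integrable_unit_gauss] ft_unit_gauss by (simp add: N_def add.commute mult_ac)
    also have "\<dots> = N * (LINT x|lborel. g' x * unit_gauss (y + x))"
      by (rule integral_mult_right_zero)
    also have "ft (\<lambda>x. f' x * unit_gauss x) y = (LINT x|lborel. g' x * unit_gauss (y + x))"
      by (rule has_fourier_L2_gauss_twist[OF fg f' g'])
    finally show ?thesis using N by simp
  qed
  from ft_injective[OF i this] show ?thesis
  proof eventually_elim
    case (elim x)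
    then have "(f' x - ft g' x / N) * unit_gauss x = 0" by (simp add: algebra_simps)
    moreover have "unit_gauss x \<noteq> 0" by (simp add: unit_gauss_def)
    ultimately have "f' x - ft g' x / N = 0" by (simp only: mult_eq_0_iff) blast
    then show ?case by (simp add: N_def)
  qed
qed

lemma square_integral_ft_le:
  fixes s :: "real^'n \<Rightarrow> complex"
  assumes s: "integrable lborel s" and fin: "(sqint lborel s) < \<infinity>"
  shows "(sqint lborel (\<lambda>y. ft s (- y) / of_real (sqrt (2 * pi) ^ CARD('n))))
     \<le> (sqint lborel s)"
proof -
  define A where "A = enn2real (sqint lborel s)"
  have A: "(sqint lborel s) = ennreal A" "A \<ge> 0" using fin by (auto simp: A_def)
  note [measurable] = borel_measurable_ft[OF s]
  have sq: "(sqrt (2 * pi) ^ CARD('n))\<^sup>2 = (2 * pi) ^ CARD('n)"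
    by (simp add: power_mult[symmetric] mult.commute[of _ 2]) (simp add: power_mult)
  have "(sqint lborel (\<lambda>y. ft s (- y) / of_real (sqrt (2 * pi) ^ CARD('n)))) =
     (\<integral>\<^sup>+y. ennreal (1 / (2 * pi) ^ CARD('n)) * ennreal ((norm (ft s (- y)))\<^sup>2) \<partial>lborel)"
  proof (intro nn_integral_cong)
    fix y
    have "(norm (ft s (- y) / of_real (sqrt (2 * pi) ^ CARD('n))))\<^sup>2
        = (norm (ft s (- y)))\<^sup>2 / (sqrt (2 * pi) ^ CARD('n))\<^sup>2"
      by (simp only: norm_divide power_divide norm_of_real power2_abs)
    then show "ennreal ((norm (ft s (- y) / of_real (sqrt (2 * pi) ^ CARD('n))))\<^sup>2) =
        ennreal (1 / (2 * pi) ^ CARD('n)) * ennreal ((norm (ft s (- y)))\<^sup>2)"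
      unfolding sq by (simp add: ennreal_mult[symmetric])
  qed
  also have "\<dots> = ennreal (1 / (2 * pi) ^ CARD('n)) * (sqint lborel (\<lambda>y. ft s (- y)))"
    by (rule nn_integral_cmult) simp
  also have "(sqint lborel (\<lambda>y. ft s (- y))) = (sqint lborel (\<lambda>y. ft s y))"
    using nn_integral_lborel_affine[of "\<lambda>y. ennreal ((norm (ft s y))\<^sup>2)" "-1" 0] by simp
  also have "ennreal (1 / (2 * pi) ^ CARD('n)) * \<dots>
      \<le> ennreal (1 / (2 * pi) ^ CARD('n)) * ennreal ((2 * pi) ^ CARD('n) * A)"
    using plancherel_le[OF s, of A] A by (intro mult_left_mono) auto
  also have "\<dots> = ennreal A"
    using A by (simp add: ennreal_mult[symmetric])
  finally show ?thesis unfolding A .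
qed

text \<open>
The Fourier integral does not increase the \<open>L\<^sup>2\<close> norm, so the Fourier integrals of the approximating functions
converge to that of \<open>f\<close> as well as to \<open>g\<close>.
\<close>
lemma has_fourier_L2_L1:
  fixes f g :: "real^'n \<Rightarrow> complex"
  assumes fg: "has_fourier_L2 f g"
    and f': "f' \<in> borel_measurable borel" "AE x in lborel. f x = f' x"
    and g': "g' \<in> borel_measurable borel" "AE x in lborel. g x = g' x"
    and fi: "integrable lborel f'"
  shows "AE y in lborel. g' y = ft f' (- y) / of_real (sqrt (2 * pi) ^ CARD('n))"
proof -
  define N where "N = complex_of_real (sqrt (2 * pi) ^ CARD('n))"
  obtain s where s: "\<And>k. integrable lborel (s k)"
    "\<And>k. (sqint lborel (\<lambda>x. s k x)) < \<infinity>"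
    and ff: "(sqint lborel f') < \<infinity>"
    and gf: "(sqint lborel g') < \<infinity>"
    and sf: "(\<lambda>k. sqint lborel (\<lambda>x. s k x - f' x)) \<longlonglongrightarrow> 0"
    and sg: "(\<lambda>k. sqint lborel (\<lambda>y. ft (s k) (- y) / N - g' y)) \<longlonglongrightarrow> 0"
    using has_fourier_L2_borel[OF fg f' g', folded N_def] by blast
  note [measurable] = f'(1) g'(1)
  have [measurable]: "s k \<in> borel_measurable borel" for k using s(1)[of k] by auto
  note [measurable] = borel_measurable_ft[OF s(1)] borel_measurable_ft[OF fi]
  let ?I = "sqint lborel (\<lambda>y. ft f' (- y) / N - g' y)"
  let ?S = "\<lambda>k. sqint lborel (\<lambda>x. s k x - f' x)"
  let ?G = "\<lambda>k. sqint lborel (\<lambda>y. ft (s k) (- y) / N - g' y)"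
  have bd: "?I \<le> 2 * ?S k + 2 * ?G k" for k
  proof -
    have fin: "(sqint lborel (\<lambda>x. f' x - s k x)) < \<infinity>"
    proof -
      have "(sqint lborel (\<lambda>x. f' x - s k x)) \<le>
         2 * (sqint lborel (\<lambda>x. f' x - 0)) + 2 * (sqint lborel (\<lambda>x. 0 - s k x))"
        by (rule square_integral_triangle) auto
      also have "\<dots> < \<infinity>" using ff s(2)[of k] by (simp add: ennreal_mult_less_top)
      finally show ?thesis .
    qed
    have int: "integrable lborel (\<lambda>x. f' x - s k x)" using fi s(1) by simp
    have lin: "ft (\<lambda>x. f' x - s k x) y = ft f' y - ft (s k) y" for y
      unfolding ft_def using integrable_mult_cis[OF fi] integrable_mult_cis[OF s(1)]
      by (simp add: left_diff_distrib)
    have "?I \<le> 2 * (sqint lborel (\<lambda>y. ft f' (- y) / N - ft (s k) (- y) / N)) + 2 * ?G k"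
      by (rule square_integral_triangle) auto
    also have "(sqint lborel (\<lambda>y. ft f' (- y) / N - ft (s k) (- y) / N)) \<le>
       (sqint lborel (\<lambda>x. f' x - s k x))"
      using square_integral_ft_le[OF int fin] unfolding lin N_def by (simp add: diff_divide_distrib)
    finally show ?thesis by (simp add: norm_minus_commute mult_left_mono add_mono)
  qed
  have "(\<lambda>k. 2 * ?S k + 2 * ?G k) \<longlonglongrightarrow> 2 * 0 + 2 * 0"
    by (intro tendsto_add tendsto_mult_ennreal tendsto_const sf sg) auto
  then have "?I \<le> 2 * 0 + 2 * 0"
    by (rule LIMSEQ_le_const) (use bd in blast)
  then have "?I = 0" by simp
  then have "AE y in lborel. ennreal ((cmod (ft f' (- y) / N - g' y))\<^sup>2) = 0"
    by (subst (asm) nn_integral_0_iff_AE) auto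
  then show ?thesis by eventually_elim (auto simp: N_def)
qed

text \<open>
Since \<open>fourier_L2\<close> is a choice of a transform, nothing can be said about it before a transform is exhibited.
Truncations of \<open>f\<close> to balls that converge rapidly to \<open>f\<close> have Fourier integrals that form a rapid Cauchy sequence.
\<close>
lemma has_fourier_L2_ex:
  fixes f :: "real^'n \<Rightarrow> complex"
  assumes f: "f \<in> L2"
  shows "\<exists>g. has_fourier_L2 f g"
proof -
  define N where "N = complex_of_real (sqrt (2 * pi) ^ CARD('n))"
  have fm: "f \<in> borel_measurable lebesgue" using f by (simp add: L2_def)
  obtain f' where f': "f' \<in> borel_measurable borel" "AE x in lborel. f x = f' x"
    by (rule borel_representative[OF fm])
  note [measurable] = f'(1)
  have ff: "(sqint lborel f') < \<infinity>"
    using f L2_iff[OF fm] L2_sqnorm_cong_AE[OF f'(2)] unfolding L2_sqnorm_lborel by simp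
  define u where "u m x = f' x * indicator (ball 0 (real m)) x" for m :: nat and x :: "real^'n"
  have [measurable]: "u m \<in> borel_measurable borel" for m
  proof -
    have [measurable]: "ball (0::real^'n) (real m) \<in> sets borel" by simp
    show ?thesis unfolding u_def by measurable
  qed
  have ufin: "(sqint lborel (\<lambda>x. u m x)) < \<infinity>" for m
  proof (rule le_less_trans[OF nn_integral_mono ff])
    show "ennreal ((cmod (u m x))\<^sup>2) \<le> ennreal ((cmod (f' x))\<^sup>2)" for x
      by (cases "x \<in> ball 0 (real m)") (simp_all add: u_def)
  qed
  have uint: "integrable lborel (u m)" for m
  proof -
    have "integrable lborel (\<lambda>x. f' x * (indicator (ball 0 (real m)) x :: complex))"
    proof (rule integrable_mult_L2[OF _ _ ff])
      have "(sqint lborel (\<lambda>x. indicator (ball (0::real^'n) (real m)) x))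
          = (\<integral>\<^sup>+x. indicator (ball (0::real^'n) (real m)) x \<partial>lborel)"
        by (intro nn_integral_cong) (auto simp: indicator_def)
      also have "\<dots> = emeasure lborel (ball (0::real^'n) (real m))" by (rule nn_integral_indicator) simp
      also have "\<dots> < \<infinity>" using emeasure_lborel_ball_finite[of "0::real^'n" "real m"] by simp
      finally show "(sqint lborel (\<lambda>x. indicator (ball (0::real^'n) (real m)) x)) < \<infinity>" .
    qed (auto intro!: borel_measurable_indicator)
    moreover have "u m = (\<lambda>x. f' x * indicator (ball 0 (real m)) x)" by (rule ext) (rule u_def)
    ultimately show ?thesis by simp
  qed
  have ulim: "(\<lambda>m. sqint lborel (\<lambda>x. u m x - f' x))
      \<longlonglongrightarrow> (\<integral>\<^sup>+x. 0 \<partial>(lborel :: (real^'n) measure))"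
  proof (rule nn_integral_dominated_convergence[where w="\<lambda>x. ennreal ((cmod (f' x))\<^sup>2)"])
    show "AE x in lborel. (\<lambda>m. ennreal ((cmod (u m x - f' x))\<^sup>2)) \<longlonglongrightarrow> 0"
    proof (intro AE_I2 tendsto_eventually)
      fix x :: "real^'n"
      obtain M where "norm x < real M" using reals_Archimedean2 by blast
      then show "\<forall>\<^sub>F m in sequentially. ennreal ((cmod (u m x - f' x))\<^sup>2) = 0"
        by (auto simp: eventually_sequentially u_def indicator_def intro!: exI[of _ M])
    qed
    show "AE x in lborel. ennreal ((cmod (u m x - f' x))\<^sup>2) \<le> ennreal ((cmod (f' x))\<^sup>2)" for m
    proof (intro AE_I2)
      show "ennreal ((cmod (u m x - f' x))\<^sup>2) \<le> ennreal ((cmod (f' x))\<^sup>2)" for x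
        by (cases "x \<in> ball 0 (real m)") (simp_all add: u_def)
    qed
  qed (use ff in auto)
  (* The extra factor 1/4 makes up for the constants in the quadratic triangle inequality. *)
  have "\<forall>j. \<exists>m. (sqint lborel (\<lambda>x. u m x - f' x)) < ennreal ((1/4) ^ j / 4)"
  proof
    fix j :: nat
    have "\<forall>\<^sub>F m in sequentially. (sqint lborel (\<lambda>x. u m x - f' x)) < ennreal ((1/4) ^ j / 4)"
      by (rule order_tendstoD(2)[OF ulim]) (simp del: ennreal_divide_numeral)
    then show "\<exists>m. (sqint lborel (\<lambda>x. u m x - f' x)) < ennreal ((1/4) ^ j / 4)"
      unfolding eventually_sequentially by blast
  qed
  from choice[OF this] obtain r where r: "\<And>j. (sqint lborel (\<lambda>x. u (r j) x - f' x)) < ennreal ((1/4) ^ j / 4)"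
    by blast
  define s where "s j = u (r j)" for j
  have [measurable]: "s j \<in> borel_measurable borel" for j by (simp add: s_def)
  have sint: "integrable lborel (s j)" and sfin: "(sqint lborel (\<lambda>x. s j x)) < \<infinity>" for j
    by (simp_all add: s_def uint ufin[simplified])
  have sf: "(sqint lborel (\<lambda>x. s j x - f' x)) \<le> ennreal ((1/4) ^ j / 4)" for j
    using r[of j] by (simp add: s_def less_imp_le)
  have ss: "(sqint lborel (\<lambda>x. s k x - s j x)) \<le> ennreal ((1/4) ^ j)" if "j \<le> k" for j k
  proof -
    have "(sqint lborel (\<lambda>x. s k x - s j x)) \<le>
       2 * (sqint lborel (\<lambda>x. s k x - f' x)) + 2 * (sqint lborel (\<lambda>x. f' x - s j x))"
      by (rule square_integral_triangle) auto
    also have "\<dots> \<le> 2 * ennreal ((1/4) ^ j / 4) + 2 * ennreal ((1/4) ^ j / 4)"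
    proof (intro add_mono mult_left_mono)
      have "(1/4::real) ^ k \<le> (1/4) ^ j" using that by (intro power_decreasing) auto
      then show "(sqint lborel (\<lambda>x. s k x - f' x)) \<le> ennreal ((1/4) ^ j / 4)"
        by (intro order_trans[OF sf] ennreal_leI) simp
      show "(sqint lborel (\<lambda>x. f' x - s j x)) \<le> ennreal ((1/4) ^ j / 4)"
        using sf[of j] by (simp add: norm_minus_commute)
    qed auto
    also have "\<dots> = ennreal ((1/4) ^ j)"
    proof -
      define q where "q = (1/4::real) ^ j / 4"
      have q: "q \<ge> 0" by (simp add: q_def)
      have "2 * ennreal q = ennreal (2 * q)" using q ennreal_mult[of 2 q] by simp
      then have "2 * ennreal q + 2 * ennreal q = ennreal (2 * q + 2 * q)"
        using q by (simp only: ennreal_plus[symmetric])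
      also have "2 * q + 2 * q = (1/4) ^ j" by (simp add: q_def)
      finally show ?thesis by (simp only: q_def)
    qed
    finally show ?thesis .
  qed
  define h where "h j y = ft (s j) (- y) / N" for j y
  have [measurable]: "h j \<in> borel_measurable borel" for j
    unfolding h_def using borel_measurable_ft[OF sint, of j] by measurable
  have hh: "(sqint lborel (\<lambda>y. h k y - h j y)) \<le> ennreal ((1/4) ^ j)" if "j \<le> k" for j k
  proof -
    have int: "integrable lborel (\<lambda>x. s k x - s j x)" using sint by simp
    have fin: "(sqint lborel (\<lambda>x. s k x - s j x)) < \<infinity>"
      using ss[OF that] by (rule le_less_trans) simp
    have lin: "ft (\<lambda>x. s k x - s j x) y = ft (s k) y - ft (s j) y" for y
      unfolding ft_def using integrable_mult_cis[OF sint] by (simp add: left_diff_distrib)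
    show ?thesis
      using order_trans[OF square_integral_ft_le[OF int fin] ss[OF that]]
      unfolding lin h_def N_def by (simp add: diff_divide_distrib)
  qed
  obtain g where [measurable]: "g \<in> borel_measurable borel"
      and g: "\<And>j. (sqint lborel (\<lambda>y. h j y - g y)) \<le> ennreal ((1/4) ^ j)"
    using L2_complete_rapid[of h lborel] hh by auto
  have lim: "(\<lambda>j. ennreal ((1/4) ^ j)) \<longlonglongrightarrow> 0"
    using tendsto_ennrealI[OF LIMSEQ_power_zero[of "1/4::real"]] by simp
  have hfin: "(sqint lborel (\<lambda>y. h j y)) < \<infinity>" for j
    unfolding h_def N_def by (rule le_less_trans[OF square_integral_ft_le[OF sint sfin] sfin])
  have gfin: "(sqint lborel g) < \<infinity>"
  proof -
    have "(sqint lborel (\<lambda>y. 0 - g y)) \<le>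
       2 * (sqint lborel (\<lambda>y. 0 - h 0 y)) + 2 * (sqint lborel (\<lambda>y. h 0 y - g y))"
      by (rule square_integral_triangle) auto
    also have "\<dots> < \<infinity>" using hfin[of 0] le_less_trans[OF g[of 0]] by (simp add: ennreal_mult_less_top)
    finally show ?thesis by simp
  qed
  have "has_fourier_L2 f g"
    unfolding has_fourier_L2_def
  proof (intro conjI exI[of _ s] allI)
    show "g \<in> L2"
      using gfin by (subst L2_iff) (auto simp: L2_sqnorm_lborel borel_measurable_lebesgueI)
    show "s k \<in> L1 \<inter> L2" for k
    proof
      show "s k \<in> L1" using sint[of k] by (simp add: L1_def integrable_completion)
      show "s k \<in> L2" using sfin[of k] by (subst L2_iff) (auto simp: L2_sqnorm_lborel borel_measurable_lebesgueI)
    qed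
    show "L2_tendsto s f sequentially"
      unfolding L2_tendsto_def
    proof (rule tendsto_sandwich[OF _ _ tendsto_const lim])
      have "L2_sqnorm (\<lambda>x. s j x - f x) \<le> ennreal ((1/4) ^ j)" for j
      proof -
        have "L2_sqnorm (\<lambda>x. s j x - f x) = L2_sqnorm (\<lambda>x. s j x - f' x)"
          by (rule L2_sqnorm_cong_AE) (use f'(2) in \<open>eventually_elim, simp\<close>)
        also have "\<dots> \<le> ennreal ((1/4) ^ j / 4)" unfolding L2_sqnorm_lborel by (rule sf)
        also have "\<dots> \<le> ennreal ((1/4) ^ j)" by (intro ennreal_leI) simp
        finally show ?thesis .
      qed
      then show "\<forall>\<^sub>F j in sequentially. L2_sqnorm (\<lambda>x. s j x - f x) \<le> ennreal ((1/4) ^ j)" by simp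
    qed simp
    show "L2_tendsto (\<lambda>k. fourier_integral (s k)) g sequentially"
      unfolding L2_tendsto_def
    proof (rule tendsto_sandwich[OF _ _ tendsto_const lim])
      have "fourier_integral (s j) = h j" for j
        unfolding h_def N_def by (rule ext, rule fourier_integral_eq_ft) auto
      then have "L2_sqnorm (\<lambda>x. fourier_integral (s j) x - g x) \<le> ennreal ((1/4) ^ j)" for j
        using g[of j] by (simp add: L2_sqnorm_lborel)
      then show "\<forall>\<^sub>F j in sequentially. L2_sqnorm (\<lambda>x. fourier_integral (s j) x - g x)
          \<le> ennreal ((1/4) ^ j)" by simp
    qed simp
  qed (rule f)
  then show ?thesis by (rule exI[of _ g])
qed

lemma has_fourier_L2_fourier_L2:
  fixes f :: "real^'n \<Rightarrow> complex"
  shows "f \<in> L2 \<Longrightarrow> has_fourier_L2 f (fourier_L2 f)"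
  unfolding fourier_L2_def by (rule someI_ex[OF has_fourier_L2_ex])

section \<open>Analyticity of transforms with exponential moments\<close>

lemma norm_exp_partial_sum_le:
  fixes z :: complex
  shows "norm (\<Sum>n<N. z ^ n / fact n) \<le> exp (norm z)"
proof -
  have s: "summable (\<lambda>n. norm z ^ n / fact n)"
    using summable_exp_generic[of "norm z"] by (simp add: divide_inverse mult.commute)
  have "norm (\<Sum>n<N. z ^ n / fact n) \<le> (\<Sum>n<N. norm z ^ n / fact n)"
    by (rule sum_norm_le) (simp add: norm_divide norm_power)
  also have "\<dots> \<le> (\<Sum>n. norm z ^ n / fact n)"
    by (rule sum_le_suminf[OF s]) auto
  also have "\<dots> = exp (norm z)"
    by (simp add: exp_def divide_inverse mult.commute)
  finally show ?thesis .
qed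

lemma power_fact_le_exp:
  fixes x :: real assumes "x \<ge> 0" shows "x ^ n / fact n \<le> exp x"
proof -
  have s: "summable (\<lambda>n. x ^ n / fact n)"
    using summable_exp_generic[of x] by (simp add: divide_inverse mult.commute)
  have "(\<Sum>k\<in>{n}. x ^ k / fact k) \<le> (\<Sum>n. x ^ n / fact n)"
    by (rule sum_le_suminf[OF s]) (use assms in auto)
  also have "\<dots> = exp x" by (simp add: exp_def divide_inverse mult.commute)
  finally show ?thesis by simp
qed

text \<open>
The exponential series may be integrated termwise because its partial sums are dominated by
\<open>|f| exp (\<rho> |\<kappa>|)\<close>.
\<close>
lemma exp_integral_power_series:
  fixes f \<kappa> :: "'a \<Rightarrow> complex"
  assumes [measurable]: "f \<in> borel_measurable M" "\<kappa> \<in> borel_measurable M"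
    and int: "integrable M (\<lambda>x. norm (f x) * exp (\<rho> * norm (\<kappa> x)))" and \<rho>: "\<rho> > 0"
    and t: "norm t < \<rho>"
  shows "(\<lambda>n. (LINT x|M. f x * \<kappa> x ^ n / fact n) * t ^ n) sums (LINT x|M. f x * exp (t * \<kappa> x))"
proof -
  have i: "integrable M (\<lambda>x. f x * \<kappa> x ^ n / fact n)" for n
  proof (rule Bochner_Integration.integrable_bound)
    show "integrable M (\<lambda>x. (1 / \<rho> ^ n) * (norm (f x) * exp (\<rho> * norm (\<kappa> x))))"
      using int by simp
    have "norm (f x * \<kappa> x ^ n / fact n)
        \<le> (1 / \<rho> ^ n) * (norm (f x) * exp (\<rho> * norm (\<kappa> x)))" for x
    proof -
      have "norm (\<kappa> x) ^ n / fact n \<le> exp (\<rho> * norm (\<kappa> x)) / \<rho> ^ n"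
        using power_fact_le_exp[of "\<rho> * norm (\<kappa> x)" n] \<rho> by (simp add: power_mult_distrib field_simps)
      from mult_left_mono[OF this norm_ge_zero[of "f x"]] show ?thesis
        by (simp add: norm_mult norm_divide norm_power)
    qed
    then show "AE x in M. norm (f x * \<kappa> x ^ n / fact n)
        \<le> norm ((1 / \<rho> ^ n) * (norm (f x) * exp (\<rho> * norm (\<kappa> x))))"
      using \<rho> by (intro AE_I2) (simp only: real_norm_def, rule order_trans[OF _ abs_ge_self])
  qed simp
  have "(\<lambda>N. LINT x|M. (\<Sum>n<N. f x * (t * \<kappa> x) ^ n / fact n))
      \<longlonglongrightarrow> (LINT x|M. f x * exp (t * \<kappa> x))"
  proof (rule integral_dominated_convergence[OF _ _ int])
    have "(\<lambda>n. (t * \<kappa> x) ^ n / fact n) sums exp (t * \<kappa> x)" for x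
      using exp_converges[of "t * \<kappa> x"] by (simp add: scaleR_conv_of_real divide_inverse mult.commute)
    then have "(\<lambda>n. f x * (t * \<kappa> x) ^ n / fact n) sums (f x * exp (t * \<kappa> x))" for x
      using sums_mult[of _ _ "f x"] by fastforce
    then show "AE x in M. (\<lambda>N. \<Sum>n<N. f x * (t * \<kappa> x) ^ n / fact n)
        \<longlonglongrightarrow> f x * exp (t * \<kappa> x)"
      by (simp add: sums_def)
    fix N
    have "norm (\<Sum>n<N. f x * (t * \<kappa> x) ^ n / fact n) \<le> norm (f x) * exp (\<rho> * norm (\<kappa> x))" for x
    proof -
      have "norm (\<Sum>n<N. f x * (t * \<kappa> x) ^ n / fact n)
          = norm (f x) * norm (\<Sum>n<N. (t * \<kappa> x) ^ n / fact n)"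
        by (simp only: norm_mult[symmetric] sum_distrib_left times_divide_eq_right)
      also have "\<dots> \<le> norm (f x) * exp (norm (t * \<kappa> x))"
        by (intro mult_left_mono norm_exp_partial_sum_le) simp
      also have "\<dots> \<le> norm (f x) * exp (\<rho> * norm (\<kappa> x))"
        using t by (intro mult_left_mono) (auto simp: norm_mult mult_right_mono)
      finally show ?thesis .
    qed
    then show "AE x in M. norm (\<Sum>n<N. f x * (t * \<kappa> x) ^ n / fact n)
        \<le> norm (f x) * exp (\<rho> * norm (\<kappa> x))" by simp
  qed measurable
  moreover have "(LINT x|M. (\<Sum>n<N. f x * (t * \<kappa> x) ^ n / fact n))
      = (\<Sum>n<N. (LINT x|M. f x * \<kappa> x ^ n / fact n) * t ^ n)" for N
  proof -
    have e: "f x * (t * \<kappa> x) ^ n / fact n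
        = f x * \<kappa> x ^ n / fact n * t ^ n" for x n by (simp add: power_mult_distrib)
    show ?thesis unfolding e
      by (subst Bochner_Integration.integral_sum)
         (intro integrable_mult_left i, simp)
  qed
  ultimately show ?thesis by (simp add: sums_def)
qed

lemma exp_integral_holomorphic:
  fixes f \<kappa> :: "'a \<Rightarrow> complex"
  assumes "f \<in> borel_measurable M" "\<kappa> \<in> borel_measurable M"
    and "integrable M (\<lambda>x. norm (f x) * exp (\<rho> * norm (\<kappa> x)))" and "\<rho> > 0"
  shows "(\<lambda>t. LINT x|M. f x * exp (t * \<kappa> x)) holomorphic_on ball 0 \<rho>"
proof (rule power_series_holomorphic)
  fix w :: complex assume "w \<in> ball 0 \<rho>"
  then show "(\<lambda>n. (LINT x|M. f x * \<kappa> x ^ n / fact n)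
      * (w - 0) ^ n) sums (LINT x|M. f x * exp (w * \<kappa> x))"
    using exp_integral_power_series[OF assms, of w] by simp
qed

lemma exp_integral_has_derivative:
  fixes f \<kappa> :: "'a \<Rightarrow> complex"
  assumes "f \<in> borel_measurable M" "\<kappa> \<in> borel_measurable M"
    and "integrable M (\<lambda>x. norm (f x) * exp (\<rho> * norm (\<kappa> x)))" and \<rho>: "\<rho> > 0"
  shows "((\<lambda>t. LINT x|M. f x * exp (t * \<kappa> x)) has_field_derivative (LINT x|M. f x * \<kappa> x)) (at 0)"
proof -
  define c where "c n = (LINT x|M. f x * \<kappa> x ^ n / fact n)" for n
  have sums: "(\<lambda>n. c n * t ^ n) sums (LINT x|M. f x * exp (t * \<kappa> x))" if "t \<in> ball 0 \<rho>" for t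
    unfolding c_def using exp_integral_power_series[OF assms, of t] that by simp
  have "summable (\<lambda>n. c n * of_real (\<rho> / 2) ^ n)"
    using sums[of "of_real (\<rho> / 2)"] \<rho> by (auto simp: sums_iff)
  then have "((\<lambda>t. \<Sum>n. c n * t ^ n) has_field_derivative (\<Sum>n. diffs c n * 0 ^ n)) (at 0)"
    by (rule termdiffs_strong) (use \<rho> in simp)
  also have "(\<Sum>n. diffs c n * 0 ^ n) = (LINT x|M. f x * \<kappa> x)"
    by (subst powser_zero) (simp add: diffs_def c_def)
  finally show ?thesis
    by (rule has_field_derivative_transform_within_open[where S="ball 0 \<rho>"])
       (use \<rho> sums in \<open>auto simp: sums_iff\<close>)
qed

text \<open>
Along the line from \<open>y0\<close> to \<open>y\<close> the transform extends holomorphically to a strip: about each real point the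
extension is an exponential integral of \<open>f\<close> times a function of modulus one, so the radius of convergence is the
same at all of them. Zeros near the parameter \<open>0\<close> then propagate to the parameter \<open>1\<close>.
\<close>
lemma ft_analytic_identity:
  fixes f :: "'a::euclidean_space \<Rightarrow> complex"
  assumes fm [measurable]: "f \<in> borel_measurable borel"
    and int: "integrable lborel (\<lambda>x. norm (f x) * exp (\<delta> * norm x))" and \<delta>: "\<delta> > 0"
    and r: "r > 0" and zero: "\<And>z. z \<in> ball y0 r \<Longrightarrow> ft f z = 0"
  shows "ft f y = 0"
proof -
  define v where "v = y - y0"
  define \<rho> where "\<rho> = \<delta> / (norm v + 1)"
  have nv: "norm v + 1 > 0" by (simp add: add_nonneg_pos)
  have \<rho>: "\<rho> > 0" using \<delta> nv by (simp add: \<rho>_def)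
  have \<rho>v: "\<rho> * \<bar>x \<bullet> v\<bar> \<le> \<delta> * norm x" for x
  proof -
    have "\<rho> * \<bar>x \<bullet> v\<bar> \<le> \<rho> * (norm x * norm v)"
      using \<rho> Cauchy_Schwarz_ineq2[of x v] by (intro mult_left_mono) auto
    also have "\<dots> = \<delta> * norm x * (norm v / (norm v + 1))" by (simp add: \<rho>_def)
    also have "\<dots> \<le> \<delta> * norm x * 1" using \<delta> nv by (intro mult_left_mono) (auto simp: divide_le_eq)
    finally show ?thesis by simp
  qed
  define \<phi> where "\<phi> t = (LINT x|lborel. f x
      * cis (x \<bullet> y0) * exp (t * (\<i> * of_real (x \<bullet> v))))" for t
  define S where "S = {t::complex. \<bar>Im t\<bar> < \<rho>}"
  have S: "S = {t. Im t < \<rho>} \<inter> {t. Im t > - \<rho>}" by (auto simp: S_def)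
  have "open S" unfolding S by (intro open_Int open_halfspace_Im_lt open_halfspace_Im_gt)
  have "convex S" unfolding S by (intro convex_Int convex_halfspace_Im_lt convex_halfspace_Im_gt)
  have real: "\<phi> (of_real s) = ft f (y0 + s *\<^sub>R v)" for s
  proof -
    have "exp (of_real s * (\<i> * of_real (x \<bullet> v))) = cis (s * (x \<bullet> v))" for x
      by (simp add: cis_conv_exp mult_ac)
    then show ?thesis unfolding \<phi>_def ft_def by (simp add: inner_add_right mult.assoc cis_mult)
  qed
  have hol0: "(\<lambda>t. \<phi> (of_real s + t)) holomorphic_on ball 0 \<rho>" for s
  proof -
    have "(\<lambda>t. LINT x|lborel. (f x * cis (x \<bullet> y0) * cis (s * (x \<bullet> v)))
        * exp (t * (\<i> * of_real (x \<bullet> v)))) holomorphic_on ball 0 \<rho>"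
    proof (rule exp_integral_holomorphic[OF _ _ _ \<rho>])
      show "integrable lborel (\<lambda>x. norm (f x * cis (x \<bullet> y0) * cis (s * (x \<bullet> v)))
          * exp (\<rho> * norm (\<i> * complex_of_real (x \<bullet> v))))"
        by (rule Bochner_Integration.integrable_bound[OF int])
           (auto simp: norm_mult \<rho>v intro!: mult_left_mono)
    qed measurable
    also have "(\<lambda>t. LINT x|lborel. (f x * cis (x \<bullet> y0) * cis (s * (x \<bullet> v)))
        * exp (t * (\<i> * of_real (x \<bullet> v)))) = (\<lambda>t. \<phi> (of_real s + t))"
    proof -
      have "f x * cis (x \<bullet> y0) * cis (s * (x \<bullet> v)) * exp (t * (\<i> * of_real (x \<bullet> v))) =
          f x * cis (x \<bullet> y0) * exp ((of_real s + t) * (\<i> * of_real (x \<bullet> v)))" for x t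
        unfolding distrib_right exp_add by (simp add: cis_conv_exp mult_ac)
      then show ?thesis unfolding \<phi>_def by (simp only:)
    qed
    finally show ?thesis .
  qed
  have "\<phi> holomorphic_on S"
  proof (subst holomorphic_on_open[OF \<open>open S\<close>], intro ballI)
    fix t assume t: "t \<in> S"
    have "t - of_real (Re t) \<in> ball 0 \<rho>"
    proof -
      have "t - of_real (Re t) = \<i> * of_real (Im t)" by (simp add: complex_eq_iff)
      then show ?thesis using t by (simp add: S_def norm_mult)
    qed
    then have "(\<lambda>u. \<phi> (of_real (Re t) + u)) field_differentiable at (t - of_real (Re t))"
      using hol0[of "Re t"] by (auto simp: holomorphic_on_open field_differentiable_def)
    then obtain D where "((\<lambda>u. \<phi> (of_real (Re t) + u)) has_field_derivative D) (at (t - of_real (Re t)))"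
      by (auto simp: field_differentiable_def)
    then have "(\<phi> has_field_derivative D) (at t)"
      using DERIV_shift[of \<phi> D "t - of_real (Re t)" "of_real (Re t)"] by (simp add: add.commute)
    then show "\<exists>D. (\<phi> has_field_derivative D) (at t)" by blast
  qed
  define U where "U = complex_of_real ` {s. \<bar>s\<bar> * norm v < r}"
  have "\<phi> 1 = 0"
  proof (rule analytic_continuation[OF \<open>\<phi> holomorphic_on S\<close> \<open>open S\<close> convex_connected[OF \<open>convex S\<close>], where U=U and \<xi>=0])
    show "U \<subseteq> S" using \<rho> by (auto simp: U_def S_def)
    show "0 islimpt U"
    proof (subst islimpt_approachable, intro allI impI)
      fix e :: real assume e: "e > 0"
      define q where "q = r / (norm v + 1)"
      have q: "q > 0" using r nv by (simp add: q_def)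
      define s where "s = min (e / 2) (q / 2)"
      have s: "s > 0" "s < e" "s < q" using e q by (auto simp: s_def)
      then have "s < r / (norm v + 1)" by (simp add: q_def)
      then have "s * (norm v + 1) < r" using nv by (simp add: pos_less_divide_eq)
      then have "s * norm v < r" using s by (simp add: distrib_left)
      then show "\<exists>x'\<in>U. x' \<noteq> 0 \<and> dist x' 0 < e"
        using s by (intro bexI[of _ "of_real s"]) (auto simp: U_def)
    qed
    show "\<phi> z = 0" if "z \<in> U" for z
    proof -
      obtain s where s: "z = of_real s" "\<bar>s\<bar> * norm v < r" using \<open>z \<in> U\<close> by (auto simp: U_def)
      show ?thesis unfolding s(1) real by (rule zero) (use s in \<open>simp add: dist_norm\<close>)
    qed
  qed (use \<rho> in \<open>auto simp: S_def\<close>)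
  then show ?thesis using real[of 1] by (simp add: v_def)
qed

section \<open>Exponential moments from the coupled integral\<close>

text \<open>
Some coordinate carries at least the fraction \<open>1 / n\<close> of the norm, so the radial weight is dominated by the sum of
the weights in the coordinate directions.
\<close>
lemma exp_weight_finite_of_directions:
  fixes f :: "'a::euclidean_space \<Rightarrow> complex"
  assumes [measurable]: "f \<in> borel_measurable borel" and R: "R \<ge> 0"
    and fin: "\<And>i. i \<in> Basis \<Longrightarrow> (\<integral>\<^sup>+x. ennreal (norm (f x)
        * exp (\<bar>x \<bullet> (R *\<^sub>R i)\<bar>)) \<partial>lborel) < \<infinity>"
  shows "integrable lborel (\<lambda>x. norm (f x) * exp (R / DIM('a) * norm x))"
proof -
  have le: "norm (f x) * exp (R / DIM('a) * norm x)
      \<le> (\<Sum>i\<in>Basis. norm (f x) * exp (\<bar>x \<bullet> (R *\<^sub>R i)\<bar>))" for x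
  proof -
    have "\<exists>i\<in>Basis. norm x \<le> DIM('a) * \<bar>x \<bullet> i\<bar>"
    proof (rule ccontr)
      assume "\<not> ?thesis"
      then have "\<And>i. i \<in> Basis
          \<Longrightarrow> \<bar>x \<bullet> i\<bar> < norm x / DIM('a)" by (auto simp: not_le field_simps)
      then have "(\<Sum>i\<in>Basis. \<bar>x \<bullet> i\<bar>) < (\<Sum>i\<in>(Basis::'a set). norm x / DIM('a))"
        by (intro sum_strict_mono) auto
      with norm_le_l1[of x] show False by simp
    qed
    then obtain i where i: "i \<in> Basis" "norm x \<le> DIM('a) * \<bar>x \<bullet> i\<bar>" by blast
    have "R / DIM('a) * norm x \<le> \<bar>x \<bullet> (R *\<^sub>R i)\<bar>"
      using mult_left_mono[OF i(2) R] R by (simp add: field_simps abs_mult)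
    then have "norm (f x) * exp (R / DIM('a) * norm x) \<le> norm (f x) * exp (\<bar>x \<bullet> (R *\<^sub>R i)\<bar>)"
      by (intro mult_left_mono) auto
    also have "\<dots> \<le> (\<Sum>i\<in>Basis. norm (f x) * exp (\<bar>x \<bullet> (R *\<^sub>R i)\<bar>))"
      by (rule member_le_sum[OF i(1)]) auto
    finally show ?thesis .
  qed
  have "integrable lborel (\<lambda>x. \<Sum>i\<in>Basis. norm (f x) * exp (\<bar>x \<bullet> (R *\<^sub>R i)\<bar>))"
    using fin by (intro Bochner_Integration.integrable_sum) (auto simp: integrable_iff_bounded)
  then show ?thesis
  proof (rule Bochner_Integration.integrable_bound)
    show "AE x in lborel. norm (norm (f x) * exp (R / DIM('a) * norm x))
        \<le> norm (\<Sum>i\<in>Basis. norm (f x) * exp (\<bar>x \<bullet> (R *\<^sub>R i)\<bar>))"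
      using le by (intro AE_I2) (simp add: sum_nonneg)
  qed simp
qed

text \<open>
The set \<open>Y\<close> of all \<open>y\<close> for which \<open>|f x| exp (a |x \<bullet> y|)\<close> is integrable in \<open>x\<close> is convex and symmetric,
and it is not null, because it contains almost all points where \<open>g\<close> is nonzero. So it contains a ball about \<open>0\<close>,
and analyticity of the transform enlarges this ball to the whole space.

The constants \<open>k\<close> and \<open>\<sigma>\<close> let the lemma apply both to the transform and to its inverse. The relation between
\<open>f\<close> and \<open>g\<close> is assumed only for integrable \<open>f\<close>, because integrability is itself a consequence of the coupling.
\<close>
lemma exp_integrable_of_fourier_coupling:
  fixes f g :: "'a::euclidean_space \<Rightarrow> complex"
  assumes [measurable]: "f \<in> borel_measurable borel" "g \<in> borel_measurable borel"
    and fin: "(\<integral>\<^sup>+x. (\<integral>\<^sup>+y. ennreal (norm (f x) * norm (g y)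
        * exp (a * \<bar>x \<bullet> y\<bar>)) \<partial>lborel) \<partial>lborel) < \<infinity>"
    and a: "a > 0"
    and g: "integrable lborel f \<Longrightarrow> AE y in lborel. g y = k * ft f (\<sigma> *\<^sub>R y)" and \<sigma>: "\<sigma> = 1 \<or> \<sigma> = -1"
    and nz: "\<not> (AE y in lborel. g y = 0)"
  shows "integrable lborel (\<lambda>x. norm (f x) * exp (R * norm x))"
proof -
  define I where "I y = (\<integral>\<^sup>+x. ennreal (norm (f x)
      * exp (a * \<bar>x \<bullet> y\<bar>)) \<partial>lborel)" for y
  define Y where "Y = {y. I y < \<infinity>}"
  have "(\<integral>\<^sup>+y. (\<integral>\<^sup>+x. ennreal (norm (f x) * norm (g y)
      * exp (a * \<bar>x \<bullet> y\<bar>)) \<partial>lborel) \<partial>lborel) < \<infinity>"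
    using fin by (subst lborel_pair.Fubini') simp_all
  then have "AE y in lborel. (\<integral>\<^sup>+x. ennreal (norm (f x) * norm (g y)
      * exp (a * \<bar>x \<bullet> y\<bar>)) \<partial>lborel) \<noteq> \<infinity>"
    by (intro nn_integral_PInf_AE) auto
  then have gY: "AE y in lborel. g y \<noteq> 0 \<longrightarrow> y \<in> Y"
  proof eventually_elim
    case (elim y)
    have "(\<integral>\<^sup>+x. ennreal (norm (f x) * norm (g y) * exp (a * \<bar>x \<bullet> y\<bar>)) \<partial>lborel)
        = ennreal (norm (g y)) * I y"
      unfolding I_def by (subst nn_integral_cmult[symmetric]) (auto simp: ennreal_mult[symmetric] mult_ac)
    with elim show ?case by (auto simp: Y_def ennreal_mult_eq_top_iff less_top)
  qed
  have uminus: "- y \<in> Y" if "y \<in> Y" for y using that by (simp add: Y_def I_def)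
  have "convex Y"
  proof (rule convexI)
    fix y z :: 'a and u v :: real assume yz: "y \<in> Y" "z \<in> Y" and uv: "0 \<le> u" "0 \<le> v" "u + v = 1"
    have "I (u *\<^sub>R y + v *\<^sub>R z)
        \<le> (\<integral>\<^sup>+x. ennreal (norm (f x) * exp (a * \<bar>x \<bullet> y\<bar>)) + ennreal (norm (f x) * exp (a * \<bar>x \<bullet> z\<bar>)) \<partial>lborel)"
      unfolding I_def
    proof (intro nn_integral_mono)
      fix x
      define m where "m = max \<bar>x \<bullet> y\<bar> \<bar>x \<bullet> z\<bar>"
      have "\<bar>x \<bullet> (u *\<^sub>R y + v *\<^sub>R z)\<bar>
          \<le> u * \<bar>x \<bullet> y\<bar> + v * \<bar>x \<bullet> z\<bar>"
        using uv abs_triangle_ineq[of "u * (x \<bullet> y)" "v * (x \<bullet> z)"] by (simp add: inner_add_right abs_mult)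
      also have "\<dots> \<le> u * m + v * m" using uv by (intro add_mono mult_left_mono) (auto simp: m_def)
      also have "\<dots> = m" using uv by (simp flip: distrib_right)
      finally have "exp (a * \<bar>x \<bullet> (u *\<^sub>R y + v *\<^sub>R z)\<bar>) \<le> exp (a * m)" using a by simp
      also have "\<dots> \<le> exp (a * \<bar>x \<bullet> y\<bar>)
          + exp (a * \<bar>x \<bullet> z\<bar>)" by (auto simp: m_def max_def)
      finally have "norm (f x) * exp (a * \<bar>x \<bullet> (u *\<^sub>R y + v *\<^sub>R z)\<bar>)
          \<le> norm (f x) * exp (a * \<bar>x \<bullet> y\<bar>) + norm (f x) * exp (a * \<bar>x \<bullet> z\<bar>)"
        by (simp add: distrib_left[symmetric] mult_left_mono)
      then show "ennreal (norm (f x) * exp (a * \<bar>x \<bullet> (u *\<^sub>R y + v *\<^sub>R z)\<bar>))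
          \<le> ennreal (norm (f x) * exp (a * \<bar>x \<bullet> y\<bar>)) + ennreal (norm (f x) * exp (a * \<bar>x \<bullet> z\<bar>))"
        by (rule order_trans[OF ennreal_leI]) simp
    qed
    also have "\<dots> = I y + I z" unfolding I_def by (rule nn_integral_add) auto
    also have "\<dots> < \<infinity>" using yz by (simp add: Y_def)
    finally show "u *\<^sub>R y + v *\<^sub>R z \<in> Y" by (simp add: Y_def)
  qed
  have "\<not> negligible Y"
  proof
    assume "negligible Y"
    then have "AE y in lebesgue. y \<notin> Y" by (simp add: negligible_iff_null_sets AE_not_in)
    then have "AE y in lborel. y \<notin> Y" by (simp add: AE_completion_iff)
    with gY have "AE y in lborel. g y = 0" by eventually_elim auto
    with nz show False by simp
  qed
  then obtain y0 where "y0 \<in> interior Y" using negligible_convex_interior[OF \<open>convex Y\<close>] by blast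
  then obtain r where r: "r > 0" "ball y0 r \<subseteq> Y" by (auto simp: mem_interior)
  have mid: "(1/2) *\<^sub>R (y + z) \<in> Y" if "y \<in> Y" "z \<in> Y" for y z
    using convexD[OF \<open>convex Y\<close> that, of "1/2" "1/2"] by (simp add: scaleR_right_distrib)
  have ball0: "z \<in> Y" if "norm z < r" for z
  proof -
    have "y0 + z \<in> Y" "y0 - z \<in> Y" using that r by (auto simp: subset_iff dist_norm)
    then have "y0 + z \<in> Y" "- (y0 - z) \<in> Y" by (auto intro: uminus simp del: minus_diff_eq)
    from mid[OF this] show ?thesis by (simp add: scaleR_2[symmetric])
  qed
  have dirs: "integrable lborel (\<lambda>x. norm (f x) * exp (a * R' / DIM('a) * norm x))"
    if R': "R' \<ge> 0" and Y: "\<And>i. i \<in> Basis \<Longrightarrow> R' *\<^sub>R i \<in> Y" for R'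
  proof (rule exp_weight_finite_of_directions)
    fix i :: 'a assume "i \<in> Basis"
    then show "(\<integral>\<^sup>+x. ennreal (norm (f x)
        * exp (\<bar>x \<bullet> ((a * R') *\<^sub>R i)\<bar>)) \<partial>lborel) < \<infinity>"
      using Y[of i] a R' by (simp add: Y_def I_def abs_mult mult.assoc)
  qed (use a R' in auto)
  define \<delta> where "\<delta> = a * (r / 2) / DIM('a)"
  have \<delta>: "\<delta> > 0" using a r by (simp add: \<delta>_def)
  have i\<delta>: "integrable lborel (\<lambda>x. norm (f x) * exp (\<delta> * norm x))"
    unfolding \<delta>_def by (rule dirs) (use r in \<open>auto intro!: ball0\<close>)
  have fi: "integrable lborel f"
  proof (rule Bochner_Integration.integrable_bound[OF i\<delta>])
    have "norm (f x) * 1 \<le> norm (f x) * exp (\<delta> * norm x)" for x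
      using \<delta> by (intro mult_left_mono) auto
    then show "AE x in lborel. norm (f x) \<le> norm (norm (f x) * exp (\<delta> * norm x))" by simp
  qed simp
  note gae = g[OF fi]
  (* If p is not in Y, then neither is any y near 2 p: its reflection 2 p - y lies in
     the ball about 0, and p is the midpoint of the two. *)
  have "p \<in> Y" for p
  proof (rule ccontr)
    assume p: "p \<notin> Y"
    have notY: "y \<notin> Y" if "y \<in> ball (2 *\<^sub>R p) r" for y
    proof
      assume "y \<in> Y"
      moreover have "2 *\<^sub>R p - y \<in> Y" using that by (intro ball0) (simp add: dist_norm)
      ultimately have "(1/2) *\<^sub>R (y + (2 *\<^sub>R p - y)) \<in> Y" by (rule mid)
      with p show False by simp
    qed
    have k: "k \<noteq> 0"
    proof
      assume "k = 0"
      with gae nz show False by simp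
    qed
    define V where "V = ball (2 *\<^sub>R p) r \<inter> {y. ft f (\<sigma> *\<^sub>R y) \<noteq> 0}"
    have "open V"
    proof -
      have "continuous_on UNIV (\<lambda>y. ft f (\<sigma> *\<^sub>R y))"
        by (intro continuous_on_compose2[OF continuous_on_ft[OF fi]] continuous_intros) auto
      then have "open {y. ft f (\<sigma> *\<^sub>R y) \<noteq> 0}" by (intro open_Collect_neq continuous_intros)
      then show ?thesis unfolding V_def by (intro open_Int) auto
    qed
    moreover have "negligible V"
    proof -
      have "AE y in lborel. y \<notin> V"
        using gae gY by eventually_elim (use notY k in \<open>auto simp: V_def\<close>)
      moreover have "V \<in> sets borel" using \<open>open V\<close> by simp
      ultimately have "V \<in> null_sets lborel" by (subst AE_iff_null_sets) auto
      then show ?thesis by (simp add: negligible_iff_null_sets null_sets_completionI)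
    qed
    ultimately have "V = {}" using open_not_negligible by blast
    then have z0: "ft f z = 0" if "z \<in> ball (\<sigma> *\<^sub>R (2 *\<^sub>R p)) r" for z
    proof -
      have "\<sigma> *\<^sub>R z \<in> ball (2 *\<^sub>R p) r" "\<sigma> *\<^sub>R (\<sigma> *\<^sub>R z) = z"
        using that \<sigma> by (auto simp: dist_norm norm_minus_commute)
           (metis add.commute norm_minus_cancel minus_add_distrib diff_conv_add_uminus minus_minus)
      then show ?thesis using \<open>V = {}\<close> unfolding V_def by (metis (mono_tags, lifting) Int_iff empty_iff mem_Collect_eq)
    qed
    have "ft f y = 0" for y by (rule ft_analytic_identity[OF assms(1) i\<delta> \<delta> r(1) z0])
    with gae nz show False by simp
  qed
  note all = this
  show ?thesis
  proof (rule Bochner_Integration.integrable_bound)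
    show "integrable lborel (\<lambda>x. norm (f x) * exp (a * (\<bar>R\<bar> * DIM('a) / a) / DIM('a) * norm x))"
      by (rule dirs) (use a all in auto)
    have "norm (f x) * exp (R * norm x) \<le> norm (f x) * exp (\<bar>R\<bar> * norm x)" for x
      by (intro mult_left_mono) (auto intro: mult_right_mono)
    then show "AE x in lborel. norm (norm (f x) * exp (R * norm x))
        \<le> norm (norm (f x) * exp (a * (\<bar>R\<bar> * DIM('a) / a) / DIM('a) * norm x))"
      using a by simp
  qed simp
qed

section \<open>Decay of the entire extension in tubes\<close>

lemma norm_integral_le_integral:
  fixes f :: "'a \<Rightarrow> 'b::{banach, second_countable_topology}"
  assumes h: "integrable M h" and le: "\<And>x. norm (f x) \<le> h x"
  shows "norm (integral\<^sup>L M f) \<le> integral\<^sup>L M h"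
proof (cases "integrable M f")
  case True
  have "norm (integral\<^sup>L M f) \<le> (LINT x|M. norm (f x))" by (rule integral_norm_bound)
  also have "\<dots> \<le> integral\<^sup>L M h" using True h le by (intro integral_mono) auto
  finally show ?thesis .
next
  case False
  have "0 \<le> h x" for x using le[of x] norm_ge_zero order_trans by blast
  then show ?thesis using False by (simp add: not_integrable_integral_eq integral_nonneg)
qed

text \<open>
The transform of \<open>tilt v g\<close> at \<open>\<xi>\<close> is the value at \<open>\<xi> + \<i> v\<close> of the entire extension of the transform of \<open>g\<close>.
\<close>
definition tilt :: "'a::euclidean_space \<Rightarrow> ('a \<Rightarrow> complex) \<Rightarrow> 'a \<Rightarrow> complex" where
  "tilt v g \<eta> = g \<eta> * of_real (exp (- (v \<bullet> \<eta>)))"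

definition exp_integrable :: "('a::euclidean_space \<Rightarrow> complex) \<Rightarrow> bool" where
  "exp_integrable g \<longleftrightarrow> g \<in> borel_measurable borel \<and> (\<forall>R. integrable lborel (\<lambda>x. norm (g x) * exp (R * norm x)))"

abbreviation exp_moment :: "real \<Rightarrow> ('a::euclidean_space \<Rightarrow> complex) \<Rightarrow> real" where
  "exp_moment R g \<equiv> LINT x|lborel. norm (g x) * exp (R * norm x)"

lemma exp_integrableD:
  assumes "exp_integrable g"
  shows "g \<in> borel_measurable borel" "integrable lborel (\<lambda>x. norm (g x) * exp (R * norm x))"
  using assms by (auto simp: exp_integrable_def)

lemma borel_measurable_tilt: "g \<in> borel_measurable borel \<Longrightarrow> tilt v g \<in> borel_measurable borel"
proof -
  assume [measurable]: "g \<in> borel_measurable borel"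
  have [measurable]: "(\<lambda>\<eta>. complex_of_real (exp (- (v \<bullet> \<eta>)))) \<in> borel_measurable borel"
    by (intro borel_measurable_continuous_onI continuous_intros)
  have "tilt v g = (\<lambda>\<eta>. g \<eta> * of_real (exp (- (v \<bullet> \<eta>))))" by (simp add: tilt_def fun_eq_iff)
  then show ?thesis by simp
qed

lemma norm_tilt_le: "norm v \<le> r \<Longrightarrow> norm (tilt v g \<eta>) \<le> norm (g \<eta>) * exp (r * norm \<eta>)"
proof -
  assume v: "norm v \<le> r"
  have "- (v \<bullet> \<eta>) \<le> norm v * norm \<eta>" using Cauchy_Schwarz_ineq2[of v \<eta>] by linarith
  also have "\<dots> \<le> r * norm \<eta>" using v by (intro mult_right_mono) auto
  finally show ?thesis unfolding tilt_def norm_mult by (intro mult_left_mono) auto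
qed

lemma integrable_tilt:
  assumes "exp_integrable g" shows "integrable lborel (tilt v g)"
proof (rule Bochner_Integration.integrable_bound[OF exp_integrableD(2)[OF assms, of "norm v"]])
  show "AE x in lborel. norm (tilt v g x) \<le> norm (norm (g x) * exp (norm v * norm x))"
    using norm_tilt_le[of v "norm v" g] by (intro AE_I2) simp
qed (use borel_measurable_tilt[OF exp_integrableD(1)[OF assms]] in simp)

lemma tilt_0: "tilt 0 g = g" by (simp add: tilt_def fun_eq_iff)

lemma norm_ft_tilt_le:
  assumes g: "exp_integrable g" and v: "norm v \<le> r"
  shows "norm (ft (tilt v g) \<xi>) \<le> (exp_moment r g)"
proof -
  have "norm (ft (tilt v g) \<xi>) \<le> (LINT x|lborel. norm (tilt v g x))"
    by (rule norm_ft_le[OF integrable_tilt[OF g]])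
  also have "\<dots> \<le> (exp_moment r g)"
    by (intro integral_mono integrable_norm integrable_tilt g exp_integrableD(2) norm_tilt_le v)
  finally show ?thesis .
qed

text \<open>
Let \<open>F\<close> be the entire extension of \<open>ft g\<close> and \<open>F* \<zeta> = cnj (F (cnj \<zeta>))\<close>. On the left is the integral of
\<open>F (\<xi> + \<i> v) F* (\<xi> - \<i> v) W \<xi>\<close>, on the right that of \<open>F \<xi> F* (\<xi> - 2 \<i> v) W (\<xi> - \<i> v)\<close>: the same entire
function on a contour moved by \<open>- \<i> v\<close>. Instead of moving contours in several variables, both sides are expanded
into double integrals against the transform of the Gaussian, where the equality holds pointwise.
\<close>
lemma gauss_contour_shift:
  fixes g :: "'a::euclidean_space \<Rightarrow> complex" and y v :: 'a
  assumes g: "exp_integrable g" and e: "e > 0"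
  defines "W \<equiv> \<lambda>\<xi>::'a. complex_of_real (exp ((2 *\<^sub>R y) \<bullet> \<xi> - e * (norm \<xi>)\<^sup>2))"
  defines "ph \<equiv> \<lambda>\<xi>. cis (2 * e * (v \<bullet> \<xi>) - 2 * (y \<bullet> v))"
  shows "(LINT \<xi>|lborel. ft (tilt v g) \<xi> * (cnj (ft (tilt v g) \<xi>) * W \<xi>)) =
     of_real (exp (e * (norm v)\<^sup>2)) * (LINT \<xi>|lborel. ft g \<xi> * (cnj (ft (tilt (2 *\<^sub>R v) g) \<xi>) * (W \<xi> * ph \<xi>)))"
proof -
  have gi: "integrable lborel g" using integrable_tilt[OF g, of 0] by (simp add: tilt_0)
  have W: "integrable lborel W"
    using integrable_gauss_cis[OF e, of "2 *\<^sub>R y" 0] by (simp add: W_def)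
  have Wph: "W \<xi> * ph \<xi> = cis (- 2 * (y \<bullet> v))
      * (W \<xi> * cis (\<xi> \<bullet> (2 * e) *\<^sub>R v))" for \<xi>
    unfolding ph_def by (simp add: cis_mult inner_commute mult_ac)
  have W2: "integrable lborel (\<lambda>\<xi>. W \<xi> * ph \<xi>)"
    unfolding Wph by (intro integrable_mult_right integrable_mult_cis W)
  have ftW: "ft W \<theta> = of_real (sqrt (pi / e) ^ DIM('a)
      * exp (((norm (2 *\<^sub>R y))\<^sup>2 - (norm \<theta>)\<^sup>2) / (4 * e))) * cis (((2 *\<^sub>R y) \<bullet> \<theta>) / (2 * e))" for \<theta>
    using has_bochner_integral_integral_eq[OF has_bochner_integral_gauss[OF e, of "2 *\<^sub>R y" \<theta>]]
    by (simp add: ft_def W_def inner_commute)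
  have ftW2: "ft (\<lambda>\<xi>. W \<xi> * ph \<xi>) \<theta>
      = of_real (exp (- e * (norm v)\<^sup>2) * exp (- (v \<bullet> \<theta>))) * ft W \<theta>" for \<theta>
  proof -
    have "ft (\<lambda>\<xi>. W \<xi> * ph \<xi>) \<theta>
        = cis (- 2 * (y \<bullet> v)) * ft (\<lambda>\<xi>. W \<xi> * cis (\<xi> \<bullet> (2 * e) *\<^sub>R v)) \<theta>"
      unfolding ft_def Wph by (subst integral_mult_right_zero[symmetric]) (simp add: mult_ac)
    also have "ft (\<lambda>\<xi>. W \<xi> * cis (\<xi> \<bullet> (2 * e) *\<^sub>R v)) \<theta>
        = ft W (\<theta> + (2 * e) *\<^sub>R v)"
      by (rule ft_mult_cis)
    also have "\<dots> = of_real (sqrt (pi / e) ^ DIM('a) * (exp (((norm (2 *\<^sub>R y))\<^sup>2 - (norm \<theta>)\<^sup>2) / (4 * e)) * (exp (- e * (norm v)\<^sup>2) * exp (- (v \<bullet> \<theta>)))))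
        * (cis (((2 *\<^sub>R y) \<bullet> \<theta>) / (2 * e)) * cis (2 * (y \<bullet> v)))"
    proof -
      have "(norm (\<theta> + (2 * e) *\<^sub>R v))\<^sup>2
          = (norm \<theta>)\<^sup>2 + 4 * e * (v \<bullet> \<theta>) + 4 * e\<^sup>2 * (norm v)\<^sup>2"
        unfolding power2_norm_eq_inner by (simp add: inner_add_left inner_add_right inner_commute power2_eq_square algebra_simps)
      then have 1: "((norm (2 *\<^sub>R y))\<^sup>2 - (norm (\<theta> + (2 * e) *\<^sub>R v))\<^sup>2) / (4 * e) =
          ((norm (2 *\<^sub>R y))\<^sup>2 - (norm \<theta>)\<^sup>2) / (4 * e) + (- e * (norm v)\<^sup>2 + - (v \<bullet> \<theta>))"
        using e by (simp add: field_simps power2_eq_square)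
      have 2: "((2 *\<^sub>R y) \<bullet> (\<theta> + (2 * e) *\<^sub>R v)) / (2 * e)
          = ((2 *\<^sub>R y) \<bullet> \<theta>) / (2 * e) + 2 * (y \<bullet> v)"
        using e by (simp add: inner_add_right field_simps)
      show ?thesis unfolding ftW 1 2 exp_add cis_mult ..
    qed
    finally show ?thesis unfolding ftW by (simp add: cis_mult mult_ac)
  qed
  define q where "q = (\<lambda>h::'a \<Rightarrow> complex. (\<lambda>x. cnj (h (- x))))"
  have qint: "integrable lborel (q h)" if "integrable lborel h" for h
    unfolding q_def using integrable_lborel_affine[OF that, of "-1" 0] by simp
  have expand: "(LINT \<xi>|lborel. ft h \<xi> * (cnj (ft k \<xi>) * w \<xi>))
      = (LINT x|lborel. (LINT u|lborel. h x * q k u * ft w (u + x)))"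
    if h: "integrable lborel h" and k: "integrable lborel k" and w: "integrable lborel w" for h k w :: "'a \<Rightarrow> complex"
  proof -
    have i: "integrable lborel (\<lambda>\<xi>. ft (q k) \<xi> * w \<xi>)"
      using integrable_mult_bounded[OF w borel_measurable_ft[OF qint[OF k]] norm_ft_le[OF qint[OF k]]]
      by (simp add: mult.commute)
    have "(LINT \<xi>|lborel. ft h \<xi> * (cnj (ft k \<xi>) * w \<xi>))
        = (LINT \<xi>|lborel. ft h \<xi> * (ft (q k) \<xi> * w \<xi>))"
      unfolding q_def cnj_ft_reflect[OF k] ..
    also have "\<dots> = (LINT x|lborel. h x * ft (\<lambda>\<xi>. ft (q k) \<xi> * w \<xi>) x)"
      by (rule ft_multiplication_formula[OF h i])
    also have "\<dots> = (LINT x|lborel. (LINT u|lborel. h x * q k u * ft w (u + x)))"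
      unfolding ft_mult_ft[OF qint[OF k] w] by (simp add: mult.assoc)
    finally show ?thesis .
  qed
  have pt: "tilt v g x * q (tilt v g) u * ft W (u + x) =
     of_real (exp (e * (norm v)\<^sup>2)) * (g x * q (tilt (2 *\<^sub>R v) g) u * ft (\<lambda>\<xi>. W \<xi> * ph \<xi>) (u + x))" for x u
  proof -
    have "exp (- (v \<bullet> x)) * exp (v \<bullet> u)
        = exp (e * (norm v)\<^sup>2) * exp (2 * (v \<bullet> u)) * (exp (- e * (norm v)\<^sup>2) * exp (- (v \<bullet> (u + x))))"
      unfolding exp_add[symmetric] by (simp add: inner_add_right)
    then have "complex_of_real (exp (- (v \<bullet> x))) * of_real (exp (v \<bullet> u))
        = of_real (exp (e * (norm v)\<^sup>2)) * of_real (exp (2 * (v \<bullet> u))) * of_real (exp (- e * (norm v)\<^sup>2) * exp (- (v \<bullet> (u + x))))"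
      by (simp only: of_real_mult[symmetric])
    then have "(g x * cnj (g (- u)) * ft W (u + x)) * (complex_of_real (exp (- (v \<bullet> x))) * of_real (exp (v \<bullet> u))) =
       (g x * cnj (g (- u)) * ft W (u + x)) * (of_real (exp (e * (norm v)\<^sup>2)) * of_real (exp (2 * (v \<bullet> u))) * of_real (exp (- e * (norm v)\<^sup>2) * exp (- (v \<bullet> (u + x)))))"
      by (simp only:)
    then show ?thesis unfolding ftW2 tilt_def q_def by (simp add: mult_ac)
  qed
  show ?thesis
    unfolding expand[OF integrable_tilt[OF g] integrable_tilt[OF g] W]
      expand[OF gi integrable_tilt[OF g] W2] pt integral_mult_right_zero ..
qed

text \<open>
After the contour shift one factor is \<open>ft g\<close> itself, which has all exponential moments, and the other is bounded.
Boundedness in tubes is all that is known of the extension at this point, and it suffices for an estimate that is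
uniform in the width of the Gaussian.
\<close>
lemma tilted_square_integral_le:
  fixes g :: "'a::euclidean_space \<Rightarrow> complex"
  assumes g: "exp_integrable g" and f: "exp_integrable (ft g)"
    and v: "2 * norm v \<le> r" and y: "2 * norm y \<le> t"
  shows "(\<integral>\<^sup>+\<xi>. ennreal ((norm (ft (tilt v g) \<xi>))\<^sup>2 * exp (2 * (y \<bullet> \<xi>))) \<partial>lborel) \<le>
    ennreal ((exp_moment r g) * (exp_moment t (ft g)))"
proof (rule nn_integral_le_of_gauss_damped)
  define B where "B = (exp_moment r g)"
  define A where "A = (exp_moment t (ft g))"
  have B: "B \<ge> 0" by (simp add: B_def)
  have gi: "integrable lborel g" using integrable_tilt[OF g, of 0] by (simp add: tilt_0)
  note [measurable] = borel_measurable_ft[OF gi] borel_measurable_ft[OF integrable_tilt[OF g]]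
  show "(\<lambda>\<xi>. (norm (ft (tilt v g) \<xi>))\<^sup>2
      * exp (2 * (y \<bullet> \<xi>))) \<in> borel_measurable borel" by measurable
  show "((\<lambda>e. exp (e * (norm v)\<^sup>2) * ((exp_moment r g) * (exp_moment t (ft g))))
     \<longlongrightarrow> (exp_moment r g) * (exp_moment t (ft g))) (at_right 0)"
    by (auto intro!: tendsto_eq_intros)
  fix e :: real assume e: "e > 0"
  define W where "W = (\<lambda>\<xi>::'a. complex_of_real (exp ((2 *\<^sub>R y) \<bullet> \<xi>
      - e * (norm \<xi>)\<^sup>2)))"
  define ph where "ph = (\<lambda>\<xi>. cis (2 * e * (v \<bullet> \<xi>) - 2 * (y \<bullet> v)))"
  have W: "integrable lborel W"
    using integrable_gauss_cis[OF e, of "2 *\<^sub>R y" 0] by (simp add: W_def)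
  have [measurable]: "W \<in> borel_measurable borel" using borel_measurable_integrable[OF W] by simp
  let ?h = "\<lambda>\<xi>. (norm (ft (tilt v g) \<xi>))\<^sup>2 * exp (2 * (y \<bullet> \<xi>))"
  have eq: "ft (tilt v g) \<xi> * (cnj (ft (tilt v g) \<xi>) * W \<xi>)
      = of_real (?h \<xi> * exp (- e * (norm \<xi>)\<^sup>2))" for \<xi>
  proof -
    have "exp ((2 *\<^sub>R y) \<bullet> \<xi> - e * (norm \<xi>)\<^sup>2)
        = exp (2 * (y \<bullet> \<xi>)) * exp (- e * (norm \<xi>)\<^sup>2)"
      by (simp add: exp_add[symmetric])
    then show ?thesis unfolding W_def by (simp only: of_real_mult complex_norm_square mult_ac)
  qed
  have il: "integrable lborel (\<lambda>\<xi>. ?h \<xi> * exp (- e * (norm \<xi>)\<^sup>2))"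
  proof -
    have "integrable lborel (\<lambda>\<xi>. W \<xi> * (ft (tilt v g) \<xi> * cnj (ft (tilt v g) \<xi>)))"
    proof (rule integrable_mult_bounded[OF W])
      show "norm (ft (tilt v g) \<xi> * cnj (ft (tilt v g) \<xi>))
          \<le> (LINT x|lborel. norm (tilt v g x)) * (LINT x|lborel. norm (tilt v g x))" for \<xi>
        unfolding norm_mult complex_mod_cnj by (intro mult_mono norm_ft_le integrable_tilt g) auto
      show "(\<lambda>\<xi>. ft (tilt v g) \<xi> * cnj (ft (tilt v g) \<xi>)) \<in> borel_measurable borel"
        by (intro borel_measurable_continuous_onI continuous_intros continuous_on_ft integrable_tilt g)
    qed
    then have "integrable lborel (\<lambda>\<xi>. ft (tilt v g) \<xi>
        * (cnj (ft (tilt v g) \<xi>) * W \<xi>))" by (simp add: mult_ac)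
    from integrable_norm[OF this] show ?thesis unfolding eq norm_of_real by simp
  qed
  have "(LINT \<xi>|lborel. ?h \<xi> * exp (- e * (norm \<xi>)\<^sup>2)) =
     norm (LINT \<xi>|lborel. ft (tilt v g) \<xi> * (cnj (ft (tilt v g) \<xi>) * W \<xi>))"
  proof -
    have "(LINT \<xi>|lborel. ft (tilt v g) \<xi> * (cnj (ft (tilt v g) \<xi>) * W \<xi>)) =
       of_real (LINT \<xi>|lborel. ?h \<xi> * exp (- e * (norm \<xi>)\<^sup>2))"
      unfolding eq using il by (rule integral_of_real)
    then show ?thesis by (simp only: norm_of_real) (simp add: integral_nonneg)
  qed
  also have "\<dots> = exp (e * (norm v)\<^sup>2)
      * norm (LINT \<xi>|lborel. ft g \<xi> * (cnj (ft (tilt (2 *\<^sub>R v) g) \<xi>) * (W \<xi> * ph \<xi>)))"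
    unfolding W_def ph_def gauss_contour_shift[OF g e] by (simp add: norm_mult)
  also have "\<dots> \<le> exp (e * (norm v)\<^sup>2) * (B * A)"
  proof (intro mult_left_mono)
    have bd: "norm (ft g \<xi> * (cnj (ft (tilt (2 *\<^sub>R v) g) \<xi>) * (W \<xi> * ph \<xi>)))
        \<le> B * (norm (ft g \<xi>) * exp (t * norm \<xi>))" for \<xi>
    proof -
      have 1: "norm (ft (tilt (2 *\<^sub>R v) g) \<xi>) \<le> B"
        unfolding B_def by (rule norm_ft_tilt_le[OF g]) (use v in simp)
      have "(2 *\<^sub>R y) \<bullet> \<xi> - e * (norm \<xi>)\<^sup>2 \<le> (2 *\<^sub>R y) \<bullet> \<xi>" using e by simp
      also have "\<dots> \<le> norm (2 *\<^sub>R y) * norm \<xi>" using Cauchy_Schwarz_ineq2[of "2 *\<^sub>R y" \<xi>] by linarith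
      also have "\<dots> \<le> t * norm \<xi>" using y by (intro mult_right_mono) auto
      finally have 2: "norm (W \<xi> * ph \<xi>) \<le> exp (t * norm \<xi>)" by (simp add: W_def ph_def norm_mult)
      have "norm (ft g \<xi> * (cnj (ft (tilt (2 *\<^sub>R v) g) \<xi>) * (W \<xi> * ph \<xi>)))
          \<le> norm (ft g \<xi>) * (B * exp (t * norm \<xi>))"
        unfolding norm_mult[of "ft g \<xi>"] norm_mult[of "cnj _"] complex_mod_cnj by (intro mult_left_mono mult_mono 1 2 B) auto
      then show ?thesis by (simp add: mult_ac)
    qed
    have "norm (LINT \<xi>|lborel. ft g \<xi> * (cnj (ft (tilt (2 *\<^sub>R v) g) \<xi>) * (W \<xi> * ph \<xi>))) \<le>
       (LINT \<xi>|lborel. B * (norm (ft g \<xi>) * exp (t * norm \<xi>)))"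
      by (intro norm_integral_le_integral integrable_mult_right exp_integrableD(2) f bd)
    then show "norm (LINT \<xi>|lborel. ft g \<xi> * (cnj (ft (tilt (2 *\<^sub>R v) g) \<xi>) * (W \<xi> * ph \<xi>)))
        \<le> B * A"
      by (simp add: A_def)
  qed simp
  finally have "(LINT \<xi>|lborel. ?h \<xi> * exp (- e * (norm \<xi>)\<^sup>2))
      \<le> exp (e * (norm v)\<^sup>2) * (B * A)" .
  then show "(\<integral>\<^sup>+\<xi>. ennreal (?h \<xi> * exp (- e * (norm \<xi>)\<^sup>2)) \<partial>lborel)
    \<le> ennreal (exp (e * (norm v)\<^sup>2) * ((exp_moment r g) * (exp_moment t (ft g))))"
    by (subst nn_integral_eq_integral[OF il]) (auto intro!: ennreal_leI simp: A_def B_def)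
qed simp

lemma norm_cis_diff_le: "norm (cis a - cis b) \<le> \<bar>a - b\<bar>"
proof -
  have "cis a - cis b = cis b * (cis (a - b) - 1)" by (simp add: algebra_simps cis_mult)
  then have "norm (cis a - cis b) = norm (exp (\<i> * of_real (a - b)) - 1)" by (simp add: norm_mult cis_conv_exp)
  also have "\<dots> = 2 * \<bar>sin ((a - b) / 2)\<bar>" by (rule dist_exp_i_1)
  also have "\<dots> \<le> 2 * \<bar>(a - b) / 2\<bar>" by (intro mult_left_mono abs_sin_x_le_abs_x) auto
  finally show ?thesis by simp
qed

lemma ft_tilt_lipschitz:
  fixes g :: "'a::euclidean_space \<Rightarrow> complex"
  assumes g: "exp_integrable g" and v: "norm v \<le> r"
  shows "norm (ft (tilt v g) \<xi> - ft (tilt v g) \<xi>') \<le> (exp_moment (r + 1) g) * norm (\<xi> - \<xi>')"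
proof -
  have i: "integrable lborel (\<lambda>x. tilt v g x * cis (x \<bullet> \<xi>))" for \<xi>
    by (intro integrable_mult_cis integrable_tilt g)
  have bd: "norm (tilt v g x * cis (x \<bullet> \<xi>) - tilt v g x * cis (x \<bullet> \<xi>'))
      \<le> norm (g x) * exp ((r + 1) * norm x) * norm (\<xi> - \<xi>')" for x
  proof -
    have "norm (tilt v g x * cis (x \<bullet> \<xi>) - tilt v g x * cis (x \<bullet> \<xi>'))
        = norm (tilt v g x) * norm (cis (x \<bullet> \<xi>) - cis (x \<bullet> \<xi>'))"
      by (simp add: norm_mult[symmetric] right_diff_distrib)
    also have "\<dots> \<le> (norm (g x) * exp (r * norm x)) * (exp (norm x) * norm (\<xi> - \<xi>'))"
    proof (intro mult_mono norm_tilt_le v)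
      have "norm (cis (x \<bullet> \<xi>) - cis (x \<bullet> \<xi>')) \<le> \<bar>x \<bullet> (\<xi> - \<xi>')\<bar>"
        using norm_cis_diff_le[of "x \<bullet> \<xi>" "x \<bullet> \<xi>'"] by (simp add: inner_diff_right)
      also have "\<dots> \<le> norm x * norm (\<xi> - \<xi>')" by (rule Cauchy_Schwarz_ineq2)
      also have "\<dots> \<le> exp (norm x) * norm (\<xi> - \<xi>')"
      proof (rule mult_right_mono)
        show "norm x \<le> exp (norm x)" using exp_ge_add_one_self[of "norm x"] by linarith
      qed simp
      finally show "norm (cis (x \<bullet> \<xi>) - cis (x \<bullet> \<xi>')) \<le> exp (norm x) * norm (\<xi> - \<xi>')" .
    qed auto
    also have "\<dots> = norm (g x) * exp ((r + 1) * norm x) * norm (\<xi> - \<xi>')"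
      by (simp add: distrib_right exp_add)
    finally show ?thesis .
  qed
  have "ft (tilt v g) \<xi> - ft (tilt v g) \<xi>'
      = (LINT x|lborel. tilt v g x * cis (x \<bullet> \<xi>) - tilt v g x * cis (x \<bullet> \<xi>'))"
    unfolding ft_def using i by simp
  also have "norm \<dots> \<le> (LINT x|lborel. norm (g x) * exp ((r + 1) * norm x) * norm (\<xi> - \<xi>'))"
    by (intro norm_integral_le_integral integrable_mult_left exp_integrableD(2) g bd)
  finally show ?thesis by simp
qed

text \<open>
If the modulus is \<open>\<delta>\<close> at \<open>\<xi>0\<close>, the Lipschitz bound keeps it above \<open>\<delta> / 2\<close> on a ball with radius proportional to
\<open>\<delta>\<close>. An exponential weight that grows in the direction of \<open>\<xi>0\<close> is at least \<open>exp (t |\<xi>0| - t)\<close> there, so the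
weighted square integral bounds \<open>\<delta> ^ (n + 2) exp (t |\<xi>0|)\<close>. The choice \<open>t = (n + 2) R\<close> compensates the power.
\<close>
lemma ft_tilt_decay:
  fixes g :: "'a::euclidean_space \<Rightarrow> complex"
  assumes g: "exp_integrable g" and f: "exp_integrable (ft g)" and R: "R \<ge> 0"
  shows "\<exists>C. C \<ge> 0 \<and> (\<forall>v \<xi>. norm v
      \<le> r \<longrightarrow> norm (ft (tilt v g) \<xi>) \<le> C * exp (- R * norm \<xi>))"
proof -
  define D where "D = DIM('a)"
  define t where "t = real (D + 2) * R"
  define L where "L = (exp_moment (r + 1) g)"
  define B where "B = (exp_moment (2 * r) g)"
  define A where "A = (exp_moment t (ft g))"
  define \<omega> where "\<omega> = measure lborel (ball (0::'a) 1)"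
  have \<omega>: "\<omega> > 0" unfolding \<omega>_def by (rule content_ball_pos) simp
  define K where "K = B * A * exp t * 4 * (2 * L) ^ D / \<omega>"
  have t: "t \<ge> 0" using R by (simp add: t_def)
  have "norm (ft (tilt v g) \<xi>0) \<le> max 1 K * exp (- R * norm \<xi>0)" if v: "norm v \<le> r" for v \<xi>0
  proof (cases "ft (tilt v g) \<xi>0 = 0")
    case False
    define F where "F = ft (tilt v g)"
    have [measurable]: "F \<in> borel_measurable borel" unfolding F_def by (rule borel_measurable_ft[OF integrable_tilt[OF g]])
    define \<delta> where "\<delta> = norm (F \<xi>0)"
    have \<delta>: "\<delta> > 0" using False by (simp add: \<delta>_def F_def)
    have "\<delta> \<le> (exp_moment r g)"
      unfolding \<delta>_def F_def by (rule norm_ft_tilt_le[OF g v])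
    also have "\<dots> \<le> L"
      unfolding L_def by (intro integral_mono exp_integrableD(2)[OF g] mult_left_mono) (auto simp: distrib_right)
    finally have \<delta>L: "\<delta> \<le> L" .
    then have L: "L > 0" using \<delta> by simp
    define \<rho> where "\<rho> = \<delta> / (2 * L)"
    have \<rho>: "\<rho> > 0" "\<rho> \<le> 1" using \<delta> L \<delta>L by (auto simp: \<rho>_def divide_le_eq)
    (* The weight exp (2 (y \<bullet> \<xi>)) grows at rate t in the direction of \<xi>0. *)
    define y where "y = (t / 2) *\<^sub>R sgn \<xi>0"
    have y: "2 * norm y \<le> t" using t by (simp add: y_def norm_sgn)
    define m where "m = (\<delta> / 2)\<^sup>2 * exp (t * norm \<xi>0 - t)"
    have m: "m \<ge> 0" by (simp add: m_def)
    have low: "m \<le> (norm (F \<xi>))\<^sup>2 * exp (2 * (y \<bullet> \<xi>))" if \<xi>: "\<xi> \<in> ball \<xi>0 \<rho>" for \<xi>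
    proof -
      have d: "norm (\<xi>0 - \<xi>) < \<rho>" using \<xi> by (simp add: dist_norm)
      have "norm (F \<xi>0 - F \<xi>) \<le> L * norm (\<xi>0 - \<xi>)"
        unfolding F_def L_def by (rule ft_tilt_lipschitz[OF g v])
      also have "\<dots> \<le> L * \<rho>" using d L by (intro mult_left_mono) auto
      also have "\<dots> = \<delta> / 2" using L by (simp add: \<rho>_def)
      finally have "\<delta> / 2 \<le> norm (F \<xi>)"
        using norm_triangle_ineq2[of "F \<xi>0" "F \<xi>0 - F \<xi>"] by (simp add: \<delta>_def)
      then have 1: "(\<delta> / 2)\<^sup>2 \<le> (norm (F \<xi>))\<^sup>2" using \<delta> by (intro power_mono) auto
      have "sgn \<xi>0 \<bullet> \<xi>0 = norm \<xi>0" by (cases "\<xi>0 = 0") (auto simp: sgn_div_norm dot_square_norm power2_eq_square)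
      moreover have "sgn \<xi>0 \<bullet> (\<xi>0 - \<xi>) \<le> norm (sgn \<xi>0) * norm (\<xi>0 - \<xi>)"
        using Cauchy_Schwarz_ineq2[of "sgn \<xi>0" "\<xi>0 - \<xi>"] by linarith
      moreover have "norm (sgn \<xi>0) * norm (\<xi>0 - \<xi>) \<le> 1"
        using d \<rho> by (simp add: norm_sgn)
      ultimately have "norm \<xi>0 - 1 \<le> sgn \<xi>0 \<bullet> \<xi>" by (simp add: inner_diff_right)
      from mult_left_mono[OF this t] have "t * norm \<xi>0 - t
          \<le> 2 * (y \<bullet> \<xi>)" by (simp add: y_def algebra_simps)
      then have 2: "exp (t * norm \<xi>0 - t) \<le> exp (2 * (y \<bullet> \<xi>))" by simp
      show ?thesis unfolding m_def by (intro mult_mono 1 2) auto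
    qed
    have "ennreal (m * (\<rho> ^ D * \<omega>))
        = (\<integral>\<^sup>+\<xi>. ennreal m * indicator (ball \<xi>0 \<rho>) \<xi> \<partial>lborel)"
    proof -
      have "emeasure lborel (ball \<xi>0 \<rho>) = ennreal (measure lborel (ball \<xi>0 \<rho>))"
        using emeasure_lborel_ball_finite[of \<xi>0 \<rho>] by (intro emeasure_eq_ennreal_measure) auto
      also have "measure lborel (ball \<xi>0 \<rho>) = \<rho> ^ D * \<omega>"
        using content_ball_conv_unit_ball[of \<rho> \<xi>0] \<rho> by (simp add: D_def \<omega>_def)
      finally have "emeasure lborel (ball \<xi>0 \<rho>) = ennreal (\<rho> ^ D * \<omega>)" .
      moreover have "ennreal (m * (\<rho> ^ D * \<omega>)) = ennreal m * ennreal (\<rho> ^ D * \<omega>)"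
        using m \<rho> \<omega> by (intro ennreal_mult) auto
      ultimately show ?thesis by (subst nn_integral_cmult_indicator) auto
    qed
    also have "\<dots> \<le> (\<integral>\<^sup>+\<xi>. ennreal ((norm (F \<xi>))\<^sup>2
        * exp (2 * (y \<bullet> \<xi>))) \<partial>lborel)"
      by (intro nn_integral_mono) (use low in \<open>auto simp: indicator_def intro!: ennreal_leI\<close>)
    also have "\<dots> \<le> ennreal (B * A)"
      unfolding F_def B_def A_def by (rule tilted_square_integral_le[OF g f _ y]) (use v in simp)
    finally have "m * (\<rho> ^ D * \<omega>) \<le> B * A"
      by (subst (asm) ennreal_le_iff) (auto simp: A_def B_def)
    then have "(\<delta> * exp (R * norm \<xi>0)) ^ (D + 2) \<le> K"
    proof -
      have ex: "exp (R * norm \<xi>0) ^ (D + 2) = exp (t * norm \<xi>0)"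
        by (simp only: exp_of_nat_mult[symmetric] t_def mult.assoc)
      have "m * (\<rho> ^ D * \<omega>)
          = (\<delta> ^ (D + 2) * exp (t * norm \<xi>0)) * (\<omega> / (4 * exp t * (2 * L) ^ D))"
        unfolding m_def \<rho>_def by (simp add: power_divide power_add exp_diff power2_eq_square)
      with \<open>m * (\<rho> ^ D * \<omega>) \<le> B * A\<close> have "(\<delta> ^ (D + 2) * exp (t * norm \<xi>0))
          * (\<omega> / (4 * exp t * (2 * L) ^ D)) \<le> B * A" by simp
      moreover have pos: "\<omega> / (4 * exp t * (2 * L) ^ D) > 0" using \<omega> L by simp
      ultimately have "\<delta> ^ (D + 2) * exp (t * norm \<xi>0) \<le> B * A / (\<omega> / (4 * exp t * (2 * L) ^ D))"
        by (subst pos_le_divide_eq) auto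
      also have "\<dots> = K" by (simp add: K_def)
      finally show ?thesis by (simp only: power_mult_distrib ex)
    qed
    have "\<delta> * exp (R * norm \<xi>0) \<le> max 1 K"
    proof (cases "\<delta> * exp (R * norm \<xi>0) \<le> 1")
      case False
      then have "(\<delta> * exp (R * norm \<xi>0)) ^ 1 \<le> (\<delta> * exp (R * norm \<xi>0)) ^ (D + 2)"
        by (intro power_increasing) auto
      then show ?thesis using \<open>(\<delta> * exp (R * norm \<xi>0)) ^ (D + 2) \<le> K\<close> by simp
    qed simp
    then show ?thesis unfolding \<delta>_def F_def by (simp add: exp_minus field_simps)
  qed simp
  then show ?thesis by (intro exI[of _ "max 1 K"]) auto
qed

section \<open>The entire extension of the representation\<close>

lemma integrable_exp_abs:
  assumes c: "c > 0" shows "integrable lborel (\<lambda>t::real. exp (- c * \<bar>t\<bar>))"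
proof -
  interpret p: prob_space "density lborel (exponential_density c)"
    by (rule prob_space_exponential_density[OF c])
  have "(\<integral>\<^sup>+t. ennreal (exponential_density c t) \<partial>lborel) = 1"
    using p.emeasure_space_1 by (simp add: emeasure_density)
  then have i: "integrable lborel (exponential_density c)"
    using c by (simp add: integrable_iff_bounded exponential_density_nonneg)
  have i': "integrable lborel (\<lambda>t. exponential_density c (0 + (-1) * t))"
    by (rule lborel_integrable_real_affine[OF i]) simp
  show ?thesis
  proof (rule Bochner_Integration.integrable_bound)
    show "integrable lborel (\<lambda>t. (exponential_density c t + exponential_density c (0 + (-1) * t)) / c)"
      using i i' by simp
    show "AE t in lborel. norm (exp (- c * \<bar>t\<bar>))
        \<le> norm ((exponential_density c t + exponential_density c (0 + (-1) * t)) / c)"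
      using c by (intro AE_I2) (auto simp: exponential_density_def mult.commute abs_if)
  qed simp
qed

text \<open>
The norm dominates the average of the moduli of the coordinates, which reduces the claim to a product of
one-dimensional integrals.
\<close>
lemma integrable_exp_neg_norm: "integrable lborel (\<lambda>x::'a::euclidean_space. exp (- norm x))"
proof -
  define c where "c = 1 / real DIM('a)"
  have c: "c > 0" by (simp add: c_def)
  have "integrable lborel (\<lambda>t. complex_of_real (exp (- c * \<bar>t\<bar>)))"
    by (intro integrable_of_real integrable_exp_abs c)
  note std = has_bochner_integral_integrable[OF this]
  have i: "integrable lborel (\<lambda>x::'a. \<Prod>b\<in>Basis. complex_of_real (exp (- c * \<bar>x \<bullet> b\<bar>)))"
    by (rule has_bochner_integral_lborel_prod[OF std, THEN has_bochner_integral_iff[THEN iffD1], THEN conjunct1])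
  show ?thesis
  proof (rule Bochner_Integration.integrable_bound[OF i])
    show "AE x::'a in lborel. norm (exp (- norm x))
        \<le> norm (\<Prod>b\<in>Basis. complex_of_real (exp (- c * \<bar>x \<bullet> b\<bar>)))"
    proof (intro AE_I2)
      fix x :: 'a
      have "(\<Sum>b\<in>Basis. c * \<bar>x \<bullet> b\<bar>) \<le> (\<Sum>b\<in>(Basis::'a set). c * norm x)"
        using c by (intro sum_mono mult_left_mono Basis_le_norm) auto
      also have "\<dots> = norm x" by (simp add: c_def)
      finally have "exp (- norm x) \<le> exp (\<Sum>b\<in>Basis. - c * \<bar>x \<bullet> b\<bar>)"
        by (simp add: sum_negf)
      also have "\<dots> = (\<Prod>b\<in>Basis. exp (- c * \<bar>x \<bullet> b\<bar>))" by (simp add: exp_sum)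
      also have "\<dots> = norm (\<Prod>b\<in>Basis. complex_of_real (exp (- c * \<bar>x \<bullet> b\<bar>)))"
        by (simp only: prod_norm[symmetric] norm_of_real abs_exp_cancel)
      finally show "norm (exp (- norm x))
          \<le> norm (\<Prod>b\<in>Basis. complex_of_real (exp (- c * \<bar>x \<bullet> b\<bar>)))" by simp
    qed
  qed simp
qed

lemma L2_exp_decay:
  fixes G :: "real^'n \<Rightarrow> complex"
  assumes "G \<in> borel_measurable borel" and C: "C \<ge> 0" and G: "\<And>\<xi>. norm (G \<xi>) \<le> C * exp (- norm \<xi>)"
  shows "L2_sqnorm G \<le> ennreal (C\<^sup>2 * (LINT x::real^'n|lborel. exp (- norm x)))" and "G \<in> L2"
proof -
  have "L2_sqnorm G \<le> (\<integral>\<^sup>+x. ennreal (C\<^sup>2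
      * exp (- norm x)) \<partial>(lborel :: (real^'n) measure))"
    unfolding L2_sqnorm_lborel
  proof (intro nn_integral_mono ennreal_leI)
    fix x :: "real^'n"
    have "(norm (G x))\<^sup>2 \<le> (C * exp (- norm x))\<^sup>2" by (intro power_mono G) auto
    also have "\<dots> = C\<^sup>2 * (exp (- norm x) * exp (- norm x))" by (simp add: power2_eq_square mult_ac)
    also have "\<dots> \<le> C\<^sup>2 * exp (- norm x)" by (intro mult_left_mono mult_left_le) auto
    finally show "(norm (G x))\<^sup>2 \<le> C\<^sup>2 * exp (- norm x)" .
  qed
  also have "\<dots> = ennreal (C\<^sup>2 * (LINT x::real^'n|lborel. exp (- norm x)))"
    by (subst nn_integral_eq_integral) (auto intro!: integrable_mult_right integrable_exp_neg_norm)
  finally show 1: "L2_sqnorm G \<le> ennreal (C\<^sup>2 * (LINT x::real^'n|lborel. exp (- norm x)))" .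
  show "G \<in> L2"
    using L2_iff[OF borel_measurable_lebesgueI[OF assms(1)]] le_less_trans[OF 1 ennreal_less_top] by simp
qed

text \<open>
Bilinear rather than Hermitian, so that it is holomorphic in both arguments.
\<close>
definition dotc :: "complex^'n \<Rightarrow> complex^'n \<Rightarrow> complex" where
  "dotc z w = (\<Sum>j\<in>UNIV. z $ j * w $ j)"

lemma dotc_simps:
  "dotc (z + z') w = dotc z w + dotc z' w" "dotc w (z + z') = dotc w z + dotc w z'"
  "dotc (t *s z) w = t * dotc z w" "dotc w (t *s z) = t * dotc w z"
  by (simp_all add: dotc_def distrib_left distrib_right sum.distrib sum_distrib_left mult_ac)

lemma norm_dotc_le: "norm (dotc z w) \<le> norm z * norm w"
proof -
  have "norm (dotc z w) \<le> (\<Sum>j\<in>UNIV. \<bar>norm (z $ j)\<bar> * \<bar>norm (w $ j)\<bar>)"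
    unfolding dotc_def by (rule sum_norm_le) (simp add: norm_mult)
  also have "\<dots> \<le> norm z * norm w" unfolding norm_vec_def by (rule L2_set_mult_ineq)
  finally show ?thesis .
qed

lemma norm_cscale: "norm (t *s (z :: complex^'n)) = norm t * norm z"
  unfolding norm_vec_def by (subst L2_set_right_distrib) (auto simp: norm_mult)

lemma norm_cscale_Pair: "norm (t *s (z :: complex^'n), t *s (w :: complex^'n)) = norm t * norm (z, w)"
  by (simp add: norm_Pair norm_cscale power_mult_distrib flip: distrib_left) (simp add: real_sqrt_mult)

abbreviation rvec :: "real^'n \<Rightarrow> complex^'n" where "rvec x \<equiv> cvec x 0"

lemma norm_rvec: "norm (rvec x) = norm x"
  unfolding norm_vec_def cvec_def by (simp add: complex_norm)

lemma dotc_rvec: "dotc (cvec x v) (rvec y) = of_real (x \<bullet> y) + \<i> * of_real (v \<bullet> y)"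
  unfolding dotc_def inner_vec_def cvec_def
  by (simp add: complex_eq_iff sum_distrib_left)

lemma norm_cvec_le: "norm (cvec x y) \<le> norm x + norm y"
proof -
  have "norm (cvec x y) \<le> L2_set (\<lambda>j. norm (x $ j) + norm (y $ j)) UNIV"
    unfolding norm_vec_def cvec_def by (rule L2_set_mono) (auto simp: complex_norm real_sqrt_sum_squares_triangle_ineq sqrt_sum_squares_le_sum_abs)
  also have "\<dots> \<le> norm x + norm y" unfolding norm_vec_def by (rule L2_set_triangle_ineq)
  finally show ?thesis .
qed

lemma cvec_decompose:
  obtains u v where "w = cvec u v" "norm u \<le> norm w" "norm v \<le> norm w"
proof (rule that[of "\<chi> j. Re (w $ j)" "\<chi> j. Im (w $ j)"])
  show "w = cvec (\<chi> j. Re (w $ j)) (\<chi> j. Im (w $ j))" by (simp add: cvec_def vec_eq_iff)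
qed (rule norm_le_componentwise_cart, simp add: abs_Re_le_cmod abs_Im_le_cmod)+

text \<open>
The transform of \<open>modulate w g\<close> at \<open>\<xi>\<close> is the value at \<open>\<xi> + w\<close> of the entire extension of the transform of \<open>g\<close>.
\<close>
definition modulate :: "complex^'n \<Rightarrow> (real^'n \<Rightarrow> complex) \<Rightarrow> real^'n \<Rightarrow> complex" where
  "modulate w g \<eta> = g \<eta> * exp (\<i> * dotc w (rvec \<eta>))"

lemma continuous_on_dotc_rvec [continuous_intros]: "continuous_on A (\<lambda>x. dotc w (rvec x))"
proof -
  have "dotc w (rvec x) = (\<Sum>j\<in>UNIV. w $ j * of_real (x $ j))" for x
    by (simp add: dotc_def cvec_def complex_of_real_def)
  then show ?thesis by (simp add: continuous_intros)
qed

lemma borel_measurable_dotc_rvec [measurable]: "(\<lambda>x. dotc w (rvec x)) \<in> borel_measurable borel"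
  by (intro borel_measurable_continuous_onI continuous_intros)

lemma borel_measurable_modulate: "g \<in> borel_measurable borel \<Longrightarrow> modulate w g \<in> borel_measurable borel"
proof -
  assume [measurable]: "g \<in> borel_measurable borel"
  have "modulate w g = (\<lambda>\<eta>. g \<eta>
      * exp (\<i> * dotc w (rvec \<eta>)))" by (simp add: modulate_def fun_eq_iff)
  then show ?thesis by simp
qed

lemma norm_exp_le_exp_norm: "norm (exp (z::complex)) \<le> exp (norm z)"
  by (simp add: complex_Re_le_cmod)

lemma norm_modulate_le: "norm (modulate w g \<eta>) \<le> norm (g \<eta>) * exp (norm w * norm \<eta>)"
proof -
  have "norm (exp (\<i> * dotc w (rvec \<eta>)))
      \<le> exp (norm (\<i> * dotc w (rvec \<eta>)))" by (rule norm_exp_le_exp_norm)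
  also have "\<dots> \<le> exp (norm w * norm \<eta>)" using norm_dotc_le[of w "rvec \<eta>"] by (simp add: norm_mult norm_rvec)
  finally show ?thesis unfolding modulate_def norm_mult by (intro mult_left_mono) auto
qed

lemma exp_integrable_modulate:
  fixes g :: "real^'n \<Rightarrow> complex"
  assumes g: "exp_integrable g" shows "exp_integrable (modulate w g)"
  unfolding exp_integrable_def
proof (intro conjI allI)
  show m: "modulate w g \<in> borel_measurable borel" by (rule borel_measurable_modulate[OF exp_integrableD(1)[OF g]])
  fix R
  show "integrable lborel (\<lambda>x. norm (modulate w g x) * exp (R * norm x))"
  proof (rule Bochner_Integration.integrable_bound[OF exp_integrableD(2)[OF g, of "norm w + R"]])
    show "AE x in lborel. norm (norm (modulate w g x) * exp (R * norm x))
        \<le> norm (norm (g x) * exp ((norm w + R) * norm x))"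
    proof (intro AE_I2)
      fix x
      have "norm (modulate w g x) * exp (R * norm x) \<le> norm (g x) * exp (norm w * norm x) * exp (R * norm x)"
        by (intro mult_right_mono norm_modulate_le) simp
      then show "norm (norm (modulate w g x) * exp (R * norm x)) \<le> norm (norm (g x) * exp ((norm w + R) * norm x))"
        by (simp add: distrib_right exp_add mult.assoc)
    qed
  qed (use m in simp)
qed

lemma exp_integrable_imp_integrable:
  assumes "exp_integrable g" shows "integrable lborel g"
  using integrable_tilt[OF assms, of 0] by (simp add: tilt_0)

lemma exp_integrable_mult_component:
  fixes g :: "real^'n \<Rightarrow> complex"
  assumes g: "exp_integrable g"
  shows "integrable lborel (\<lambda>\<eta>. g \<eta> * (\<i> * of_real (\<eta> $ j)))"
proof (rule Bochner_Integration.integrable_bound[OF exp_integrableD(2)[OF g, of 1]])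
  show "AE x in lborel. norm (g x * (\<i> * complex_of_real (x $ j))) \<le> norm (norm (g x) * exp (1 * norm x))"
  proof (intro AE_I2)
    fix x :: "real^'n"
    have "\<bar>x $ j\<bar> \<le> exp (norm x)" using component_le_norm_cart[of x j] exp_ge_add_one_self[of "norm x"] by linarith
    then show "norm (g x * (\<i> * complex_of_real (x $ j))) \<le> norm (norm (g x) * exp (1 * norm x))"
      by (simp add: norm_mult mult_left_mono)
  qed
  show "(\<lambda>\<eta>. g \<eta> * (\<i> * of_real (\<eta> $ j))) \<in> borel_measurable lborel"
  proof -
    have [measurable]: "(\<lambda>\<eta>::real^'n. \<eta> $ j) \<in> borel_measurable borel"
      by (intro borel_measurable_continuous_onI continuous_intros)
    show ?thesis using exp_integrableD(1)[OF g] by simp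
  qed
qed

lemma ft_modulate_cvec: "ft (modulate (cvec u v) g) \<xi> = ft (tilt v g) (\<xi> + u)"
  unfolding ft_def modulate_def tilt_def dotc_rvec
proof (rule Bochner_Integration.integral_cong[OF refl])
  fix x
  have "exp (\<i> * (complex_of_real (u \<bullet> x) + \<i> * complex_of_real (v \<bullet> x)))
      = cis (x \<bullet> u) * of_real (exp (- (v \<bullet> x)))"
  proof -
    have "\<i> * (complex_of_real (u \<bullet> x) + \<i> * complex_of_real (v \<bullet> x))
        = \<i> * of_real (u \<bullet> x) + of_real (- (v \<bullet> x))"
      by (simp add: distrib_left mult.assoc[symmetric])
    then show ?thesis by (simp only: exp_add exp_of_real cis_conv_exp inner_commute)
  qed
  then show "g x * exp (\<i> * (complex_of_real (u \<bullet> x) + \<i> * complex_of_real (v \<bullet> x))) * cis (x \<bullet> \<xi>) =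
       g x * complex_of_real (exp (- (v \<bullet> x))) * cis (x \<bullet> (\<xi> + u))"
    by (simp add: inner_add_right cis_mult[symmetric] mult_ac)
qed

text \<open>
The formula for \<open>\<pi>(z, w) f\<close> with \<open>p = (z, w)\<close> complex, where \<open>f\<close> is the transform of \<open>g\<close>.
\<close>
definition rep_ext :: "(real^'n \<Rightarrow> complex) \<Rightarrow> (complex^'n) \<times> (complex^'n) \<Rightarrow> real^'n \<Rightarrow> complex" where
  "rep_ext g p \<xi> = exp (\<i> * (dotc (fst p) (rvec \<xi>) + dotc (fst p) (snd p) / 2)) * ft (modulate (snd p) g) \<xi>"

lemma borel_measurable_rep_ext:
  assumes g: "exp_integrable g" shows "rep_ext g p \<in> borel_measurable borel"
proof -
  have [measurable]: "ft (modulate (snd p) g) \<in> borel_measurable borel"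
    by (intro borel_measurable_ft exp_integrable_imp_integrable exp_integrable_modulate g)
  have "rep_ext g p = (\<lambda>\<xi>. exp (\<i> * (dotc (fst p) (rvec \<xi>) + dotc (fst p) (snd p) / 2))
      * ft (modulate (snd p) g) \<xi>)"
    by (simp add: rep_ext_def fun_eq_iff)
  then show ?thesis by simp
qed

lemma rep_ext_decay:
  fixes g :: "real^'n \<Rightarrow> complex"
  assumes g: "exp_integrable g" and f: "exp_integrable (ft g)" and r: "r \<ge> 0"
  shows "\<exists>C\<ge>0. \<forall>p \<xi>. norm p
      \<le> r \<longrightarrow> norm (rep_ext g p \<xi>) \<le> C * exp (- norm \<xi>)"
proof -
  obtain C where C: "C \<ge> 0" "\<And>v \<xi>. norm v \<le> r \<Longrightarrow> norm (ft (tilt v g) \<xi>) \<le> C * exp (- (r + 1) * norm \<xi>)"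
    using ft_tilt_decay[OF g f, of "r + 1" r] r by auto
  define C' where "C' = exp (r * r / 2) * (C * exp ((r + 1) * r))"
  have "norm (rep_ext g p \<xi>) \<le> C' * exp (- norm \<xi>)" if p: "norm p \<le> r" for p \<xi>
  proof -
    have p1: "norm (fst p) \<le> r" and p2: "norm (snd p) \<le> r"
      using p norm_fst_le[of "fst p" "snd p"] norm_snd_le[of "snd p" "fst p"] by auto
    obtain u v where uv: "snd p = cvec u v" "norm u \<le> norm (snd p)" "norm v \<le> norm (snd p)"
      by (rule cvec_decompose)
    have "norm (ft (modulate (snd p) g) \<xi>) \<le> C * exp (- (r + 1) * norm (\<xi> + u))"
      unfolding uv(1) ft_modulate_cvec by (rule C(2)) (use uv p2 in linarith)
    also have "\<dots> \<le> C * exp ((r + 1) * r - (r + 1) * norm \<xi>)"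
    proof -
      have "norm \<xi> \<le> norm (\<xi> + u) + r"
        using norm_triangle_ineq4[of "\<xi> + u" u] uv p2 by simp
      from mult_left_mono[OF this, of "r + 1"] r have "- (r + 1) * norm (\<xi> + u) \<le> (r + 1) * r - (r + 1) * norm \<xi>"
        by (simp add: algebra_simps)
      then show ?thesis using C(1) by (intro mult_left_mono) auto
    qed
    finally have 1: "norm (ft (modulate (snd p) g) \<xi>) \<le> C * exp ((r + 1) * r - (r + 1) * norm \<xi>)" .
    have "norm (\<i> * (dotc (fst p) (rvec \<xi>) + dotc (fst p) (snd p) / 2))
        \<le> norm (dotc (fst p) (rvec \<xi>)) + norm (dotc (fst p) (snd p)) / 2"
      using norm_triangle_ineq[of "dotc (fst p) (rvec \<xi>)" "dotc (fst p) (snd p) / 2"] by (simp add: norm_mult norm_divide)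
    also have "\<dots> \<le> r * norm \<xi> + r * r / 2"
    proof (intro add_mono divide_right_mono)
      show "norm (dotc (fst p) (rvec \<xi>)) \<le> r * norm \<xi>"
        using norm_dotc_le[of "fst p" "rvec \<xi>"] mult_right_mono[OF p1, of "norm \<xi>"] by (simp add: norm_rvec)
      show "norm (dotc (fst p) (snd p)) \<le> r * r"
        using norm_dotc_le[of "fst p" "snd p"] mult_mono[OF p1 p2 r] by simp
    qed simp
    finally have 2: "norm (exp (\<i> * (dotc (fst p) (rvec \<xi>) + dotc (fst p) (snd p) / 2)))
        \<le> exp (r * norm \<xi> + r * r / 2)"
      by (intro order_trans[OF norm_exp_le_exp_norm]) simp
    have "norm (rep_ext g p \<xi>) \<le> exp (r * norm \<xi> + r * r / 2) * (C * exp ((r + 1) * r - (r + 1) * norm \<xi>))"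
      unfolding rep_ext_def norm_mult by (rule mult_mono[OF 2 1]) auto
    also have "\<dots> = C' * exp (- norm \<xi>)"
      unfolding C'_def by (simp add: mult_exp_exp exp_add[symmetric] algebra_simps)
    finally show ?thesis .
  qed
  moreover have "C' \<ge> 0" using C by (simp add: C'_def)
  ultimately show ?thesis by blast
qed

text \<open>
The derivative of \<open>rep_ext\<close> with respect to the component \<open>j\<close> of the first argument.
\<close>
definition rep_ext_dfst :: "(real^'n \<Rightarrow> complex) \<Rightarrow> (complex^'n) \<times> (complex^'n) \<Rightarrow> 'n \<Rightarrow> real^'n \<Rightarrow> complex" where
  "rep_ext_dfst g p j \<xi> = \<i> * (of_real (\<xi> $ j) + snd p $ j / 2) * rep_ext g p \<xi>"

text \<open>
The derivative of \<open>rep_ext\<close> with respect to the component \<open>j\<close> of the second argument.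
\<close>
definition rep_ext_dsnd :: "(real^'n \<Rightarrow> complex) \<Rightarrow> (complex^'n) \<times> (complex^'n) \<Rightarrow> 'n \<Rightarrow> real^'n \<Rightarrow> complex" where
  "rep_ext_dsnd g p j \<xi> = \<i> * (fst p $ j / 2) * rep_ext g p \<xi> +
     exp (\<i> * (dotc (fst p) (rvec \<xi>) + dotc (fst p) (snd p) / 2)) * ft (\<lambda>\<eta>. modulate (snd p) g \<eta> * (\<i> * of_real (\<eta> $ j))) \<xi>"

abbreviation rep_ext_differential ::
  "(real^'n \<Rightarrow> complex) \<Rightarrow> (complex^'n) \<times> (complex^'n) \<Rightarrow> (complex^'n) \<times> (complex^'n) \<Rightarrow> real^'n \<Rightarrow> complex" where
  "rep_ext_differential g p q \<xi> \<equiv> (\<Sum>j\<in>UNIV. fst q $ j * rep_ext_dfst g p j \<xi>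
      + snd q $ j * rep_ext_dsnd g p j \<xi>)"

definition rep_slice :: "(real^'n \<Rightarrow> complex) \<Rightarrow> (complex^'n) \<times> (complex^'n) \<Rightarrow> (complex^'n) \<times> (complex^'n) \<Rightarrow> real^'n \<Rightarrow> complex \<Rightarrow> complex" where
  "rep_slice g p q \<xi> t = rep_ext g (fst p + t *s fst q, snd p + t *s snd q) \<xi>"

lemma rep_slice_integral:
  "rep_slice g p q \<xi> t = exp (\<i> * (dotc (fst p) (rvec \<xi>) + dotc (fst p) (snd p) / 2 +
      t * (dotc (fst q) (rvec \<xi>) + (dotc (fst q) (snd p) + dotc (fst p) (snd q)) / 2) + t\<^sup>2 * (dotc (fst q) (snd q) / 2))) *
    (LINT \<eta>|lborel. modulate (snd p) g \<eta> * cis (\<eta> \<bullet> \<xi>) * exp (t * (\<i> * dotc (snd q) (rvec \<eta>))))"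
proof -
  have "ft (modulate (snd p + t *s snd q) g) \<xi>
      = (LINT \<eta>|lborel. modulate (snd p) g \<eta> * cis (\<eta> \<bullet> \<xi>) * exp (t * (\<i> * dotc (snd q) (rvec \<eta>))))"
    unfolding ft_def modulate_def by (simp add: dotc_simps distrib_left exp_add mult_ac)
  then show ?thesis
    unfolding rep_slice_def rep_ext_def by (simp add: dotc_simps power2_eq_square algebra_simps add_divide_distrib)
qed

lemma slice_weight_integrable:
  fixes g :: "real^'n \<Rightarrow> complex"
  assumes g: "exp_integrable g"
  shows "integrable lborel (\<lambda>\<eta>. norm (modulate w g \<eta> * cis (\<eta> \<bullet> \<xi>))
      * exp (\<rho> * norm (\<i> * dotc k (rvec \<eta>))))"
proof (rule Bochner_Integration.integrable_bound[OF exp_integrableD(2)[OF exp_integrable_modulate[OF g, of w], of "\<bar>\<rho>\<bar> * norm k"]])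
  note [measurable] = exp_integrableD(1)[OF exp_integrable_modulate[OF g, of w]]
  show "(\<lambda>\<eta>. norm (modulate w g \<eta> * cis (\<eta> \<bullet> \<xi>))
      * exp (\<rho> * norm (\<i> * dotc k (rvec \<eta>)))) \<in> borel_measurable lborel"
    by simp
  show "AE x in lborel. norm (norm (modulate w g x * cis (x \<bullet> \<xi>))
      * exp (\<rho> * norm (\<i> * dotc k (rvec x)))) \<le> norm (norm (modulate w g x) * exp (\<bar>\<rho>\<bar> * norm k * norm x))"
  proof (intro AE_I2)
    fix x
    have "\<rho> * norm (dotc k (rvec x)) \<le> \<bar>\<rho>\<bar> * norm (dotc k (rvec x))" by (intro mult_right_mono) auto
    also have "\<dots> \<le> \<bar>\<rho>\<bar> * (norm k * norm x)"
      using norm_dotc_le[of k "rvec x"] by (intro mult_left_mono) (auto simp: norm_rvec)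
    finally show "norm (norm (modulate w g x * cis (x \<bullet> \<xi>)) * exp (\<rho> * norm (\<i> * dotc k (rvec x))))
        \<le> norm (norm (modulate w g x) * exp (\<bar>\<rho>\<bar> * norm k * norm x))"
      by (simp add: norm_mult mult_left_mono mult.assoc)
  qed
qed

lemma rep_slice_holomorphic:
  fixes g :: "real^'n \<Rightarrow> complex"
  assumes g: "exp_integrable g"
  shows "rep_slice g p q \<xi> holomorphic_on ball 0 2"
proof -
  note [measurable] = exp_integrableD(1)[OF exp_integrable_modulate[OF g, of "snd p"]]
  have h: "(\<lambda>t. LINT \<eta>|lborel. modulate (snd p) g \<eta> * cis (\<eta> \<bullet> \<xi>)
      * exp (t * (\<i> * dotc (snd q) (rvec \<eta>)))) holomorphic_on ball 0 2"
    by (rule exp_integral_holomorphic[OF _ _ slice_weight_integrable[OF g]]) auto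
  have "(\<lambda>t. rep_slice g p q \<xi> t) holomorphic_on ball 0 2"
    unfolding rep_slice_integral by (intro holomorphic_intros h)
  then show ?thesis .
qed

lemma rep_slice_deriv_0:
  fixes g :: "real^'n \<Rightarrow> complex"
  assumes g: "exp_integrable g"
  shows "(rep_slice g p q \<xi> has_field_derivative (rep_ext_differential g p q \<xi>)) (at 0)"
proof -
  note [measurable] = exp_integrableD(1)[OF exp_integrable_modulate[OF g, of "snd p"]]
  define A where "A = dotc (fst p) (rvec \<xi>) + dotc (fst p) (snd p) / 2"
  define B where "B = dotc (fst q) (rvec \<xi>) + (dotc (fst q) (snd p) + dotc (fst p) (snd q)) / 2"
  define H where "H t = (LINT \<eta>|lborel. modulate (snd p) g \<eta>
      * cis (\<eta> \<bullet> \<xi>) * exp (t * (\<i> * dotc (snd q) (rvec \<eta>))))" for t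
  define H' where "H' = (LINT \<eta>|lborel. modulate (snd p) g \<eta>
      * cis (\<eta> \<bullet> \<xi>) * (\<i> * dotc (snd q) (rvec \<eta>)))"
  have H: "(H has_field_derivative H') (at 0)"
    unfolding H_def H'_def
    by (rule exp_integral_has_derivative[OF _ _ slice_weight_integrable[OF g, of _ _ 1]]) auto
  have H0: "H 0 = ft (modulate (snd p) g) \<xi>" by (simp add: H_def ft_def)
  have "((\<lambda>t. exp (\<i> * (A + t * B + t\<^sup>2 * (dotc (fst q) (snd q) / 2))) * H t) has_field_derivative
      (\<i> * B) * exp (\<i> * A) * H 0 + exp (\<i> * A) * H') (at 0)"
    using H by (auto intro!: derivative_eq_intros)
  also have "(\<lambda>t. exp (\<i> * (A + t * B + t\<^sup>2 * (dotc (fst q) (snd q) / 2))) * H t) = rep_slice g p q \<xi>"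
    unfolding rep_slice_integral H_def A_def B_def by (rule ext) simp
  also have "(\<i> * B) * exp (\<i> * A) * H 0 + exp (\<i> * A) * H' = (rep_ext_differential g p q \<xi>)"
  proof -
    have B: "B = (\<Sum>j\<in>UNIV. fst q $ j * (of_real (\<xi> $ j) + snd p $ j / 2) + snd q $ j * (fst p $ j / 2))"
      unfolding B_def dotc_def cvec_def
      by (simp add: sum.distrib distrib_left sum_divide_distrib add_divide_distrib mult_ac complex_of_real_def)
    have "H' = (LINT \<eta>|lborel. (\<Sum>j\<in>UNIV. snd q $ j
        * (modulate (snd p) g \<eta> * (\<i> * of_real (\<eta> $ j)) * cis (\<eta> \<bullet> \<xi>))))"
      unfolding H'_def dotc_def cvec_def
      by (simp add: sum_distrib_left mult_ac complex_of_real_def)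
    also have "\<dots> = (\<Sum>j\<in>UNIV. snd q $ j
        * ft (\<lambda>\<eta>. modulate (snd p) g \<eta> * (\<i> * of_real (\<eta> $ j))) \<xi>)"
      unfolding ft_def
      by (subst Bochner_Integration.integral_sum)
         (auto intro!: integrable_mult_right integrable_mult_cis exp_integrable_mult_component exp_integrable_modulate g)
    finally have H': "H' = (\<Sum>j\<in>UNIV. snd q $ j
        * ft (\<lambda>\<eta>. modulate (snd p) g \<eta> * (\<i> * of_real (\<eta> $ j))) \<xi>)" .
    have Fe: "rep_ext g p \<xi> = exp (\<i> * A) * H 0" unfolding rep_ext_def A_def H0 ..
    have t: "fst q $ j * rep_ext_dfst g p j \<xi> + snd q $ j * rep_ext_dsnd g p j \<xi> =
      (\<i> * exp (\<i> * A) * H 0) * (fst q $ j * (of_real (\<xi> $ j) + snd p $ j / 2) + snd q $ j * (fst p $ j / 2)) +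
       exp (\<i> * A) * (snd q $ j * ft (\<lambda>\<eta>. modulate (snd p) g \<eta> * (\<i> * of_real (\<eta> $ j))) \<xi>)" for j
      unfolding rep_ext_dfst_def rep_ext_dsnd_def Fe A_def[symmetric] by (simp add: algebra_simps)
    have "(rep_ext_differential g p q \<xi>) =
       (\<Sum>j\<in>UNIV. (\<i> * exp (\<i> * A) * H 0) * (fst q $ j * (of_real (\<xi> $ j) + snd p $ j / 2) + snd q $ j * (fst p $ j / 2))) +
       (\<Sum>j\<in>UNIV. exp (\<i> * A) * (snd q $ j * ft (\<lambda>\<eta>. modulate (snd p) g \<eta> * (\<i> * of_real (\<eta> $ j))) \<xi>))"
      unfolding t by (rule sum.distrib)
    also have "\<dots> = (\<i> * exp (\<i> * A) * H 0) * B + exp (\<i> * A) * H'"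
      by (simp only: sum_distrib_left[symmetric] B[symmetric] H'[symmetric])
    finally show ?thesis by (simp add: mult_ac)
  qed
  finally show ?thesis .
qed

text \<open>
Cauchy's inequality on discs of radius \<open>1/2\<close> bounds the second derivative by \<open>8 M\<close>, and Taylor's formula turns
this into a bound on the remainder.
\<close>
lemma cauchy_taylor_bounds:
  assumes h: "\<phi> holomorphic_on ball 0 2" and M: "\<And>t. norm t \<le> 1 \<Longrightarrow> norm (\<phi> t) \<le> M"
    and d: "(\<phi> has_field_derivative d) (at 0)"
  shows "norm d \<le> M" and "norm s \<le> 1/2 \<Longrightarrow> norm (\<phi> s - \<phi> 0 - s * d) \<le> 8 * M * (norm s)\<^sup>2"
proof -
  have cb: "norm ((deriv ^^ n) \<phi> x) \<le> fact n * M / r ^ n" if "r > 0" "norm x + r \<le> 1" for n x r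
  proof (rule Cauchy_inequality[OF _ _ that(1)])
    have sub: "cball x r \<subseteq> ball 0 2"
    proof
      fix y assume "y \<in> cball x r"
      then have "norm (y - x) \<le> r" by (simp add: dist_norm norm_minus_commute)
      then show "y \<in> ball 0 2" using norm_triangle_ineq[of "y - x" x] that by simp
    qed
    show "\<phi> holomorphic_on ball x r" by (rule holomorphic_on_subset[OF h]) (use sub ball_subset_cball in blast)
    show "continuous_on (cball x r) \<phi>" by (rule continuous_on_subset[OF holomorphic_on_imp_continuous_on[OF h] sub])
    show "norm (\<phi> y) \<le> M" if "norm (x - y) = r" for y
      using norm_triangle_ineq4[of x "x - y"] that \<open>norm x + r \<le> 1\<close> by (intro M) simp
  qed
  have d': "deriv \<phi> 0 = d" by (rule DERIV_imp_deriv[OF d])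
  show "norm d \<le> M" using cb[of 1 0 1] d' by simp
  assume s: "norm s \<le> 1/2"
  have "norm (\<phi> s - (\<Sum>i\<le>1. (deriv ^^ i) \<phi> 0 * (s - 0) ^ i / fact i))
      \<le> (8 * M) * norm (s - 0) ^ Suc 1 / fact 1"
  proof (rule complex_Taylor[of "cball 0 (1/2)" 1 "\<lambda>i. (deriv ^^ i) \<phi>", simplified funpow_0])
    fix i :: nat and x :: complex assume x: "x \<in> cball 0 (1/2)"
    have "(deriv ^^ i) \<phi> holomorphic_on ball 0 2" by (rule holomorphic_higher_deriv[OF h]) simp
    then have "((deriv ^^ i) \<phi> has_field_derivative deriv ((deriv ^^ i) \<phi>) x) (at x)"
      using x by (intro holomorphic_derivI[of _ "ball 0 2"]) auto
    then show "((deriv ^^ i) \<phi> has_field_derivative (deriv ^^ Suc i) \<phi> x) (at x within cball 0 (1/2))"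
      by (simp add: has_field_derivative_at_within)
  next
    fix x :: complex assume x: "x \<in> cball 0 (1/2)"
    then show "norm ((deriv ^^ Suc 1) \<phi> x) \<le> 8 * M" using cb[of "1/2" x "Suc 1"] by (simp add: power2_eq_square)
  qed (use s in auto)
  then show "norm (\<phi> s - \<phi> 0 - s * d) \<le> 8 * M * (norm s)\<^sup>2"
    by (simp add: d' power2_eq_square mult_ac diff_diff_eq)
qed

lemma rep_ext_slice_bounds:
  fixes g :: "real^'n \<Rightarrow> complex"
  assumes g: "exp_integrable g"
    and C: "\<And>p' \<xi>. norm p' \<le> norm p + 1
        \<Longrightarrow> norm (rep_ext g p' \<xi>) \<le> C * exp (- norm \<xi>)"
    and q: "norm q = 1"
  shows "norm (rep_ext_differential g p q \<xi>) \<le> C * exp (- norm \<xi>)"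
    and "norm s \<le> 1/2 \<Longrightarrow>
      norm (rep_slice g p q \<xi> s - rep_ext g p \<xi> - s * (rep_ext_differential g p q \<xi>))
        \<le> 8 * (C * exp (- norm \<xi>)) * (norm s)\<^sup>2"
proof -
  have M: "norm (rep_slice g p q \<xi> t) \<le> C * exp (- norm \<xi>)" if "norm t \<le> 1" for t
    unfolding rep_slice_def
  proof (rule C)
    have "norm (fst p + t *s fst q, snd p + t *s snd q) = norm (p + (t *s fst q, t *s snd q))"
      by (simp add: plus_prod_def)
    also have "\<dots> \<le> norm p + norm t * norm (fst q, snd q)"
      using norm_triangle_ineq[of p "(t *s fst q, t *s snd q)"] by (simp add: norm_cscale_Pair)
    also have "\<dots> \<le> norm p + 1" using that q by simp
    finally show "norm (fst p + t *s fst q, snd p + t *s snd q) \<le> norm p + 1" .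
  qed
  note b = cauchy_taylor_bounds[OF rep_slice_holomorphic[OF g] M rep_slice_deriv_0[OF g]]
  show "norm (rep_ext_differential g p q \<xi>) \<le> C * exp (- norm \<xi>)" by (rule b(1))
  have "rep_slice g p q \<xi> 0 = rep_ext g p \<xi>" by (simp add: rep_slice_def vec_eq_iff)
  then show "norm (rep_slice g p q \<xi> s - rep_ext g p \<xi> - s * (rep_ext_differential g p q \<xi>))
        \<le> 8 * (C * exp (- norm \<xi>)) * (norm s)\<^sup>2" if "norm s \<le> 1/2"
    using b(2)[OF _ that] by simp
qed

lemma borel_measurable_rep_ext_dfst:
  fixes g :: "real^'n \<Rightarrow> complex"
  assumes g: "exp_integrable g" shows "rep_ext_dfst g p j \<in> borel_measurable borel"
proof -
  note [measurable] = borel_measurable_rep_ext[OF g]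
  have [measurable]: "(\<lambda>\<xi>::real^'n. \<xi> $ j) \<in> borel_measurable borel"
    by (intro borel_measurable_continuous_onI continuous_intros)
  have "rep_ext_dfst g p j = (\<lambda>\<xi>. \<i> * (of_real (\<xi> $ j) + snd p $ j / 2)
      * rep_ext g p \<xi>)" by (simp add: rep_ext_dfst_def fun_eq_iff)
  then show ?thesis by simp
qed

lemma borel_measurable_rep_ext_dsnd:
  fixes g :: "real^'n \<Rightarrow> complex"
  assumes g: "exp_integrable g" shows "rep_ext_dsnd g p j \<in> borel_measurable borel"
proof -
  note [measurable] = borel_measurable_rep_ext[OF g]
    borel_measurable_ft[OF exp_integrable_mult_component[OF exp_integrable_modulate[OF g, of "snd p"], of j]]
  have "rep_ext_dsnd g p j = (\<lambda>\<xi>. \<i> * (fst p $ j / 2) * rep_ext g p \<xi> +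
     exp (\<i> * (dotc (fst p) (rvec \<xi>) + dotc (fst p) (snd p) / 2)) * ft (\<lambda>\<eta>. modulate (snd p) g \<eta> * (\<i> * of_real (\<eta> $ j))) \<xi>)"
    by (simp add: rep_ext_dsnd_def fun_eq_iff)
  then show ?thesis by simp
qed

text \<open>
On bounded sets the extension is dominated by a multiple of \<open>exp (- |\<xi>|)\<close>. Cauchy's estimates on the complex lines
through \<open>p\<close> transfer this domination to the derivatives and to the Taylor remainder, which is quadratic in \<open>q\<close>.
\<close>
lemma L2_entire_rep_ext:
  fixes g :: "real^'n \<Rightarrow> complex"
  assumes g: "exp_integrable g" and f: "exp_integrable (ft g)"
  shows "L2_entire (rep_ext g)"
  unfolding L2_entire_def
proof (intro conjI allI)
  fix p :: "(complex^'n) \<times> (complex^'n)"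
  obtain C where C: "C \<ge> 0" "\<And>p' \<xi>. norm p' \<le> norm p + 1 \<Longrightarrow> norm (rep_ext g p' \<xi>) \<le> C * exp (- norm \<xi>)"
    using rep_ext_decay[OF g f, of "norm p + 1"] by auto
  show "rep_ext g p \<in> L2"
    by (rule L2_exp_decay(2)[OF borel_measurable_rep_ext[OF g] C(1)]) (rule C(2), simp)
  define T where "T q \<xi> = (rep_ext_differential g p q \<xi>)" for q \<xi>
  have bds: "norm (T q \<xi>) \<le> C * exp (- norm \<xi>)"
      "norm s \<le> 1/2 \<Longrightarrow> norm (rep_slice g p q \<xi> s - rep_ext g p \<xi> - s * T q \<xi>)
          \<le> 8 * (C * exp (- norm \<xi>)) * (norm s)\<^sup>2"
    if "norm q = 1" for q \<xi> s
    unfolding T_def using rep_ext_slice_bounds[OF g C(2) that] by auto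
  have TD1: "T (axis j 1, 0) \<xi> = rep_ext_dfst g p j \<xi>" for j \<xi>
    by (simp add: T_def axis_def if_distrib[of "\<lambda>x. x * _"] cong: if_cong)
  have TD2: "T (0, axis j 1) \<xi> = rep_ext_dsnd g p j \<xi>" for j \<xi>
    by (simp add: T_def axis_def if_distrib[of "\<lambda>x. x * _"] cong: if_cong)
  have rep_ext_dfst: "rep_ext_dfst g p j \<in> L2" for j
    by (rule L2_exp_decay(2)[OF borel_measurable_rep_ext_dfst[OF g] C(1)])
       (use bds(1)[of "(axis j 1, 0)"] in \<open>simp add: TD1 norm_Pair norm_axis_1\<close>)
  have rep_ext_dsnd: "rep_ext_dsnd g p j \<in> L2" for j
    by (rule L2_exp_decay(2)[OF borel_measurable_rep_ext_dsnd[OF g] C(1)])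
       (use bds(1)[of "(0, axis j 1)"] in \<open>simp add: TD2 norm_Pair norm_axis_1\<close>)
  let ?err = "\<lambda>q \<xi>. (rep_ext g (p + q) \<xi> - rep_ext g p \<xi> - T q \<xi>) / of_real (norm q)"
  have [measurable]: "rep_ext_dfst g p j \<in> borel_measurable borel" "rep_ext_dsnd g p j \<in> borel_measurable borel" for j
    by (intro borel_measurable_rep_ext_dfst borel_measurable_rep_ext_dsnd g)+
  have Tm: "T q \<in> borel_measurable borel" for q
  proof -
    have "T q = (\<lambda>\<xi>. \<Sum>j\<in>UNIV. fst q $ j * rep_ext_dfst g p j \<xi>
        + snd q $ j * rep_ext_dsnd g p j \<xi>)" by (simp add: T_def fun_eq_iff)
    then show ?thesis by simp
  qed
  have errb: "norm (?err q \<xi>) \<le> (8 * C * norm q) * exp (- norm \<xi>)" if q: "q \<noteq> 0" "norm q \<le> 1/2" for q \<xi>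
  proof -
    define n where "n = norm q"
    have n: "n > 0" using q by (simp add: n_def)
    define e where "e = (of_real (1 / n) *s fst q, of_real (1 / n) *s snd q)"
    have e1: "norm e = 1" unfolding e_def norm_cscale_Pair using n by (simp add: n_def norm_divide)
    have qe: "fst q = of_real n *s fst e" "snd q = of_real n *s snd e"
      using n by (simp_all add: e_def vec_eq_iff)
    have "rep_slice g p e \<xi> (of_real n) = rep_ext g (p + q) \<xi>"
      unfolding rep_slice_def qe[symmetric] by (simp add: plus_prod_def)
    moreover have "of_real n * T e \<xi> = T q \<xi>"
      unfolding T_def qe by (simp add: sum_distrib_left algebra_simps)
    ultimately have "norm (rep_ext g (p + q) \<xi> - rep_ext g p \<xi> - T q \<xi>)
        \<le> 8 * (C * exp (- norm \<xi>)) * n\<^sup>2"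
      using bds(2)[OF e1, of "of_real n" \<xi>] n q(2) by (simp add: n_def)
    then have "norm (rep_ext g (p + q) \<xi> - rep_ext g p \<xi> - T q \<xi>) / n
        \<le> 8 * (C * exp (- norm \<xi>)) * n\<^sup>2 / n"
      using n by (intro divide_right_mono) auto
    also have "\<dots> = (8 * C * n) * exp (- norm \<xi>)" using n by (simp add: power2_eq_square)
    finally show ?thesis using n by (simp add: norm_divide n_def)
  qed
  define I where "I = (LINT x::real^'n|lborel. exp (- norm x))"
  have "L2_tendsto ?err (\<lambda>\<xi>. 0) (at 0)"
    unfolding L2_tendsto_def
  proof (rule tendsto_sandwich[OF _ _ tendsto_const])
    have "((\<lambda>q::(complex^'n) \<times> (complex^'n). (8 * C * norm q)\<^sup>2 * I)
        \<longlongrightarrow> (8 * C * norm (0::(complex^'n) \<times> (complex^'n)))\<^sup>2 * I) (at 0)"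
      by (intro tendsto_intros)
    then show "((\<lambda>q::(complex^'n) \<times> (complex^'n). ennreal ((8 * C * norm q)\<^sup>2 * I))
        \<longlongrightarrow> 0) (at 0)"
      by (intro tendsto_ennrealI[where x=0, simplified]) simp
    show "\<forall>\<^sub>F q in at 0. L2_sqnorm (\<lambda>x. ?err q x - 0) \<le> ennreal ((8 * C * norm q)\<^sup>2 * I)"
      unfolding eventually_at
    proof (intro exI[of _ "1/2"] conjI ballI impI)
      fix q :: "(complex^'n) \<times> (complex^'n)"
      assume q: "q \<noteq> 0 \<and> dist q 0 < 1/2"
      note [measurable] = borel_measurable_rep_ext[OF g] Tm
      show "L2_sqnorm (\<lambda>x. ?err q x - 0) \<le> ennreal ((8 * C * norm q)\<^sup>2 * I)"
        unfolding I_def diff_0_right by (rule L2_exp_decay(1)) (use C(1) q errb in auto)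
    qed simp
  qed auto
  then show "\<exists>D E. (\<forall>j. D j \<in> L2 \<and> E j \<in> L2) \<and>
        L2_tendsto (\<lambda>q \<xi>. (rep_ext g (p + q) \<xi> - rep_ext g p \<xi> - (\<Sum>j\<in>UNIV. fst q $ j * D j \<xi> + snd q $ j * E j \<xi>)) / of_real (norm q))
          (\<lambda>\<xi>. 0) (at 0)"
    using rep_ext_dfst rep_ext_dsnd unfolding T_def by (intro exI[of _ "rep_ext_dfst g p"] exI[of _ "rep_ext_dsnd g p"]) auto
qed

section \<open>Entire vectors\<close>

lemma AE_lebesgue_translate:
  fixes u :: "'a::euclidean_space"
  assumes "AE x in lebesgue. P x"
  shows "AE x in lebesgue. P (x + u)"
proof -
  have "negligible {x. \<not> P x}"
    using assms unfolding completion.AE_iff_null_sets by (simp add: negligible_iff_null_sets)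
  then have "negligible ((+) (- u) ` {x. \<not> P x})" by (rule negligible_translation)
  moreover have "(+) (- u) ` {x. \<not> P x} = {x. \<not> P (x + u)}"
  proof (intro set_eqI iffI)
    fix x assume "x \<in> {x. \<not> P (x + u)}"
    then show "x \<in> (+) (- u) ` {x. \<not> P x}" by (intro image_eqI[of _ _ "x + u"]) auto
  qed auto
  ultimately show ?thesis
    unfolding completion.AE_iff_null_sets by (simp add: negligible_iff_null_sets)
qed

lemma ft_cmult: "ft (\<lambda>x. c * g x) y = c * ft g y"
  unfolding ft_def mult.assoc by (rule integral_mult_right_zero)

lemma exp_integrable_cmult:
  assumes g: "exp_integrable g" shows "exp_integrable (\<lambda>x. c * g x)"
  unfolding exp_integrable_def
proof (intro conjI allI)
  show "(\<lambda>x. c * g x) \<in> borel_measurable borel" using exp_integrableD(1)[OF g] by simp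
  show "integrable lborel (\<lambda>x. norm (c * g x) * exp (R * norm x))" for R
    using integrable_mult_right[OF exp_integrableD(2)[OF g, of R], of "norm c"] by (simp add: norm_mult mult.assoc)
qed

lemma entire_vector_ft:
  fixes f g :: "real^'n \<Rightarrow> complex"
  assumes f: "f \<in> L2" and g: "exp_integrable g" and fg: "exp_integrable (ft g)"
    and ae: "AE x in lborel. f x = ft g x"
  shows "entire_vector f"
  unfolding entire_vector_def
proof (intro conjI exI[of _ "rep_ext g"] allI impI)
  show "f \<in> L2" by (rule f)
  show "L2_entire (rep_ext g)" by (rule L2_entire_rep_ext[OF g fg])
  show "AE \<xi> in lebesgue. rep_ext g (rvec x, rvec u) \<xi> = schrodinger x u f \<xi>" for x u
    using AE_lebesgue_translate[OF AE_completion[OF ae], of u]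
  proof eventually_elim
    case (elim \<xi>)
    have d: "dotc (rvec x) (rvec z) = of_real (x \<bullet> z)" for z :: "real^'n" by (simp add: dotc_rvec)
    have "ft (modulate (rvec u) g) \<xi> = ft g (\<xi> + u)" unfolding ft_modulate_cvec tilt_0 ..
    then show ?case using elim by (simp add: rep_ext_def schrodinger_def d)
  qed
  fix t :: real and x u :: "real^'n" assume t: "t > 0"
  define r where "r = norm x + norm u + 2 * t"
  have r: "r \<ge> 0" using t by (simp add: r_def)
  obtain C where C: "C \<ge> 0" "\<And>p \<xi>. norm p \<le> r \<Longrightarrow> norm (rep_ext g p \<xi>) \<le> C * exp (- norm \<xi>)"
    using rep_ext_decay[OF g fg r] by auto
  have "(SUP (y, v) \<in> {(y, v). (norm y)\<^sup>2 + (norm v)\<^sup>2 < t\<^sup>2}. L2_sqnorm (rep_ext g (cvec x y, cvec u v)))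
      \<le> ennreal (C\<^sup>2 * (LINT x::real^'n|lborel. exp (- norm x)))"
  proof (rule SUP_least, clarify)
    fix y v :: "real^'n" assume yv: "(norm y)\<^sup>2 + (norm v)\<^sup>2 < t\<^sup>2"
    have "(norm y)\<^sup>2 \<le> t\<^sup>2" "(norm v)\<^sup>2 \<le> t\<^sup>2"
      using yv zero_le_power2[of "norm v"] zero_le_power2[of "norm y"] by linarith+
    then have "norm y \<le> t" "norm v \<le> t" using t by (auto simp: abs_le_square_iff[symmetric])
    then have "norm (cvec x y, cvec u v) \<le> r"
      using norm_Pair_le[of "cvec x y" "cvec u v"] norm_cvec_le[of x y] norm_cvec_le[of u v] by (simp add: r_def)
    then show "L2_sqnorm (rep_ext g (cvec x y, cvec u v))
        \<le> ennreal (C\<^sup>2 * (LINT x::real^'n|lborel. exp (- norm x)))"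
      by (intro L2_exp_decay(1) borel_measurable_rep_ext g C)
  qed
  then show "(SUP (y, v) \<in> {(y, v). (norm y)\<^sup>2 + (norm v)\<^sup>2
      < t\<^sup>2}. L2_sqnorm (rep_ext g (cvec x y, cvec u v))) < \<infinity>"
    by (rule le_less_trans) simp
qed

theorem theorem2p11:
  fixes f :: "real^'n \<Rightarrow> complex" and a :: real
  assumes "f \<in> L2"
    and "a > 0"
    and "K a f < \<infinity>"
  shows "entire_vector f"
proof -
  define N where "N = complex_of_real (sqrt (2 * pi) ^ CARD('n))"
  have N: "N \<noteq> 0" by (simp add: N_def)
  define g where "g = fourier_L2 f"
  have fg: "has_fourier_L2 f g" unfolding g_def by (rule has_fourier_L2_fourier_L2[OF assms(1)])
  obtain f' where f': "f' \<in> borel_measurable borel" "AE x in lborel. f x = f' x"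
    using borel_representative[of f] fg by (auto simp: has_fourier_L2_def L2_def)
  obtain g' where g': "g' \<in> borel_measurable borel" "AE x in lborel. g x = g' x"
    using borel_representative[of g] fg by (auto simp: has_fourier_L2_def L2_def)
  note [measurable] = f'(1) g'(1)
  have Kf: "(\<integral>\<^sup>+x. (\<integral>\<^sup>+y. ennreal (norm (f' x) * norm (g' y)
      * exp (a * \<bar>x \<bullet> y\<bar>)) \<partial>lborel) \<partial>lborel) < \<infinity>"
  proof -
    have "K a f = (\<integral>\<^sup>+x. (\<integral>\<^sup>+y. ennreal (norm (f x)
        * norm (g y) * exp (a * \<bar>x \<bullet> y\<bar>)) \<partial>lborel) \<partial>lborel)"
      by (simp add: K_def g_def nn_integral_completion)
    also have "\<dots> = (\<integral>\<^sup>+x. (\<integral>\<^sup>+y. ennreal (norm (f x)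
        * norm (g' y) * exp (a * \<bar>x \<bullet> y\<bar>)) \<partial>lborel) \<partial>lborel)"
      by (rule nn_integral_cong, rule nn_integral_cong_AE) (use g'(2) in \<open>eventually_elim, simp\<close>)
    also have "\<dots> = (\<integral>\<^sup>+x. (\<integral>\<^sup>+y. ennreal (norm (f' x)
        * norm (g' y) * exp (a * \<bar>x \<bullet> y\<bar>)) \<partial>lborel) \<partial>lborel)"
      by (intro nn_integral_cong_AE) (use f'(2) in \<open>eventually_elim, simp\<close>)
    finally show ?thesis using assms(3) by simp
  qed
  show ?thesis
  proof (cases "AE x in lborel. f' x = 0")
    (* Then f is represented by the transform of the zero function. *)
    case True
    have z: "exp_integrable (\<lambda>x::real^'n. 0)" "ft (\<lambda>x::real^'n. 0) = (\<lambda>x. 0)"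
      by (simp_all add: exp_integrable_def ft_def fun_eq_iff)
    show ?thesis
      by (rule entire_vector_ft[OF assms(1) z(1)], unfold z(2)) (use z(1) True f'(2) in auto)
  next
    case f0: False
    have inv: "AE x in lborel. f' x = (1 / N) * ft g' (1 *\<^sub>R x)" if "integrable lborel g'"
      using has_fourier_L2_inversion[OF fg f' g' that] by (simp add: N_def)
    have g0: "\<not> (AE y in lborel. g' y = 0)"
    proof
      assume z: "AE y in lborel. g' y = 0"
      then have "integrable lborel g'" by (subst integrable_cong_AE[of _ _ "\<lambda>_. 0"]) auto
      note inv[OF this]
      moreover have "ft g' x = 0" for x
        unfolding ft_def by (rule integral_eq_zero_AE) (use z in \<open>eventually_elim, simp\<close>)
      ultimately show False using f0 by simp
    qed
    have fe: "exp_integrable f'"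
      unfolding exp_integrable_def
    proof (intro conjI allI exp_integrable_of_fourier_coupling[OF f'(1) g'(1) Kf assms(2) _ _ g0])
      show "AE y in lborel. g' y = (1 / N) * ft f' (-1 *\<^sub>R y)" if "integrable lborel f'"
        using has_fourier_L2_L1[OF fg f' g' that] by (simp add: N_def)
    qed (use f'(1) in auto)
    have Kg: "(\<integral>\<^sup>+y. (\<integral>\<^sup>+x. ennreal (norm (g' y) * norm (f' x)
        * exp (a * \<bar>y \<bullet> x\<bar>)) \<partial>lborel) \<partial>lborel) < \<infinity>"
      using Kf by (subst lborel_pair.Fubini') (simp_all add: mult_ac inner_commute)
    have ge: "exp_integrable g'"
      unfolding exp_integrable_def
      by (intro conjI allI exp_integrable_of_fourier_coupling[OF g'(1) f'(1) Kg assms(2) inv _ f0]) (use g'(1) in auto)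
    have gi: "integrable lborel g'" by (rule exp_integrable_imp_integrable[OF ge])
    define h where "h x = (1 / N) * g' x" for x
    have he: "exp_integrable h" unfolding h_def by (rule exp_integrable_cmult[OF ge])
    have fth: "ft h x = (1 / N) * ft g' x" for x unfolding h_def by (rule ft_cmult)
    have aeh: "AE x in lborel. f' x = ft h x" using inv[OF gi] by (simp add: fth)
    have hm: "ft h \<in> borel_measurable borel" by (rule borel_measurable_ft[OF exp_integrable_imp_integrable[OF he]])
    have "exp_integrable (ft h)"
      unfolding exp_integrable_def
    proof (intro conjI allI hm)
      fix R
      show "integrable lborel (\<lambda>x. norm (ft h x) * exp (R * norm x))"
        using exp_integrableD(2)[OF fe, of R]
        by (rule integrable_cong_AE_imp) (use hm aeh in \<open>auto elim: eventually_mono\<close>)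
    qed
    moreover have "AE x in lborel. f x = ft h x" using f'(2) aeh by eventually_elim simp
    ultimately show ?thesis by (rule entire_vector_ft[OF assms(1) he])
  qed
qed

end
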